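(* Let $\mathbb S=R[X;\boldsymbol\alpha,\boldsymbol\delta]$ be a skew polynomial ring of bijective type over a well-ordered set of variables, and suppose that $\delta_\kappa(\mathcal Z(R)T_\kappa)=0$ for every $\kappa<\Omega$. Let $A$ be an essentially special subextension of $\mathbb S$. Then every uniform (respectively, essential) left ideal $L$ of $R$ gives a uniform (respectively, essential) left ideal $A\cap AL$ of $A$, and $\mathcal Z(A)=A\cap\mathcal Z(R)T$. Moreover, if $R$ has enough uniform left ideals, then so does $A$, and $\operatorname{udim}(A)=\operatorname{udim}(R)$.
   Context: Setting (M): $R$ a ring, $\Omega$ an ordinal, $X=\{x_s:s<\Omega\}$; $T_\kappa$ the standard terms $x_{s_1}\cdots x_{s_n}$ ($n\in\mathbb N$, $s_1\le\cdots\le s_n<\kappa$), $T=T_\Omega$; $\mathbb S$ has subrings $\mathbb S_\kappa$ ($\kappa\le\Omega$) with $\mathbb S_0=R$, $\mathbb S_\Omega=\mathbb S$, $\mathbb S_\kappa$ free as left $R$-module on $T_\kappa$, $\mathbb S_{\kappa+1}=\mathbb S_\kappa[x_\kappa;\alpha_\kappa,\delta_\kappa]$ an Ore extension (free left $\mathbb S_\kappa$-module on $\{x_\kappa^n\}$, $x_\kappa p=\alpha_\kappa(p)x_\kappa+\delta_\kappa(p)$) with $\alpha_\kappa$ a ring automorphism and $\delta_\kappa$ an $\alpha_\kappa$-derivation of $\mathbb S_\kappa$, and $\mathbb S_\kappa=\bigcup_{\eta<\kappa}\mathbb S_\eta$ for limit $\kappa$. $\mathcal Z(R)T_\kappa$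 is the set of elements of $\mathbb S_\kappa$ all of whose coefficients w.r.t. $T_\kappa$ lie in the left singular ideal $\mathcal Z(R)$. Univariate notions (for a ring $S\supseteq R$ free as left $R$-module, $x$ an Ore variable over $S$, $\deg_x$ the $x$-degree): for a subring $A\supseteq R$ of $S[x;\alpha,\delta]$, $\operatorname{Deg}_x(A)=\{\deg_xf:0\ne f\in A\}$, $d_A=\gcd(\operatorname{Deg}_x(A)\setminus\{0\})$ if $A\not\subseteq S$, else $0$. $A$ is a special subextension if $A=\sum_m(A\cap Sx^m)$, $\operatorname{Deg}_x(A)=d_A\mathbb N$, and for each $0\ne m\in\operatorname{Deg}_x(A)$ there exist $\lambda_m=\upsilon_mx^m\in A$ with $\upsilon_m$ regular in $S$, a subring $B_m$ with $R\subseteq B_m\subseteq A\cap S$, and an automorphism $\alpha_{(m)}$ of $B_m$ with $\deg_x(\lambda_mp-\alpha_{(m)}(p)\lambda_m)<m$ for $p\in B_m$, and for every $q\in S$ with $qx^m\in A$ some $u\in B_m$ regular in $S$ with $uqx^m\in B_m\lambda_m$; for $m=0$: $\lambda_0=1$, $B_0=A\cap S$, $\alpha_{(0)}=\mathrm{id}$. A subring $A$ of a ring $B$ is nicely essential if for every finite set $E\subseteq B$ of non-zero elements there is $a\in A$ with $0\ne ax\in A$ for all $x\in E$. Essentially special subextension of $\mathbb S$ (defined by induction on $\Omega$): if $\Omega=0$, a nicely essential subring of $R$ containing... i.e. any nicely essential subring $A$ of $R$; if $\Omega$ is a limit ordinal, a union $A=\bigcup_{\kappa\in\Lambda}A_\kappa$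 of an increasing family, $\Lambda\subseteq\Omega$, where each $A_\kappa$ is an essentially special subextension of $\mathbb S_\kappa$; if $\Omega=\kappa+1$, a nicely essential subring $A$ of some special subextension $\widetilde A$ of $\mathbb S=\mathbb S_\kappa[x_\kappa;\alpha_\kappa,\delta_\kappa]$ (viewed as univariate Ore extension over $S=\mathbb S_\kappa$) such that, for every $m\in\operatorname{Deg}_{x_\kappa}(\widetilde A)$, the attached ring $B_m$ is an essentially special subextension of $\mathbb S_\kappa$. $\operatorname{udim}$ is left uniform dimension (possibly infinite); enough uniform left ideals means every non-zero left ideal contains a uniform left ideal. *)

theory Defs
  imports Main "HOL-Library.Extended_Nat"
begin

definition subring :: "'a::ring_1 set \<Rightarrow> bool" where
  "subring A \<longleftrightarrow> 1 \<in> A \<and> (\<forall>a\<in>A. \<forall>b\<in>A. a - b \<in> A \<and> a * b \<in> A)"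

definition left_ideal :: "'a::ring_1 set \<Rightarrow> 'a set \<Rightarrow> bool" where
  "left_ideal A L \<longleftrightarrow> L \<subseteq> A \<and> 0 \<in> L \<and> (\<forall>a\<in>L. \<forall>b\<in>L. a - b \<in> L)
     \<and> (\<forall>r\<in>A. \<forall>a\<in>L. r * a \<in> L)"

definition essential_li :: "'a::ring_1 set \<Rightarrow> 'a set \<Rightarrow> bool" where
  "essential_li A L \<longleftrightarrow> left_ideal A L \<and>
     (\<forall>M. left_ideal A M \<and> M \<noteq> {0} \<longrightarrow> L \<inter> M \<noteq> {0})"

definition uniform_li :: "'a::ring_1 set \<Rightarrow> 'a set \<Rightarrow> bool" where
  "uniform_li A L \<longleftrightarrow> left_ideal A L \<and> L \<noteq> {0} \<and>
     (\<forall>M N. left_ideal A M \<and> left_ideal A N \<and> M \<subseteq> L \<and> N \<subseteq> L \<and> M \<noteq> {0} \<and> N \<noteq> {0}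
        \<longrightarrow> M \<inter> N \<noteq> {0})"

definition lann :: "'a::ring_1 set \<Rightarrow> 'a \<Rightarrow> 'a set" where
  "lann A a = {b \<in> A. b * a = 0}"

definition sing_ideal :: "'a::ring_1 set \<Rightarrow> 'a set" where
  "sing_ideal A = {a \<in> A. essential_li A (lann A a)}"

definition enough_uniform :: "'a::ring_1 set \<Rightarrow> bool" where
  "enough_uniform A \<longleftrightarrow> (\<forall>L. left_ideal A L \<and> L \<noteq> {0} \<longrightarrow> (\<exists>U. U \<subseteq> L \<and> uniform_li A U))"

definition udim :: "'a::ring_1 set \<Rightarrow> enat" where
  "udim A = Sup {enat n | n. \<exists>Ls :: nat \<Rightarrow> 'a set.
       (\<forall>i<n. left_ideal A (Ls i) \<and> Ls i \<noteq> {0}) \<and>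
       (\<forall>c. (\<forall>i<n. c i \<in> Ls i) \<and> (\<Sum>i<n. c i) = 0 \<longrightarrow> (\<forall>i<n. c i = 0))}"

definition prod_span :: "'a::ring_1 set \<Rightarrow> 'a set \<Rightarrow> 'a set" where
  "prod_span A L = {y. \<exists>(n::nat) a l. (\<forall>i<n. a i \<in> A \<and> l i \<in> L) \<and> y = (\<Sum>i<n. a i * l i)}"

definition nicely_ess :: "'a::ring_1 set \<Rightarrow> 'a set \<Rightarrow> bool" where
  "nicely_ess A B \<longleftrightarrow> subring A \<and> A \<subseteq> B \<and>
     (\<forall>E. finite E \<and> E \<subseteq> B - {0} \<longrightarrow> (\<exists>a\<in>A. \<forall>y\<in>E. a * y \<noteq> 0 \<and> a * y \<in> A))"

definition regular :: "'a::ring_1 set \<Rightarrow> 'a \<Rightarrow> bool" where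
  "regular S u \<longleftrightarrow> u \<in> S \<and> (\<forall>s\<in>S. s * u = 0 \<longrightarrow> s = 0) \<and> (\<forall>s\<in>S. u * s = 0 \<longrightarrow> s = 0)"

definition lin_comb :: "'a::ring_1 set \<Rightarrow> 'a set \<Rightarrow> 'a set" where
  "lin_comb R T = {y. \<exists>F c. finite F \<and> F \<subseteq> T \<and> (\<forall>t\<in>F. c t \<in> R) \<and> y = (\<Sum>t\<in>F. c t * t)}"

definition lin_indep :: "'a::ring_1 set \<Rightarrow> 'a set \<Rightarrow> bool" where
  "lin_indep R T \<longleftrightarrow> (\<forall>F c. finite F \<and> F \<subseteq> T \<and> (\<forall>t\<in>F. c t \<in> R) \<and> (\<Sum>t\<in>F. c t * t) = 0
      \<longrightarrow> (\<forall>t\<in>F. c t = 0))"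

text \<open>Initial segments ("ordinals \<le> \<Omega>") of the well-ordered index type.\<close>
definition down_closed :: "'v::wellorder set \<Rightarrow> bool" where
  "down_closed I \<longleftrightarrow> (\<forall>s t. t \<in> I \<and> s \<le> t \<longrightarrow> s \<in> I)"

definition std_terms :: "('v::wellorder \<Rightarrow> 'a::ring_1) \<Rightarrow> 'v set \<Rightarrow> 'a set" where
  "std_terms x I = {prod_list (map x ss) | ss. sorted ss \<and> set ss \<subseteq> I}"

definition Sk :: "'a::ring_1 set \<Rightarrow> ('v::wellorder \<Rightarrow> 'a) \<Rightarrow> 'v set \<Rightarrow> 'a set" where
  "Sk R x I = lin_comb R (std_terms x I)"

definition ZT :: "'a::ring_1 set \<Rightarrow> ('v::wellorder \<Rightarrow> 'a) \<Rightarrow> 'v set \<Rightarrow> 'a set" where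
  "ZT R x I = lin_comb (sing_ideal R) (std_terms x I)"

definition automorph :: "'a::ring_1 set \<Rightarrow> ('a \<Rightarrow> 'a) \<Rightarrow> bool" where
  "automorph S f \<longleftrightarrow> bij_betw f S S \<and> f 1 = 1 \<and>
     (\<forall>a\<in>S. \<forall>b\<in>S. f (a + b) = f a + f b \<and> f (a * b) = f a * f b)"

definition alpha_derivation :: "'a::ring_1 set \<Rightarrow> ('a \<Rightarrow> 'a) \<Rightarrow> ('a \<Rightarrow> 'a) \<Rightarrow> bool" where
  "alpha_derivation S \<alpha> \<delta> \<longleftrightarrow> (\<forall>a\<in>S. \<delta> a \<in> S) \<and>
     (\<forall>a\<in>S. \<forall>b\<in>S. \<delta> (a + b) = \<delta> a + \<delta> b \<and> \<delta> (a * b) = \<alpha> a * \<delta> b + \<delta> a * b)"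

definition ore_ext :: "'a::ring_1 set \<Rightarrow> 'a \<Rightarrow> 'a set \<Rightarrow> ('a \<Rightarrow> 'a) \<Rightarrow> ('a \<Rightarrow> 'a) \<Rightarrow> bool" where
  "ore_ext S x S' \<alpha> \<delta> \<longleftrightarrow> S' = lin_comb S (range (\<lambda>n. x ^ n)) \<and>
     (\<forall>N c. (\<forall>n. c n \<in> S) \<and> (\<Sum>n\<le>N. c n * x ^ n) = 0 \<longrightarrow> (\<forall>n\<le>N. c n = 0)) \<and>
     automorph S \<alpha> \<and> alpha_derivation S \<alpha> \<delta> \<and> (\<forall>p\<in>S. x * p = \<alpha> p * x + \<delta> p)"

text \<open>x-degree (over S): least n with f in S + S x + ... + S x^n (the degree, by freeness).\<close>
definition degx :: "'a::ring_1 set \<Rightarrow> 'a \<Rightarrow> 'a \<Rightarrow> nat" where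
  "degx S x f = (LEAST n. \<exists>c. (\<forall>i. c i \<in> S) \<and> f = (\<Sum>i\<le>n. c i * x ^ i))"

definition Degs :: "'a::ring_1 set \<Rightarrow> 'a \<Rightarrow> 'a set \<Rightarrow> nat set" where
  "Degs S x A = {degx S x f | f. f \<in> A \<and> f \<noteq> 0}"

definition dA :: "'a::ring_1 set \<Rightarrow> 'a \<Rightarrow> 'a set \<Rightarrow> nat" where
  "dA S x A = (if A \<subseteq> S then 0 else Gcd (Degs S x A - {0}))"

definition special ::
  "'a::ring_1 set \<Rightarrow> 'a \<Rightarrow> 'a set \<Rightarrow> 'a set \<Rightarrow> 'a set \<Rightarrow> (nat \<Rightarrow> 'a) \<Rightarrow> (nat \<Rightarrow> 'a set)
     \<Rightarrow> (nat \<Rightarrow> 'a \<Rightarrow> 'a) \<Rightarrow> bool" where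
  "special S x R S' A lam B alm \<longleftrightarrow>
     subring A \<and> R \<subseteq> A \<and> A \<subseteq> S' \<and>
     (\<forall>a\<in>A. \<exists>N c. (\<forall>m. c m \<in> S \<and> c m * x ^ m \<in> A) \<and> a = (\<Sum>m\<le>N. c m * x ^ m)) \<and>
     Degs S x A = {dA S x A * n | n. True} \<and>
     lam 0 = 1 \<and> B 0 = A \<inter> S \<and> (\<forall>p\<in>B 0. alm 0 p = p) \<and>
     (\<forall>m\<in>Degs S x A. m \<noteq> 0 \<longrightarrow>
        (\<exists>v. regular S v \<and> lam m = v * x ^ m) \<and> lam m \<in> A \<and>
        subring (B m) \<and> R \<subseteq> B m \<and> B m \<subseteq> A \<inter> S \<and> automorph (B m) (alm m) \<and>
        (\<forall>p\<in>B m. degx S x (lam m * p - alm m p * lam m) < m) \<and>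
        (\<forall>q\<in>S. q * x ^ m \<in> A \<longrightarrow> (\<exists>u\<in>B m. regular S u \<and> (\<exists>b\<in>B m. u * q * x ^ m = b * lam m))))"

inductive ess_sp :: "'a::ring_1 set \<Rightarrow> ('v::wellorder \<Rightarrow> 'a) \<Rightarrow> 'v set \<Rightarrow> 'a set \<Rightarrow> bool"
  for R x where
  zero: "nicely_ess A R \<Longrightarrow> ess_sp R x {} A"
| lim: "\<lbrakk> I \<noteq> {}; down_closed I; \<forall>m\<in>I. \<exists>s\<in>I. m < s; \<Lambda> \<subseteq> I; \<Lambda> \<noteq> {};
          \<forall>j\<in>\<Lambda>. \<forall>j'\<in>\<Lambda>. j \<le> j' \<longrightarrow> Af j \<subseteq> Af j';
          \<forall>j\<in>\<Lambda>. ess_sp R x {s. s < j} (Af j);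
          A = (\<Union>j\<in>\<Lambda>. Af j) \<rbrakk> \<Longrightarrow> ess_sp R x I A"
| succ: "\<lbrakk> special (Sk R x {s. s < k}) (x k) R (Sk R x {s. s \<le> k}) At lam B alm;
           \<forall>m\<in>Degs (Sk R x {s. s < k}) (x k) At. ess_sp R x {s. s < k} (B m);
           nicely_ess A At \<rbrakk> \<Longrightarrow> ess_sp R x {s. s \<le> k} A"

end

theory Submission
  imports Defs
begin

text \<open>
  Call \<open>A\<close> good if \<open>AL\<close> is essential (uniform) in \<open>A\<close> whenever \<open>L\<close> is so in \<open>R\<close>. Goodness passes to
  nicely essential subrings and to unions of chains, so everything is about a special subextension
  \<open>A\<close> of \<open>S[x; \<alpha>, \<delta>]\<close> whose rings \<open>B\<^sub>m\<close> are good. After multiplication by a regular element of \<open>A \<inter> S\<close>,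
  every \<open>f \<in> AL\<close> of degree \<open>m\<close> has the form \<open>\<lambda>\<^sub>m z +\<close> (lower terms) with \<open>z \<in> B\<^sub>mL\<close>, and one argues by
  induction on the degree with \<open>B\<^sub>m\<close> acting on leading coefficients. Subtracting two elements with the
  same leading term is harmless as long as annihilators are controlled.
  Off the singular ideal this is possible because \<open>a \<notin> \<Z>(R)T\<close> admits \<open>0 \<noteq> j \<in> R\<close> with \<open>sja = 0 \<Longrightarrow> sj = 0\<close>
  for all \<open>s\<close>; on \<open>\<Z>(R)T\<close> it is possible because \<open>\<delta>\<close> vanishes there, so that \<open>x\<close> commutes with the
  coefficients up to \<open>\<alpha>\<close>. The same element \<open>j\<close> gives \<open>\<Z>(A) \<subseteq> \<Z>(R)T\<close>, and the converse
  inclusion follows from essentiality of \<open>AK\<close>, where \<open>K\<close> annihilates the coefficients.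

  Since every \<open>\<alpha>\<close> is bijective the whole ring is also free as a right \<open>R\<close>-module, so independent left
  ideals of \<open>R\<close> extend to independent left ideals. A maximal independent family of uniform left ideals
  of \<open>R\<close> therefore extends to one of \<open>A\<close> with essential sum, which yields the statement on uniform dimension.
\<close>

section \<open>Left ideals and subrings\<close>

text \<open>The obstacle is annihilation. When \<open>f\<close> and \<open>g\<close> share their
  leading term, induction yields a common multiple \<open>t * (f - g) = s * g\<close>, and the
  resulting relation for \<open>f\<close> is void if \<open>t * f = 0\<close>. A uniform
  \<open>L\<close> is therefore split at its intersection with Z(R). If this is 0, right freeness
  keeps the elements \<open>z\<close> of the leading terms out of Z(R)T. If not, \<open>L\<close>
  may be replaced by the intersection: a complement \<open>C\<close> of it in \<open>R\<close> also
  satisfies \<open>L \<inter> C = {0}\<close>, and right freeness preserves this after extension, so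
  essentiality of the extended sum moves non-zero elements of \<open>AL\<close> into the smaller
  span. A second obstacle is that Z(R)T is defined by left coefficients, which hide its stability
  under left multiplication and under \<alpha>. Both come from identifying it with the singular
  ideal of the stage, and that needs essentiality in the stage. Hence the essential part is
  established for the whole tower, independently of the given \<open>A\<close>.\<close>

abbreviation principal :: "'a::ring_1 set \<Rightarrow> 'a \<Rightarrow> 'a set" where
  "principal A f \<equiv> (\<lambda>r. r * f) ` A"

abbreviation multiple_in :: "'a::ring_1 set \<Rightarrow> 'a \<Rightarrow> 'a set \<Rightarrow> bool" where
  "multiple_in A f W \<equiv> \<exists>q\<in>A. q * f \<noteq> 0 \<and> q * f \<in> W"

abbreviation common_multiple :: "'a::ring_1 set \<Rightarrow> 'a \<Rightarrow> 'a \<Rightarrow> bool" where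
  "common_multiple A f g \<equiv> \<exists>s\<in>A. \<exists>t\<in>A. s * f = t * g \<and> s * f \<noteq> 0"

lemma subring_one: "subring A \<Longrightarrow> 1 \<in> A"
  and subring_diff: "subring A \<Longrightarrow> a \<in> A \<Longrightarrow> b \<in> A \<Longrightarrow> a - b \<in> A"
  and subring_mult: "subring A \<Longrightarrow> a \<in> A \<Longrightarrow> b \<in> A \<Longrightarrow> a * b \<in> A"
  by (auto simp: subring_def)

lemma subring_zero: "subring A \<Longrightarrow> 0 \<in> A"
  using subring_diff[of A 1 1] subring_one by force

lemma subring_uminus: "subring A \<Longrightarrow> a \<in> A \<Longrightarrow> - a \<in> A"
  using subring_diff[of A 0 a] subring_zero by force

lemma subring_add: "subring A \<Longrightarrow> a \<in> A \<Longrightarrow> b \<in> A \<Longrightarrow> a + b \<in> A"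
  using subring_diff[of A a "- b"] subring_uminus by force

lemma subring_sum: "subring A \<Longrightarrow> (\<And>i. i \<in> F \<Longrightarrow> f i \<in> A) \<Longrightarrow> sum f F \<in> A"
  by (induction F rule: infinite_finite_induct) (auto intro: subring_zero subring_add)

lemma subring_power: "subring A \<Longrightarrow> a \<in> A \<Longrightarrow> a ^ n \<in> A"
  by (induction n) (auto intro: subring_one subring_mult)

lemmas subring_closed = subring_zero subring_one subring_diff subring_uminus subring_add
  subring_mult subring_power

lemma left_ideal_subset: "left_ideal A L \<Longrightarrow> a \<in> L \<Longrightarrow> a \<in> A"
  and left_ideal_zero: "left_ideal A L \<Longrightarrow> 0 \<in> L"
  and left_ideal_diff: "left_ideal A L \<Longrightarrow> a \<in> L \<Longrightarrow> b \<in> L \<Longrightarrow> a - b \<in> L"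
  and left_ideal_mult: "left_ideal A L \<Longrightarrow> r \<in> A \<Longrightarrow> a \<in> L \<Longrightarrow> r * a \<in> L"
  by (auto simp: left_ideal_def)

lemma left_ideal_uminus: "left_ideal A L \<Longrightarrow> a \<in> L \<Longrightarrow> - a \<in> L"
  using left_ideal_diff[of A L 0 a] left_ideal_zero by force

lemma left_ideal_add: "left_ideal A L \<Longrightarrow> a \<in> L \<Longrightarrow> b \<in> L \<Longrightarrow> a + b \<in> L"
  using left_ideal_diff[of A L a "- b"] left_ideal_uminus by force

lemma left_ideal_sum: "left_ideal A L \<Longrightarrow> (\<And>i. i \<in> F \<Longrightarrow> f i \<in> L) \<Longrightarrow> sum f F \<in> L"
  by (induction F rule: infinite_finite_induct) (auto intro: left_ideal_zero left_ideal_add)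

lemma left_ideal_Int: "left_ideal A L \<Longrightarrow> left_ideal A M \<Longrightarrow> left_ideal A (L \<inter> M)"
  by (auto simp: left_ideal_def)

lemma left_ideal_self: "subring A \<Longrightarrow> left_ideal A A"
  by (auto simp: left_ideal_def simp: subring_closed)

lemma left_ideal_principal:
  assumes "subring A" "f \<in> A"
  shows "left_ideal A (principal A f)"
  unfolding left_ideal_def
proof (intro conjI ballI)
  show "principal A f \<subseteq> A" using assms by (auto simp: subring_closed)
  show "0 \<in> principal A f" using subring_zero[OF assms(1)] by (metis image_eqI mult_zero_left)
  show "a - b \<in> principal A f" if ab: "a \<in> principal A f" "b \<in> principal A f" for a b
  proof -
    obtain r s where "a = r * f" "b = s * f" "r \<in> A" "s \<in> A" using ab by auto
    then have "a - b = (r - s) * f" "r - s \<in> A"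
      using assms by (auto simp: left_diff_distrib simp: subring_closed)
    then show ?thesis by blast
  qed
  show "r * a \<in> principal A f" if ab: "r \<in> A" "a \<in> principal A f" for r a
  proof -
    obtain s where "a = s * f" "s \<in> A" using ab by auto
    then have "r * a = (r * s) * f" "r * s \<in> A"
      using assms ab by (auto simp: mult.assoc simp: subring_closed)
    then show ?thesis by blast
  qed
qed

lemma self_in_principal: "subring A \<Longrightarrow> f \<in> principal A f"
  by (auto intro!: image_eqI[of _ _ 1] subring_one)

text \<open>As \<open>A\<close> contains \<open>1\<close>, a non-zero \<open>f\<close> lies in
  \<open>principal A f\<close>, so testing against principal left ideals is enough. The element-wise
  form exhibits the multiplier, whose degree and location matter later.\<close>

lemma essential_li_iff:
  assumes "subring A"
  shows "essential_li A W \<longleftrightarrow> left_ideal A W \<and> (\<forall>f\<in>A - {0}. multiple_in A f W)"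
proof (intro iffI conjI ballI)
  fix f assume e: "essential_li A W" and f: "f \<in> A - {0}"
  have "principal A f \<noteq> {0}" using self_in_principal[OF assms, of f] f by auto
  then have "W \<inter> principal A f \<noteq> {0}"
    using e left_ideal_principal[OF assms, of f] f unfolding essential_li_def by auto
  moreover have "0 \<in> W \<inter> principal A f"
    using e left_ideal_principal[OF assms, of f] f unfolding essential_li_def left_ideal_def by auto
  ultimately show "multiple_in A f W" by auto
next
  assume *: "left_ideal A W \<and> (\<forall>f\<in>A - {0}. multiple_in A f W)"
  show "essential_li A W" unfolding essential_li_def
  proof (intro conjI allI impI)
    fix M assume M: "left_ideal A M \<and> M \<noteq> {0}"
    then obtain f where f: "f \<in> M" "f \<noteq> 0" using left_ideal_zero by blast
    then have "f \<in> A - {0}" using M left_ideal_subset by blast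
    then obtain q where "q \<in> A" "q * f \<noteq> 0" "q * f \<in> W" using * by blast
    then show "W \<inter> M \<noteq> {0}" using M f left_ideal_mult[of A M q f] by auto
  qed (use * in auto)
qed (auto simp: essential_li_def)

lemma uniform_li_iff:
  assumes "subring A"
  shows "uniform_li A W \<longleftrightarrow> left_ideal A W \<and> W \<noteq> {0} \<and>
    (\<forall>f\<in>W - {0}. \<forall>g\<in>W - {0}. common_multiple A f g)"
proof (intro iffI conjI ballI)
  fix f g assume u: "uniform_li A W" and f: "f \<in> W - {0}" and g: "g \<in> W - {0}"
  have W: "left_ideal A W" using u by (auto simp: uniform_li_def)
  have fA: "f \<in> A" "g \<in> A" using f g W left_ideal_subset by blast+
  have "principal A f \<noteq> {0}" using self_in_principal[OF assms, of f] f by auto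
  moreover have "principal A g \<noteq> {0}" using self_in_principal[OF assms, of g] g by auto
  moreover have "principal A f \<subseteq> W" "principal A g \<subseteq> W"
    using W f g left_ideal_mult by blast+
  moreover note li = left_ideal_principal[OF assms fA(1)] left_ideal_principal[OF assms fA(2)]
  ultimately have "principal A f \<inter> principal A g \<noteq> {0}"
    using u unfolding uniform_li_def by meson
  moreover have "0 \<in> principal A f \<inter> principal A g"
    using li[THEN left_ideal_zero] by blast
  ultimately obtain y where "y \<in> principal A f \<inter> principal A g" "y \<noteq> 0" by blast
  then show "common_multiple A f g" by auto
next
  assume *: "left_ideal A W \<and> W \<noteq> {0} \<and>
    (\<forall>f\<in>W - {0}. \<forall>g\<in>W - {0}. common_multiple A f g)"
  show "uniform_li A W" unfolding uniform_li_def
  proof (intro conjI allI impI)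
    fix M N assume MN: "left_ideal A M \<and> left_ideal A N \<and> M \<subseteq> W \<and> N \<subseteq> W \<and> M \<noteq> {0} \<and> N \<noteq> {0}"
    then obtain f g where fg: "f \<in> M" "f \<noteq> 0" "g \<in> N" "g \<noteq> 0" using left_ideal_zero by blast
    then have "f \<in> W - {0}" "g \<in> W - {0}" using MN by auto
    then obtain s t where "s \<in> A" "t \<in> A" "s * f = t * g" "s * f \<noteq> 0" using * by blast
    then have "s * f \<in> M \<inter> N" "s * f \<noteq> 0"
      using MN fg left_ideal_mult[of A M s f] left_ideal_mult[of A N t g] by auto
    then show "M \<inter> N \<noteq> {0}" by auto
  qed (use * in auto)
qed (auto simp: uniform_li_def)

section \<open>The additive span \<open>AL\<close> of products, for an arbitrary set of left
  factors\<close>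

lemma prod_span_zero: "0 \<in> prod_span A L"
  unfolding prod_span_def by (auto intro!: exI[of _ 0])

lemma prod_span_Cons:
  assumes "a \<in> A" "l \<in> L" "y \<in> prod_span A L"
  shows "a * l + y \<in> prod_span A L"
proof -
  obtain n :: nat and b m where *: "\<forall>i<n. b i \<in> A \<and> m i \<in> L" "y = (\<Sum>i<n. b i * m i)"
    using assms(3) unfolding prod_span_def by auto
  have "\<forall>i<Suc n. (b(n := a)) i \<in> A \<and> (m(n := l)) i \<in> L" using * assms by (auto simp: less_Suc_eq)
  moreover have "(\<Sum>i<Suc n. (b(n := a)) i * (m(n := l)) i) = a * l + y" using * by simp
  ultimately show ?thesis unfolding prod_span_def
    by (intro CollectI exI[of _ "Suc n"] exI[of _ "b(n := a)"] exI[of _ "m(n := l)"]) simp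
qed

lemma prod_span_mem: "a \<in> A \<Longrightarrow> l \<in> L \<Longrightarrow> a * l \<in> prod_span A L"
  using prod_span_Cons[of a A l L 0] prod_span_zero[of A L] by simp

lemma prod_span_induct [consumes 1, case_names zero Cons]:
  assumes "y \<in> prod_span A L" "P 0"
    "\<And>a l y. a \<in> A \<Longrightarrow> l \<in> L \<Longrightarrow> y \<in> prod_span A L \<Longrightarrow> P y \<Longrightarrow> P (a * l + y)"
  shows "P y"
proof -
  have "(\<forall>i<n. a i \<in> A \<and> l i \<in> L) \<longrightarrow> P (\<Sum>i<n. a i * l i) \<and> (\<Sum>i<n. a i * l i) \<in> prod_span A L"
    for n :: nat and a l
  proof (induction n)
    case 0 then show ?case by (simp add: assms(2) prod_span_zero)
  next
    case (Suc n)
    then show ?case using assms(3)[of "a n" "l n" "\<Sum>i<n. a i * l i"]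
        prod_span_Cons[of "a n" A "l n" L "\<Sum>i<n. a i * l i"]
      by (simp add: add.commute)
  qed
  then show ?thesis using assms(1) unfolding prod_span_def by auto
qed

lemma prod_span_add: "y \<in> prod_span A L \<Longrightarrow> z \<in> prod_span A L \<Longrightarrow> y + z \<in> prod_span A L"
  by (induction y rule: prod_span_induct) (auto simp: add.assoc intro: prod_span_Cons)

lemma prod_span_sum: "(\<And>i. i \<in> F \<Longrightarrow> f i \<in> prod_span A L) \<Longrightarrow> sum f F \<in> prod_span A L"
  by (induction F rule: infinite_finite_induct) (auto intro: prod_span_zero prod_span_add)

lemma prod_span_mono: "y \<in> prod_span A L \<Longrightarrow> A \<subseteq> A' \<Longrightarrow> L \<subseteq> L' \<Longrightarrow> y \<in> prod_span A' L'"
  by (induction y rule: prod_span_induct) (auto intro: prod_span_zero prod_span_Cons)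

text \<open>The set of left factors may change: it is applied to sets such as
  \<open>A \<inter> P n\<close>, which are not subrings, and to multipliers that push finitely many
  factors into a smaller ring.\<close>

lemma prod_span_mult_left:
  assumes "y \<in> prod_span A L" "\<And>a. a \<in> A \<Longrightarrow> c * a \<in> A'"
  shows "c * y \<in> prod_span A' L"
  using assms(1)
proof (induction rule: prod_span_induct)
  case zero then show ?case by (simp add: prod_span_zero)
next
  case (Cons a l y)
  have "(c * a) * l + c * y \<in> prod_span A' L" using Cons assms(2) by (intro prod_span_Cons) auto
  then show ?case by (simp add: distrib_left mult.assoc)
qed

lemma prod_span_uminus:
  assumes "y \<in> prod_span A L" "\<And>a. a \<in> A \<Longrightarrow> - a \<in> A"
  shows "- y \<in> prod_span A L"
proof -
  have "- 1 * y \<in> prod_span A L"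
    using assms(1) by (rule prod_span_mult_left) (simp only: mult_minus1 assms(2))
  then show ?thesis by (simp only: mult_minus1)
qed

lemma prod_span_subset:
  assumes "subring A" "L \<subseteq> A" "y \<in> prod_span A L"
  shows "y \<in> A"
  using assms(3)
proof (induction rule: prod_span_induct)
  case zero then show ?case using subring_zero[OF assms(1)] .
next
  case (Cons a l y)
  then show ?case using assms(2) by (intro subring_add[OF assms(1)] subring_mult[OF assms(1)]) auto
qed

lemma left_ideal_Int_prod_span:
  assumes "subring A"
  shows "left_ideal A (A \<inter> prod_span A L)"
  unfolding left_ideal_def
proof (intro conjI ballI)
  fix a b assume ab: "a \<in> A \<inter> prod_span A L" "b \<in> A \<inter> prod_span A L"
  then have "a + - b \<in> prod_span A L"
    using assms by (intro prod_span_add prod_span_uminus) (auto simp: subring_closed)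
  then show "a - b \<in> A \<inter> prod_span A L" using ab assms by (auto simp: subring_closed)
next
  fix r a assume "r \<in> A" "a \<in> A \<inter> prod_span A L"
  then show "r * a \<in> A \<inter> prod_span A L"
    using assms subring_mult[OF assms] by (auto intro: prod_span_mult_left[of a A])
qed (auto intro: subring_closed prod_span_zero assms)

lemma left_ideal_prod_span:
  assumes "subring A" "L \<subseteq> A"
  shows "left_ideal A (prod_span A L)"
proof -
  have "A \<inter> prod_span A L = prod_span A L" using prod_span_subset[OF assms] by auto
  then show ?thesis using left_ideal_Int_prod_span[OF assms(1), of L] by simp
qed

lemma prod_span_left_ideal:
  assumes "left_ideal A L" "y \<in> prod_span A L"
  shows "y \<in> L"
  using assms(2)
proof (induction rule: prod_span_induct)
  case zero then show ?case using left_ideal_zero[OF assms(1)] .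
next
  case (Cons a l y)
  then show ?case by (intro left_ideal_add[OF assms(1)] left_ideal_mult[OF assms(1)]) auto
qed

text \<open>Only finitely many left factors occur in one element; this lets a single multiplier
  clear all of them, or a single member of a chain contain them all.\<close>

lemma prod_span_finite:
  assumes "y \<in> prod_span A L"
  shows "\<exists>F. finite F \<and> F \<subseteq> A \<and> y \<in> prod_span F L"
  using assms
proof (induction rule: prod_span_induct)
  case zero then show ?case using prod_span_zero by blast
next
  case (Cons a l y)
  then obtain F where F: "finite F" "F \<subseteq> A" "y \<in> prod_span F L" by blast
  then have "y \<in> prod_span (insert a F) L" using prod_span_mono[of y F L "insert a F" L] by blast
  then have "a * l + y \<in> prod_span (insert a F) L" using Cons by (intro prod_span_Cons) auto
  then show ?case using F Cons by (intro exI[of _ "insert a F"]) auto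
qed

text \<open>Repeated terms are merged by adding their coefficients, which uses closure of
  \<open>R\<close> under addition. Afterwards the induction rule of \<open>prod_span\<close> serves
  for \<open>lin_comb\<close> as well.\<close>

lemma lin_comb_eq_prod_span:
  assumes "0 \<in> R" "\<And>a b. a \<in> R \<Longrightarrow> b \<in> R \<Longrightarrow> a + b \<in> R"
  shows "lin_comb R T = prod_span R T"
proof (intro equalityI subsetI)
  fix y assume "y \<in> lin_comb R T"
  then show "y \<in> prod_span R T" unfolding lin_comb_def
    by (auto intro!: prod_span_sum prod_span_mem)
next
  fix y assume "y \<in> prod_span R T"
  then show "y \<in> lin_comb R T"
  proof (induction rule: prod_span_induct)
    case zero
    show ?case unfolding lin_comb_def by (auto intro!: exI[of _ "{}"])
  next
    case (Cons a l y)
    then obtain F c where F: "finite F" "F \<subseteq> T" "\<forall>t\<in>F. c t \<in> R" "y = (\<Sum>t\<in>F. c t * t)"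
      unfolding lin_comb_def by blast
    \<comment> \<open>The old coefficients, extended by \<open>0\<close> outside \<open>F\<close>,
      plus \<open>a\<close> at \<open>l\<close>; this covers both \<open>l \<in> F\<close> and
      \<open>l \<notin> F\<close>.\<close>
    define d where "d = (\<lambda>t. (if t \<in> F then c t else 0) + (if t = l then a else 0))"
    have "(\<Sum>t\<in>insert l F. d t * t) = (\<Sum>t\<in>insert l F. (if t \<in> F then c t else 0) * t)
        + (\<Sum>t\<in>insert l F. (if t = l then a else 0) * t)"
      by (simp only: d_def distrib_right sum.distrib)
    also have "(\<Sum>t\<in>insert l F. (if t \<in> F then c t else 0) * t) = (\<Sum>t\<in>F. c t * t)"
      using F by (intro sum.mono_neutral_cong_right) auto
    also have "(\<Sum>t\<in>insert l F. (if t = l then a else 0) * t) = (\<Sum>t\<in>{l}. a * t)"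
      using F by (intro sum.mono_neutral_cong_right) auto
    finally have "a * l + y = (\<Sum>t\<in>insert l F. d t * t)" using F by (simp add: add.commute)
    moreover have "\<forall>t\<in>insert l F. d t \<in> R" using F Cons assms by (auto simp: d_def)
    ultimately show ?case unfolding lin_comb_def using F Cons
      by (intro CollectI exI[of _ "insert l F"] exI[of _ d]) auto
  qed
qed

section \<open>Annihilators, essential left ideals and the left singular ideal\<close>

lemma left_ideal_lann: "subring A \<Longrightarrow> left_ideal A (lann A a)"
  unfolding left_ideal_def lann_def
  by (auto simp: left_diff_distrib mult.assoc subring_closed)

lemma essential_li_Int:
  assumes "subring A" "essential_li A L" "essential_li A M"
  shows "essential_li A (L \<inter> M)"
  unfolding essential_li_iff[OF assms(1)]
proof (intro conjI ballI)
  show "left_ideal A (L \<inter> M)" using assms by (auto simp: essential_li_def intro: left_ideal_Int)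
  fix f assume "f \<in> A - {0}"
  then obtain q where q: "q \<in> A" "q * f \<noteq> 0" "q * f \<in> L" "f \<in> A"
    using assms by (auto simp: essential_li_iff)
  then have "q * f \<in> A - {0}" using assms by (auto simp: subring_closed)
  then obtain p where p: "p \<in> A" "p * (q * f) \<noteq> 0" "p * (q * f) \<in> M"
    using assms by (auto simp: essential_li_iff)
  then have "p * (q * f) \<in> L" using q assms by (auto simp: essential_li_def intro: left_ideal_mult)
  then show "multiple_in A f (L \<inter> M)" using p q assms
    by (intro bexI[of _ "p * q"]) (auto simp: mult.assoc simp: subring_closed)
qed

lemma essential_li_mono:
  assumes "subring A" "essential_li A L" "left_ideal A M" "L \<subseteq> M"
  shows "essential_li A M"
  using assms(2-4) unfolding essential_li_iff[OF assms(1)] by blast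

text \<open>If \<open>f * b\<close> is non-zero, essentiality gives it a multiple inside
  \<open>L\<close>; if it is \<open>0\<close>, then \<open>f\<close> itself already lies in the
  colon ideal.\<close>

lemma essential_li_colon:
  assumes "subring A" "essential_li A L" "b \<in> A"
  shows "essential_li A {c \<in> A. c * b \<in> L}"
  unfolding essential_li_iff[OF assms(1)]
proof (intro conjI ballI)
  have L: "left_ideal A L" using assms by (simp add: essential_li_def)
  show "left_ideal A {c \<in> A. c * b \<in> L}"
    unfolding left_ideal_def using assms L
    by (auto intro: subring_closed left_ideal_zero left_ideal_diff left_ideal_mult
        simp: left_diff_distrib mult.assoc)
  fix f assume f: "f \<in> A - {0}"
  show "multiple_in A f {c \<in> A. c * b \<in> L}"
  proof (cases "f * b = 0")
    case True
    then show ?thesis using f assms L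
      by (intro bexI[of _ 1]) (auto intro: subring_closed left_ideal_zero)
  next
    case False
    then have "f * b \<in> A - {0}" using f assms by (auto simp: subring_closed)
    then obtain q where "q \<in> A" "q * (f * b) \<noteq> 0" "q * (f * b) \<in> L"
      using assms(2) unfolding essential_li_iff[OF assms(1)] by blast
    moreover from this have "q * f \<noteq> 0" using mult.assoc[of q f b] by auto
    ultimately show ?thesis using f assms
      by (intro bexI[of _ q]) (auto simp: mult.assoc simp: subring_closed)
  qed
qed

text \<open>Two inclusions of annihilators carry the proof: that of \<open>a - b\<close> contains
  the intersection of those of \<open>a\<close> and \<open>b\<close>, and that of
  \<open>r * a\<close> contains the colon ideal of \<open>lann A a\<close> by
  \<open>r\<close>.\<close>

lemma left_ideal_sing_ideal:
  assumes "subring A"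
  shows "left_ideal A (sing_ideal A)"
  unfolding left_ideal_def
proof (intro conjI ballI)
  show "sing_ideal A \<subseteq> A" by (auto simp: sing_ideal_def)
  have "lann A 0 = A" by (auto simp: lann_def)
  moreover have "essential_li A A" using assms left_ideal_self[OF assms]
    by (auto simp: essential_li_iff intro!: bexI[of _ 1] subring_one)
  ultimately show "0 \<in> sing_ideal A" using assms by (simp add: sing_ideal_def subring_zero)
  fix a b assume ab: "a \<in> sing_ideal A" "b \<in> sing_ideal A"
  then have "essential_li A (lann A a \<inter> lann A b)"
    using assms by (intro essential_li_Int) (auto simp: sing_ideal_def)
  moreover have "lann A a \<inter> lann A b \<subseteq> lann A (a - b)" by (auto simp: lann_def right_diff_distrib)
  ultimately have "essential_li A (lann A (a - b))"
    using assms essential_li_mono left_ideal_lann by blast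
  then show "a - b \<in> sing_ideal A" using ab assms by (auto simp: sing_ideal_def simp: subring_closed)
next
  fix r a assume ra: "r \<in> A" "a \<in> sing_ideal A"
  then have "essential_li A {c \<in> A. c * r \<in> lann A a}"
    using assms by (intro essential_li_colon) (auto simp: sing_ideal_def)
  moreover have "{c \<in> A. c * r \<in> lann A a} \<subseteq> lann A (r * a)" by (auto simp: lann_def mult.assoc)
  ultimately have "essential_li A (lann A (r * a))"
    using assms essential_li_mono left_ideal_lann by blast
  then show "r * a \<in> sing_ideal A" using ra assms by (auto simp: sing_ideal_def simp: subring_closed)
qed

lemma sing_ideal_iff:
  assumes "subring A"
  shows "a \<in> sing_ideal A \<longleftrightarrow> a \<in> A \<and> (\<forall>p\<in>A - {0}. \<exists>q\<in>A. q * p \<noteq> 0 \<and> q * p * a = 0)"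
  unfolding sing_ideal_def essential_li_iff[OF assms] using assms left_ideal_lann[OF assms]
  by (auto simp: lann_def subring_closed)

section \<open>Automorphisms of a subring\<close>

lemma automorphD:
  assumes "automorph S f"
  shows "a \<in> S \<Longrightarrow> f a \<in> S" "f 1 = 1" "a \<in> S \<Longrightarrow> b \<in> S \<Longrightarrow> f (a + b) = f a + f b"
    "a \<in> S \<Longrightarrow> b \<in> S \<Longrightarrow> f (a * b) = f a * f b" "b \<in> S \<Longrightarrow> \<exists>a\<in>S. f a = b"
    "a \<in> S \<Longrightarrow> b \<in> S \<Longrightarrow> f a = f b \<Longrightarrow> a = b"
proof -
  show "a \<in> S \<Longrightarrow> f a \<in> S" using assms by (auto simp: automorph_def bij_betw_def)
  show "b \<in> S \<Longrightarrow> \<exists>a\<in>S. f a = b" using assms by (metis automorph_def bij_betw_def imageE)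
  show "a \<in> S \<Longrightarrow> b \<in> S \<Longrightarrow> f a = f b \<Longrightarrow> a = b"
    using assms by (auto simp: automorph_def bij_betw_def inj_on_def)
qed (use assms in \<open>auto simp: automorph_def\<close>)

lemma automorph_zero: "automorph S f \<Longrightarrow> subring S \<Longrightarrow> f 0 = 0"
  using automorphD(3)[of S f 0 0] by (simp add: subring_zero)

lemma automorph_eq_zero: "automorph S f \<Longrightarrow> subring S \<Longrightarrow> a \<in> S \<Longrightarrow> f a = 0 \<longleftrightarrow> a = 0"
  using automorphD(6)[of S f a 0] automorph_zero[of S f] subring_zero by auto

lemma automorph_funpow: "automorph S f \<Longrightarrow> automorph S (f ^^ n)"
proof (induction n)
  case 0 then show ?case by (auto simp: automorph_def bij_betw_def)
next
  case (Suc n)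
  have "bij_betw (f ^^ Suc n) S S"
    using Suc bij_betw_trans[of "f ^^ n" S S f S] by (simp add: automorph_def)
  then have "bij_betw (\<lambda>a. f ((f ^^ n) a)) S S" by (simp add: comp_def)
  moreover have "\<forall>a\<in>S. (f ^^ n) a \<in> S" using Suc automorphD(1) by blast
  ultimately show ?case using Suc by (auto simp: automorph_def)
qed

text \<open>The criterion \<open>sing_ideal_iff\<close> quantifies over test elements and
  multipliers in \<open>S\<close> only, and a bijective homomorphism permutes both. This is the
  source of the invariance of Z(R)T under \<alpha> and of its trace on \<open>B m\<close> under
  \<open>alm m\<close>.\<close>

lemma automorph_sing_ideal:
  assumes "automorph S f" "subring S" "a \<in> S"
  shows "f a \<in> sing_ideal S \<longleftrightarrow> a \<in> sing_ideal S"
proof -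
  note f = automorphD[OF assms(1)]
  have "(\<forall>p\<in>S - {0}. \<exists>q\<in>S. q * p \<noteq> 0 \<and> q * p * f a = 0)" if
    *: "\<forall>p\<in>S - {0}. \<exists>q\<in>S. q * p \<noteq> 0 \<and> q * p * a = 0"
  proof
    fix p assume p: "p \<in> S - {0}"
    then obtain p' where p': "p' \<in> S" "f p' = p" using f(5) by auto
    then have "p' \<in> S - {0}" using p automorph_zero[OF assms(1,2)] by auto
    then obtain q where q: "q \<in> S" "q * p' \<noteq> 0" "q * p' * a = 0" using * by blast
    have "f q * p = f (q * p')" using q p' f by auto
    moreover have "f (q * p') \<noteq> 0" using q p' automorph_eq_zero[OF assms(1,2)] subring_mult[OF assms(2)] by auto
    moreover have "f (q * p') * f a = f (q * p' * a)"
      using f(4)[of "q * p'" a] q p' assms subring_mult[OF assms(2)] by simp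
    moreover have "f q \<in> S" using q f by auto
    ultimately show "\<exists>q\<in>S. q * p \<noteq> 0 \<and> q * p * f a = 0"
      using q automorph_zero[OF assms(1,2)] by (intro bexI[of _ "f q"]) auto
  qed
  moreover have "(\<forall>p\<in>S - {0}. \<exists>q\<in>S. q * p \<noteq> 0 \<and> q * p * a = 0)" if
    *: "\<forall>p\<in>S - {0}. \<exists>q\<in>S. q * p \<noteq> 0 \<and> q * p * f a = 0"
  proof
    fix p assume p: "p \<in> S - {0}"
    then have "f p \<in> S - {0}" using f automorph_eq_zero[OF assms(1,2)] by auto
    then obtain q where q: "q \<in> S" "q * f p \<noteq> 0" "q * f p * f a = 0" using * by blast
    then obtain q' where q': "q' \<in> S" "f q' = q" using f(5) by auto
    have e1: "f (q' * p) = q * f p" using q' p f by auto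
    have e2: "f (q' * p * a) = q * f p * f a"
      using f(4)[of "q' * p" a] e1 q' p assms subring_mult[OF assms(2)] by auto
    have "q' * p \<noteq> 0" using e1 q automorph_zero[OF assms(1,2)] by metis
    moreover have "q' * p * a = 0"
      using e2 q q' p assms automorph_eq_zero[OF assms(1,2)] subring_mult[OF assms(2)] by (metis DiffD1)
    ultimately show "\<exists>q\<in>S. q * p \<noteq> 0 \<and> q * p * a = 0" using q' by auto
  qed
  ultimately show ?thesis using assms f by (auto simp: sing_ideal_iff)
qed

section \<open>Leading terms in an Ore extension\<close>

locale ore =
  fixes S :: "'a::ring_1 set" and x :: 'a and \<alpha> \<delta> :: "'a \<Rightarrow> 'a"
  assumes subS: "subring S"
    and free: "\<And>N c. (\<And>n. c n \<in> S) \<Longrightarrow> (\<Sum>n\<le>N. c n * x ^ n) = 0 \<Longrightarrow> n \<le> N \<Longrightarrow> c n = 0"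
    and aut: "automorph S \<alpha>"
    and der: "alpha_derivation S \<alpha> \<delta>"
    and comm: "\<And>p. p \<in> S \<Longrightarrow> x * p = \<alpha> p * x + \<delta> p"
begin

text \<open>The bound on the degree is strict, so that \<open>P 0\<close> is \<open>{0}\<close> and
  an induction on the bound starts with the zero element.\<close>

definition P :: "nat \<Rightarrow> 'a set" where
  "P n = {f. \<exists>c. (\<forall>i. c i \<in> S) \<and> f = (\<Sum>i<n. c i * x ^ i)}"

text \<open>The coefficient \<open>c\<close> of \<open>x ^ n\<close> in \<open>lt n c f\<close> may vanish: the relation only bounds the degree by \<open>n\<close>.\<close>

definition lt :: "nat \<Rightarrow> 'a \<Rightarrow> 'a \<Rightarrow> bool" where
  "lt n c f \<longleftrightarrow> c \<in> S \<and> f - c * x ^ n \<in> P n"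

definition Sx :: "'a set" where
  "Sx = (\<Union>n. P n)"

lemmas S_closed = subring_closed[OF subS]

lemma delta_S: "p \<in> S \<Longrightarrow> \<delta> p \<in> S"
  using der by (simp add: alpha_derivation_def)

lemma aut_pow: "automorph S (\<alpha> ^^ n)"
  using aut by (rule automorph_funpow)

lemmas alpha_pow = automorphD[OF aut_pow]
lemmas alpha_pow_eq_zero = automorph_eq_zero[OF aut_pow subS]

lemma P_0: "P 0 = {0}"
  using S_closed by (auto simp: P_def intro!: exI[of _ "\<lambda>_. 0"])

lemma P_add: "f \<in> P n \<Longrightarrow> g \<in> P n \<Longrightarrow> f + g \<in> P n"
proof -
  assume "f \<in> P n" "g \<in> P n"
  then obtain c d where "\<forall>i. c i \<in> S" "f = (\<Sum>i<n. c i * x ^ i)"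
    "\<forall>i. d i \<in> S" "g = (\<Sum>i<n. d i * x ^ i)" by (auto simp: P_def)
  then have "\<forall>i. c i + d i \<in> S" "f + g = (\<Sum>i<n. (c i + d i) * x ^ i)"
    by (auto simp: distrib_right sum.distrib S_closed)
  then show ?thesis by (auto simp: P_def intro!: exI[of _ "\<lambda>i. c i + d i"])
qed

lemma P_smult: "s \<in> S \<Longrightarrow> f \<in> P n \<Longrightarrow> s * f \<in> P n"
proof -
  assume "s \<in> S" "f \<in> P n"
  then obtain c where "\<forall>i. c i \<in> S" "f = (\<Sum>i<n. c i * x ^ i)" by (auto simp: P_def)
  then have "\<forall>i. s * c i \<in> S" "s * f = (\<Sum>i<n. (s * c i) * x ^ i)"
    using \<open>s \<in> S\<close> by (auto simp: sum_distrib_left mult.assoc S_closed)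
  then show ?thesis by (auto simp: P_def intro!: exI[of _ "\<lambda>i. s * c i"])
qed

lemma P_uminus: "f \<in> P n \<Longrightarrow> - f \<in> P n"
  using P_smult[of "- 1" f n] by (simp add: S_closed)

lemma P_diff: "f \<in> P n \<Longrightarrow> g \<in> P n \<Longrightarrow> f - g \<in> P n"
  using P_add[of f n "- g"] P_uminus by simp

lemma monom_P: "c \<in> S \<Longrightarrow> i < n \<Longrightarrow> c * x ^ i \<in> P n"
proof -
  assume *: "c \<in> S" "i < n"
  have "(\<Sum>j<n. (if j = i then c else 0) * x ^ j) = (\<Sum>j\<in>{i}. c * x ^ j)"
    using * by (intro sum.mono_neutral_cong_right) auto
  then show ?thesis using * S_closed
    by (auto simp: P_def intro!: exI[of _ "\<lambda>j. if j = i then c else 0"])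
qed

lemma P_zero: "0 \<in> P n"
  by (auto simp: P_def S_closed intro!: exI[of _ "\<lambda>_. 0"])

lemma P_sum: "(\<And>i. i \<in> F \<Longrightarrow> f i \<in> P n) \<Longrightarrow> sum f F \<in> P n"
  by (induction F rule: infinite_finite_induct) (auto simp: P_zero P_add)

lemma P_mono: "f \<in> P m \<Longrightarrow> m \<le> n \<Longrightarrow> f \<in> P n"
proof -
  assume *: "f \<in> P m" "m \<le> n"
  then obtain c where "\<forall>i. c i \<in> S" "f = (\<Sum>i<m. c i * x ^ i)" by (auto simp: P_def)
  then show ?thesis using * by (auto intro!: P_sum monom_P)
qed

lemma P_Suc: "f \<in> P (Suc n) \<longleftrightarrow> (\<exists>c. lt n c f)"
proof
  assume "f \<in> P (Suc n)"
  then obtain c where c: "\<forall>i. c i \<in> S" "f = (\<Sum>i<Suc n. c i * x ^ i)" by (auto simp: P_def)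
  then have "f - c n * x ^ n = (\<Sum>i<n. c i * x ^ i)" by simp
  then show "\<exists>c. lt n c f" using c unfolding lt_def P_def by blast
next
  assume "\<exists>c. lt n c f"
  then obtain c where "c \<in> S" "f - c * x ^ n \<in> P n" by (auto simp: lt_def)
  then have "c * x ^ n + (f - c * x ^ n) \<in> P (Suc n)"
    by (intro P_add monom_P) (auto intro: P_mono[of _ n "Suc n"])
  then show "f \<in> P (Suc n)" by simp
qed

text \<open>The bridge from \<open>free\<close> to degrees: moving the lower terms to one side gives
  a vanishing combination \<open>e\<close> with \<open>c\<close> in the top place.\<close>

lemma monom_in_P: "c \<in> S \<Longrightarrow> c * x ^ n \<in> P n \<Longrightarrow> c = 0"
proof -
  assume *: "c \<in> S" "c * x ^ n \<in> P n"
  then obtain d where d: "\<forall>i. d i \<in> S" "c * x ^ n = (\<Sum>i<n. d i * x ^ i)" by (auto simp: P_def)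
  define e where "e = (\<lambda>i. if i = n then c else - d i)"
  have "(\<Sum>i\<le>n. e i * x ^ i) = c * x ^ n + (\<Sum>i<n. e i * x ^ i)"
    by (simp add: e_def lessThan_Suc_atMost[symmetric])
  also have "(\<Sum>i<n. e i * x ^ i) = - (\<Sum>i<n. d i * x ^ i)"
    by (simp add: e_def sum_negf[symmetric])
  finally have "(\<Sum>i\<le>n. e i * x ^ i) = 0" using d by simp
  then have "e n = 0" using free[of e n n] d * by (auto simp: e_def S_closed)
  then show ?thesis by (simp add: e_def)
qed

lemma lt_in_P: "lt n c f \<Longrightarrow> f \<in> P n \<Longrightarrow> c = 0"
proof -
  assume *: "lt n c f" "f \<in> P n"
  then have "f - (f - c * x ^ n) \<in> P n" using P_diff[of f n "f - c * x ^ n"] by (simp add: lt_def)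
  then show ?thesis using * monom_in_P by (auto simp: lt_def)
qed

lemma lt_zero: "lt n c 0 \<Longrightarrow> c = 0"
  using lt_in_P P_zero by blast

lemma lt_0_iff: "lt n 0 f \<longleftrightarrow> f \<in> P n"
  by (simp add: lt_def S_closed)

lemma lt_S: "lt n c f \<Longrightarrow> c \<in> S"
  by (simp add: lt_def)

lemma lt_diff: "lt n c f \<Longrightarrow> lt n d g \<Longrightarrow> lt n (c - d) (f - g)"
  using P_diff[of "f - c * x ^ n" n "g - d * x ^ n"]
  by (simp add: lt_def S_closed algebra_simps)

lemma lt_diff_P: "lt n c f \<Longrightarrow> lt n c g \<Longrightarrow> f - g \<in> P n"
  using lt_diff[of n c f c g] by (simp add: lt_0_iff)

lemma lt_smult: "s \<in> S \<Longrightarrow> lt n c f \<Longrightarrow> lt n (s * c) (s * f)"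
  using P_smult[of s "f - c * x ^ n" n] by (auto simp: lt_def S_closed algebra_simps)

lemma lt_unique: "lt n c f \<Longrightarrow> lt n d f \<Longrightarrow> c = d"
  using lt_diff[of n c f d f] lt_zero by fastforce

lemma lt_monom: "c \<in> S \<Longrightarrow> lt n c (c * x ^ n)"
  by (simp add: lt_def P_zero)

lemma lt_const: "c \<in> S \<Longrightarrow> lt 0 c c"
  using lt_monom[of c 0] by simp

lemma lt_Suc_P: "lt n c f \<Longrightarrow> f \<in> P (Suc n)"
  using P_Suc by blast

lemma x_P: "f \<in> P n \<Longrightarrow> x * f \<in> P (Suc n)"
proof -
  assume "f \<in> P n"
  then obtain c where c: "\<forall>i. c i \<in> S" "f = (\<Sum>i<n. c i * x ^ i)" by (auto simp: P_def)
  have "x * f = (\<Sum>i<n. \<alpha> (c i) * x ^ Suc i + \<delta> (c i) * x ^ i)"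
    using c by (simp add: sum_distrib_left mult.assoc[symmetric] comm distrib_right)
  also have "\<dots> \<in> P (Suc n)"
    using c automorphD(1)[OF aut] delta_S by (intro P_sum P_add monom_P) auto
  finally show ?thesis .
qed

lemma pow_P: "f \<in> P n \<Longrightarrow> x ^ k * f \<in> P (n + k)"
  by (induction k) (auto simp: mult.assoc x_P)

text \<open>One factor is bounded strictly and the other weakly, so that an error term times a full
  factor stays below the top degree in \<open>lt_mult\<close>. Each \<open>x ^ i\<close> with
  \<open>i < m\<close> raises the degree of \<open>g\<close> by at most \<open>i\<close>.\<close>

lemma P_mult: "f \<in> P m \<Longrightarrow> g \<in> P (Suc n) \<Longrightarrow> f * g \<in> P (m + n)"
proof -
  assume f: "f \<in> P m" and g: "g \<in> P (Suc n)"
  then obtain c where c: "\<forall>i. c i \<in> S" "f = (\<Sum>i<m. c i * x ^ i)" by (auto simp: P_def)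
  have "c i * (x ^ i * g) \<in> P (m + n)" if "i < m" for i
  proof -
    have "x ^ i * g \<in> P (Suc n + i)" using g by (rule pow_P)
    then have "x ^ i * g \<in> P (m + n)" by (rule P_mono) (use that in simp)
    then show ?thesis using c P_smult by blast
  qed
  then show ?thesis using c by (auto simp: sum_distrib_right mult.assoc intro!: P_sum)
qed

lemma pow_in_P: "x ^ n \<in> P (Suc n)"
  using monom_P[of 1 n "Suc n"] S_closed by simp

lemma P_pow: "f \<in> P m \<Longrightarrow> f * x ^ n \<in> P (m + n)"
  using P_mult pow_in_P by blast

lemma S_in_P: "s \<in> S \<Longrightarrow> s \<in> P (Suc n)"
  using monom_P[of s 0 "Suc n"] by simp

lemma P_S: "f \<in> P m \<Longrightarrow> s \<in> S \<Longrightarrow> f * s \<in> P m"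
  using P_mult[of f m s 0] S_in_P by simp

text \<open>Each passage of \<open>x\<close> applies \<alpha> to the leading coefficient; the
  \<delta>-terms have lower degree.\<close>

lemma lt_pow_S: "s \<in> S \<Longrightarrow> lt n ((\<alpha> ^^ n) s) (x ^ n * s)"
proof (induction n)
  case 0 then show ?case by (simp add: lt_const)
next
  case (Suc n)
  define c where "c = (\<alpha> ^^ n) s"
  define p where "p = x ^ n * s - c * x ^ n"
  have c: "c \<in> S" "p \<in> P n" using Suc by (auto simp: c_def p_def lt_def)
  have "x ^ Suc n * s = x * (c * x ^ n + p)" by (simp add: p_def mult.assoc)
  also have "\<dots> = \<alpha> c * x ^ Suc n + (\<delta> c * x ^ n + x * p)"
    using c by (simp add: distrib_left mult.assoc[symmetric] comm distrib_right add.assoc)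
  finally have "x ^ Suc n * s - \<alpha> c * x ^ Suc n = \<delta> c * x ^ n + x * p" by simp
  moreover have "\<delta> c * x ^ n + x * p \<in> P (Suc n)"
    using c delta_S by (intro P_add monom_P x_P) auto
  ultimately show ?case using c automorphD(1)[OF aut] by (auto simp: lt_def c_def)
qed

text \<open>Moving \<open>x ^ m\<close> past \<open>d\<close> applies \<open>\<alpha> ^^ m\<close>
  to it and costs a remainder \<open>r\<close> of degree below \<open>m\<close>. The three error
  terms come from \<open>r\<close> and from the lower parts \<open>q\<close> of \<open>g\<close> and
  \<open>p\<close> of \<open>f\<close>.\<close>

lemma lt_mult: "lt m c f \<Longrightarrow> lt n d g \<Longrightarrow> lt (m + n) (c * (\<alpha> ^^ m) d) (f * g)"
proof -
  assume f: "lt m c f" and g: "lt n d g"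
  define p where "p = f - c * x ^ m"
  define q where "q = g - d * x ^ n"
  define r where "r = x ^ m * d - (\<alpha> ^^ m) d * x ^ m"
  have S: "c \<in> S" "d \<in> S" using f g lt_S by auto
  have p: "p \<in> P m" "q \<in> P n" "r \<in> P m"
    using f g lt_pow_S[OF S(2), of m] by (auto simp: lt_def p_def q_def r_def)
  have "f * g = (c * x ^ m + p) * g" by (simp add: p_def)
  also have "\<dots> = c * x ^ m * (d * x ^ n + q) + p * g" by (simp add: distrib_right q_def)
  also have "\<dots> = c * ((x ^ m * d) * x ^ n) + c * (x ^ m * q) + p * g"
    by (simp add: distrib_left mult.assoc)
  also have "x ^ m * d = (\<alpha> ^^ m) d * x ^ m + r" by (simp add: r_def)
  also have "c * (((\<alpha> ^^ m) d * x ^ m + r) * x ^ n) = c * (\<alpha> ^^ m) d * x ^ (m + n) + c * (r * x ^ n)"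
    by (simp add: distrib_left distrib_right mult.assoc power_add)
  finally have "f * g - c * (\<alpha> ^^ m) d * x ^ (m + n) = c * (r * x ^ n) + c * (x ^ m * q) + p * g"
    by simp
  also have "\<dots> \<in> P (m + n)"
    using P_smult[OF S(1) P_pow[OF p(3), of n]] P_smult[OF S(1) pow_P[OF p(2), of m]]
      P_mult[OF p(1) lt_Suc_P[OF g]] by (simp add: P_add add.commute)
  finally show ?thesis using S alpha_pow(1) by (auto simp: lt_def S_closed)
qed

lemma P_in_Sx: "f \<in> P n \<Longrightarrow> f \<in> Sx"
  by (auto simp: Sx_def)

lemma lt_exists: "f \<in> P n \<Longrightarrow> f \<noteq> 0 \<Longrightarrow> \<exists>m c. m < n \<and> lt m c f \<and> c \<noteq> 0"
proof (induction n)
  case 0 then show ?case by (simp add: P_0)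
next
  case (Suc n)
  then obtain c where c: "lt n c f" using P_Suc by blast
  show ?case
  proof (cases "c = 0")
    case True
    then show ?thesis using Suc c lt_0_iff less_SucI by blast
  qed (use c in blast)
qed

lemma lt_exists_Sx: "f \<in> Sx \<Longrightarrow> f \<noteq> 0 \<Longrightarrow> \<exists>m c. lt m c f \<and> c \<noteq> 0"
  using lt_exists by (auto simp: Sx_def) blast

lemma degx_eq: "lt m c f \<Longrightarrow> c \<noteq> 0 \<Longrightarrow> degx S x f = m"
proof -
  assume *: "lt m c f" "c \<noteq> 0"
  have "degx S x f = (LEAST n. f \<in> P (Suc n))"
    by (simp add: degx_def P_def lessThan_Suc_atMost)
  also have "\<dots> = m"
  proof (rule Least_equality)
    show "f \<in> P (Suc m)" using * lt_Suc_P by blast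
    show "m \<le> n" if "f \<in> P (Suc n)" for n
    proof (rule ccontr)
      assume "\<not> m \<le> n"
      then have "f \<in> P m" using that P_mono[of f "Suc n" m] by auto
      then show False using * lt_in_P by blast
    qed
  qed
  finally show ?thesis .
qed

text \<open>Translates the degree bounds in the definition of a special subextension into membership
  in \<open>P m\<close>.\<close>

lemma degx_less_P: "f \<in> Sx \<Longrightarrow> degx S x f < m \<Longrightarrow> f \<in> P m"
proof (cases "f = 0")
  case False
  assume *: "f \<in> Sx" "degx S x f < m"
  then obtain n c where "lt n c f" "c \<noteq> 0" using lt_exists_Sx False by blast
  then show ?thesis using degx_eq[of n c f] * lt_Suc_P[of n c f] P_mono[of f "Suc n" m] by auto
qed (auto simp: P_zero)

lemma lin_comb_eq_Sx: "lin_comb S (range (\<lambda>n. x ^ n)) = Sx"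
proof -
  have "lin_comb S (range (\<lambda>n. x ^ n)) = prod_span S (range (\<lambda>n. x ^ n))"
    by (rule lin_comb_eq_prod_span) (auto simp: S_closed)
  also have "\<dots> = Sx"
  proof (intro equalityI subsetI)
    fix f assume "f \<in> prod_span S (range (\<lambda>n. x ^ n))"
    then show "f \<in> Sx"
    proof (induction rule: prod_span_induct)
      case zero then show ?case using P_zero P_in_Sx by blast
    next
      case (Cons a l y)
      then obtain n m where nm: "l = x ^ n" "y \<in> P m" by (auto simp: Sx_def)
      then have "a * l + y \<in> P (Suc n + m)" using Cons
        by (auto intro!: P_add monom_P intro: P_mono[of y m])
      then show ?case by (rule P_in_Sx)
    qed
  next
    fix f assume "f \<in> Sx"
    then obtain n c where "\<forall>i. c i \<in> S" "f = (\<Sum>i<(n::nat). c i * x ^ i)" by (auto simp: Sx_def P_def)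
    then show "f \<in> prod_span S (range (\<lambda>n. x ^ n))" by (auto intro!: prod_span_sum prod_span_mem)
  qed
  finally show ?thesis .
qed

lemma Sx_coeffs: "f \<in> Sx \<Longrightarrow> \<exists>N c. (\<forall>m. c m \<in> S) \<and> f = (\<Sum>m\<le>N. c m * x ^ m)"
proof -
  assume "f \<in> Sx"
  then obtain n where "f \<in> P n" by (auto simp: Sx_def)
  then have "f \<in> P (Suc n)" by (rule P_mono) simp
  then show ?thesis by (auto simp: P_def lessThan_Suc_atMost)
qed

lemma S_Sx: "s \<in> S \<Longrightarrow> s \<in> Sx"
  using S_in_P P_in_Sx by blast

lemma lt_coeffs: "(\<And>m. c m \<in> S) \<Longrightarrow> lt n (c n) (\<Sum>m\<le>n. c m * x ^ m)"
  by (auto simp: lt_def lessThan_Suc_atMost[symmetric] intro!: P_sum monom_P)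

lemma subring_Sx: "subring Sx"
  unfolding subring_def
proof (intro conjI ballI)
  show "1 \<in> Sx" using S_Sx S_closed by blast
  fix a b assume "a \<in> Sx" "b \<in> Sx"
  then obtain m n where "a \<in> P m" "b \<in> P n" by (auto simp: Sx_def)
  then have "a \<in> P (m + n)" "b \<in> P (m + n)" "a \<in> P m" "b \<in> P (Suc n)"
    by (auto intro: P_mono[of a m] P_mono[of b n])
  then show "a - b \<in> Sx" "a * b \<in> Sx" using P_diff P_mult P_in_Sx by blast+
qed

text \<open>Surjectivity of \<alpha> enters here: a coefficient on the left of \<open>x ^ n\<close>
  moves to its right at the cost of lower terms. This is the mechanism behind freeness as a right
  module.\<close>

lemma swap_pow: "c \<in> S \<Longrightarrow> \<exists>s\<in>S. c = (\<alpha> ^^ n) s \<and> c * x ^ n - x ^ n * s \<in> P n"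
proof -
  assume c: "c \<in> S"
  then obtain s where s: "s \<in> S" "(\<alpha> ^^ n) s = c" using alpha_pow(5) by blast
  then have "c * x ^ n - x ^ n * s \<in> P n"
    using lt_pow_S[of s n] lt_monom[OF c, of n] lt_diff_P by simp
  then show ?thesis using s by blast
qed

text \<open>Write the top term of \<open>t\<close> as \<open>x ^ e * s\<close>, with the coefficient
  on the right. The top coefficient of \<open>t * j * f\<close> is then the image of
  \<open>s * j * a\<close> under a power of \<alpha>, so \<open>s * j * a = 0\<close> and hence
  \<open>s * j = 0\<close>. The top term can thus be removed from \<open>t\<close> without changing
  \<open>t * j\<close>.\<close>

lemma annihilator_lt:
  assumes j: "j \<in> S" and f: "lt n a f" and ja: "\<And>b. b \<in> S \<Longrightarrow> b * j * a = 0 \<Longrightarrow> b * j = 0"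
    and t: "t \<in> Sx" and tjf: "t * j * f = 0"
  shows "t * j = 0"
proof -
  have "t \<in> P e \<Longrightarrow> t * j * f = 0 \<Longrightarrow> t * j = 0" for e t
  proof (induction e arbitrary: t)
    case 0 then show ?case by (simp add: P_0)
  next
    case (Suc e)
    then obtain c where c: "lt e c t" using P_Suc by blast
    then obtain s where s: "s \<in> S" "c = (\<alpha> ^^ e) s" "c * x ^ e - x ^ e * s \<in> P e"
      using swap_pow lt_S by blast
    have a: "a \<in> S" using f lt_S by blast
    have "lt (0 + n) (j * (\<alpha> ^^ 0) a) (j * f)" by (intro lt_mult lt_const j f)
    then have "lt (e + n) (c * (\<alpha> ^^ e) (j * a)) (t * (j * f))" using c by (intro lt_mult) auto
    then have "c * (\<alpha> ^^ e) (j * a) = 0" using Suc lt_zero by (auto simp: mult.assoc)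
    then have "(\<alpha> ^^ e) (s * (j * a)) = 0" using s j a alpha_pow(4) by (simp add: S_closed)
    then have "s * j * a = 0" using s j a alpha_pow_eq_zero by (simp add: S_closed mult.assoc)
    then have sj: "s * j = 0" using ja s by blast
    define t' where "t' = t - x ^ e * s"
    have "t' = (t - c * x ^ e) + (c * x ^ e - x ^ e * s)" by (simp add: t'_def)
    also have "\<dots> \<in> P e" using s(3) c by (intro P_add) (auto simp: lt_def)
    finally have "t' \<in> P e" .
    moreover have "t' * j = t * j" using sj by (simp add: t'_def left_diff_distrib mult.assoc)
    ultimately show ?case using Suc by metis
  qed
  then show ?thesis using t tjf by (auto simp: Sx_def)
qed

end

section \<open>Special subextensions\<close>

lemma regular_mult: "subring S \<Longrightarrow> regular S u \<Longrightarrow> regular S w \<Longrightarrow> regular S (u * w)"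
  unfolding regular_def by (metis mult.assoc subring_mult)

lemma regularD: "regular S u \<Longrightarrow> s \<in> S \<Longrightarrow> s * u = 0 \<Longrightarrow> s = 0"
  "regular S u \<Longrightarrow> s \<in> S \<Longrightarrow> u * s = 0 \<Longrightarrow> s = 0" "regular S u \<Longrightarrow> u \<in> S"
  unfolding regular_def by blast+

text \<open>Regularity is assumed inside \<open>S\<close> only; leading coefficients carry the
  cancellation of \<open>u\<close> on the left over to \<open>Sx\<close>.\<close>

lemma (in ore) regular_Sx:
  assumes "regular S u" "y \<in> Sx" "u * y = 0"
  shows "y = 0"
proof (rule ccontr)
  assume "y \<noteq> 0"
  then obtain m c where c: "lt m c y" "c \<noteq> 0" using assms lt_exists_Sx by blast
  then have "lt m (u * c) (u * y)" using assms regularD by (intro lt_smult) auto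
  then have "u * c = 0" using assms lt_zero by simp
  then show False using c assms regularD(2) lt_S by blast
qed

text \<open>\<open>Z\<close> stands for the elements of \<open>S\<close> with coefficients in Z(R).
  \<open>D_diff\<close> is the form in which Deg = dN is used: the lower of two degrees is raised to
  the higher by some \<open>lam\<close>. Two instances occur, a special subextension and the full
  extension with \<open>lam m = x ^ m\<close> and every \<open>B m\<close> equal to
  \<open>S\<close>.\<close>

locale ore_special = ore S x \<alpha> \<delta> for S :: "'a::ring_1 set" and x \<alpha> \<delta> +
  fixes R A :: "'a set" and D :: "nat set" and lam :: "nat \<Rightarrow> 'a" and B :: "nat \<Rightarrow> 'a set"
    and alm :: "nat \<Rightarrow> 'a \<Rightarrow> 'a" and Z :: "'a set"
  assumes subR: "subring R" and subA: "subring A" and RA: "R \<subseteq> A" and ASx: "A \<subseteq> Sx"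
    and homog: "\<And>a. a \<in> A \<Longrightarrow> \<exists>N c. (\<forall>m. c m \<in> S \<and> c m * x ^ m \<in> A) \<and> a = (\<Sum>m\<le>N. c m * x ^ m)"
    and degD: "\<And>a m c. a \<in> A \<Longrightarrow> lt m c a \<Longrightarrow> c \<noteq> 0 \<Longrightarrow> m \<in> D"
    and D_diff: "\<And>m n. m \<in> D \<Longrightarrow> n \<in> D \<Longrightarrow> n \<le> m \<Longrightarrow> m - n \<in> D"
    and B_0: "B 0 = A \<inter> S"
    and lam_form: "\<And>m. m \<in> D \<Longrightarrow> \<exists>v. regular S v \<and> lam m = v * x ^ m"
    and lam_A: "\<And>m. m \<in> D \<Longrightarrow> lam m \<in> A"
    and subB: "\<And>m. m \<in> D \<Longrightarrow> subring (B m)"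
    and RB: "\<And>m. m \<in> D \<Longrightarrow> R \<subseteq> B m"
    and BAS: "\<And>m. m \<in> D \<Longrightarrow> B m \<subseteq> A \<inter> S"
    and autB: "\<And>m. m \<in> D \<Longrightarrow> automorph (B m) (alm m)"
    and lam_comm: "\<And>m p. m \<in> D \<Longrightarrow> p \<in> B m \<Longrightarrow> lam m * p - alm m p * lam m \<in> P m"
    and denom: "\<And>m q. m \<in> D \<Longrightarrow> q \<in> S \<Longrightarrow> q * x ^ m \<in> A \<Longrightarrow>
      \<exists>u\<in>B m. regular S u \<and> (\<exists>b\<in>B m. u * q * x ^ m = b * lam m)"
    and Z_left: "left_ideal S Z"
    and Z_alpha: "\<And>z. z \<in> Z \<Longrightarrow> \<alpha> z \<in> Z"
    and Z_delta: "\<And>z. z \<in> Z \<Longrightarrow> \<delta> z = 0"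
    and singB: "\<And>m. m \<in> D \<Longrightarrow> sing_ideal (B m) = B m \<inter> Z"
begin

lemmas A_closed = subring_closed[OF subA]
lemmas alm = automorphD[OF autB]

lemma zero_D: "0 \<in> D"
proof -
  have "lt 0 1 1" using lt_const S_closed by blast
  then show ?thesis using degD[of 1 0 1] A_closed by simp
qed

lemmas B0_closed = subring_closed[OF subB[OF zero_D]]

lemma B_A: "m \<in> D \<Longrightarrow> b \<in> B m \<Longrightarrow> b \<in> A" and B_S: "m \<in> D \<Longrightarrow> b \<in> B m \<Longrightarrow> b \<in> S"
  and B_B0: "m \<in> D \<Longrightarrow> b \<in> B m \<Longrightarrow> b \<in> B 0"
  using BAS B_0 by blast+

lemma R_S: "r \<in> R \<Longrightarrow> r \<in> S"
  using RB[OF zero_D] B_S[OF zero_D] by blast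

lemma B_mult: "m \<in> D \<Longrightarrow> a \<in> B m \<Longrightarrow> b \<in> B m \<Longrightarrow> a * b \<in> B m"
  using subring_mult[OF subB] by blast

lemma B_subset: "m \<in> D \<Longrightarrow> L \<subseteq> R \<Longrightarrow> y \<in> prod_span (B m) L \<Longrightarrow> y \<in> B m"
  using prod_span_subset[OF subB, of m L y] RB by blast

text \<open>Homogeneity provides an expansion with all monomials in \<open>A\<close>, but its length
  \<open>N\<close> need not match the degree. The induction on \<open>N\<close> finds either the
  coefficient at \<open>m\<close> or a non-zero leading coefficient above \<open>m\<close>, and the
  latter contradicts the degree bound contained in \<open>lt m c a\<close>.\<close>

lemma lead_A:
  assumes "a \<in> A" "lt m c a"
  shows "c * x ^ m \<in> A"
proof -
  obtain N d where d: "\<forall>m. d m \<in> S \<and> d m * x ^ m \<in> A" "a = (\<Sum>m\<le>N. d m * x ^ m)"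
    using homog assms by blast
  have "lt m (if m \<le> N then d m else 0) a \<or> (\<exists>k. m < k \<and> k \<le> N \<and> lt k (d k) a \<and> d k \<noteq> 0)"
    unfolding d(2)
  proof (induction N)
    case 0
    show ?case using lt_const[of "d 0"] d lt_0_iff[of m "d 0"] S_in_P[of "d 0" "m - 1"]
      by (cases "m = 0") auto
  next
    case (Suc N)
    have S: "lt (Suc N) (d (Suc N)) (\<Sum>m\<le>Suc N. d m * x ^ m)" using d lt_coeffs by blast
    consider "m = Suc N" | "m > Suc N" | "m < Suc N" "d (Suc N) = 0" | "m < Suc N" "d (Suc N) \<noteq> 0"
      by linarith
    then show ?case
    proof cases
      case 1 then show ?thesis using S by auto
    next
      case 2
      then have "(\<Sum>m\<le>Suc N. d m * x ^ m) \<in> P m" using P_mono[OF lt_Suc_P[OF S], of m] by simp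
      then show ?thesis using 2 by (simp add: lt_0_iff)
    next
      case 3
      then show ?thesis using Suc by (auto simp: le_Suc_eq)
    next
      case 4 then show ?thesis using S by blast
    qed
  qed
  moreover have False if "m < k" "lt k (d k) a" "d k \<noteq> 0" for k
    using that lt_in_P[OF that(2)] P_mono[OF lt_Suc_P[OF assms(2)], of k] by auto
  ultimately have "lt m (if m \<le> N then d m else 0) a" by blast
  then have "c = (if m \<le> N then d m else 0)" using assms lt_unique by blast
  then show ?thesis using d A_closed by auto
qed

lemma lam_lt: 
  assumes "m \<in> D" "lam m = v * x ^ m" "regular S v" "z \<in> B m"
  shows "lt m (alm m z * v) (lam m * z)"
proof -
  have "alm m z * v \<in> S" using alm(1)[OF assms(1,4)] B_S[OF assms(1)] regularD(3)[OF assms(3)] by (simp add: S_closed)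
  then have "lt m (alm m z * v) (alm m z * lam m)" using lt_monom[of "alm m z * v" m] assms
    by (simp add: mult.assoc)
  then show ?thesis using lam_comm[OF assms(1,4)] P_add[of "lam m * z - alm m z * lam m" m "alm m z * lam m - alm m z * v * x ^ m"]
    by (simp add: lt_def)
qed

lemma lam_in_P: "m \<in> D \<Longrightarrow> z \<in> B m \<Longrightarrow> lam m * z \<in> P m \<Longrightarrow> z = 0"
proof -
  assume *: "m \<in> D" "z \<in> B m" "lam m * z \<in> P m"
  obtain v where v: "regular S v" "lam m = v * x ^ m" using lam_form * by blast
  have "alm m z * v = 0" using lt_in_P[OF lam_lt[OF *(1) v(2,1) *(2)]] * by blast
  then have "alm m z = 0" using regularD(1)[OF v(1)] alm(1) B_S * by blast
  then show ?thesis using automorph_eq_zero[OF autB subB] * by blast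
qed

text \<open>Lets \<open>B m\<close> act on \<open>z\<close> in \<open>lam m * z\<close>:
  multiplication of \<open>f\<close> by \<open>alm m s\<close> becomes multiplication of
  \<open>z\<close> by \<open>s\<close>, up to lower terms.\<close>

lemma lam_shift:
  assumes m: "m \<in> D" "z \<in> B m" "s \<in> B m" "f - lam m * z \<in> P m"
  shows "alm m s * f - lam m * (s * z) \<in> P m"
proof -
  have "alm m s * f - lam m * (s * z) = alm m s * (f - lam m * z) - (lam m * s - alm m s * lam m) * z"
    by (simp add: algebra_simps)
  then show ?thesis
    using P_smult[OF _ m(4), of "alm m s"] P_S[OF lam_comm[OF m(1,3)], of z] alm(1)[OF m(1,3)] B_S m
    by (simp add: P_diff)
qed

text \<open>The remainder stays a sum of products with left factors in
  \<open>A \<inter> P e\<close>, which permits iteration. A new summand \<open>a * l\<close> is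
  treated by a denominator \<open>u'\<close> with \<open>u' * u * c * x ^ e = b * lam e\<close>;
  writing \<open>b = alm e b'\<close> and \<open>u' = alm e u''\<close> moves both to the right of
  \<open>lam e\<close>.\<close>

lemma prod_span_lead:
  assumes e: "e \<in> D" and LR: "L \<subseteq> R" and f: "f \<in> prod_span (A \<inter> P (Suc e)) L"
  shows "\<exists>u\<in>B e. regular S u \<and> (\<exists>z\<in>prod_span (B e) L. u * f - lam e * z \<in> prod_span (A \<inter> P e) L)"
  using f
proof (induction rule: prod_span_induct)
  case zero
  have "regular S 1" by (simp add: regular_def S_closed)
  then show ?case using subring_one[OF subB[OF e]]
    by (intro bexI[of _ 1] conjI bexI[of _ 0]) (auto simp: prod_span_zero)
next
  case (Cons a l y)
  then obtain u z where u: "u \<in> B e" "regular S u" "z \<in> prod_span (B e) L"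
    "u * y - lam e * z \<in> prod_span (A \<inter> P e) L" by blast
  obtain c where c: "lt e c a" using Cons P_Suc by blast
  have cA: "c * x ^ e \<in> A" using lead_A c Cons by blast
  have lS: "l \<in> S" using Cons LR R_S by blast
  have AP_uminus: "- p \<in> A \<inter> P e" if "p \<in> A \<inter> P e" for p using that A_closed P_uminus by auto
  have "u * c * x ^ e \<in> A" "u * c \<in> S"
    using cA u B_A[OF e] B_S[OF e] c lt_S A_closed S_closed by (auto simp: mult.assoc)
  then obtain u' b where u': "u' \<in> B e" "regular S u'" "b \<in> B e" "u' * (u * c) * x ^ e = b * lam e"
    using denom[OF e] by blast
  obtain b' where b': "b' \<in> B e" "alm e b' = b" using alm(5)[OF e u'(3)] by blast
  obtain u'' where u'': "u'' \<in> B e" "alm e u'' = u'" using alm(5)[OF e u'(1)] by blast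
  have low: "lam e * p - alm e p * lam e \<in> A \<inter> P e" if "p \<in> B e" for p
    using lam_comm[OF e that] lam_A[OF e] B_A[OF e that] B_A[OF e alm(1)[OF e that]] A_closed by auto
  \<comment> \<open>What remains of \<open>u' * u * a\<close> once \<open>lam e * b'\<close> is
    taken out; the parts of degree \<open>e\<close> cancel by \<open>uc\<close>.\<close>
  define w1 where "w1 = u' * (u * (a - c * x ^ e)) - (lam e * b' - b * lam e)"
  have uc: "u' * (u * (c * x ^ e)) = b * lam e" using u' by (simp add: mult.assoc)
  have w1: "w1 \<in> A \<inter> P e"
  proof -
    have "u' * (u * (a - c * x ^ e)) \<in> P e"
      using c u u' B_S[OF e] by (intro P_smult) (auto simp: lt_def)
    moreover have "u' * (u * (a - c * x ^ e)) \<in> A"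
      using cA Cons u u' B_A[OF e] A_closed by auto
    ultimately show ?thesis using low[OF b'(1)] b'(2) A_closed P_diff by (auto simp: w1_def)
  qed
  have e1: "u' * u * (a * l) - lam e * (b' * l) = w1 * l"
    unfolding w1_def using uc by (simp add: algebra_simps)
  have e2: "u' * (u * y) - lam e * (u'' * z)
      = u' * (u * y - lam e * z) + (- (lam e * u'' - u' * lam e)) * z"
    by (simp add: algebra_simps)
  have in1: "w1 * l \<in> prod_span (A \<inter> P e) L" using w1 Cons prod_span_mem by blast
  have in2: "u' * (u * y - lam e * z) \<in> prod_span (A \<inter> P e) L"
    using u(4) by (rule prod_span_mult_left)
      (use u'(1) B_A[OF e] B_S[OF e] A_closed P_smult in auto)
  have in3: "(- (lam e * u'' - u' * lam e)) * z \<in> prod_span (A \<inter> P e) L"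
    using u(3) by (rule prod_span_mult_left)
      (use AP_uminus[OF low[OF u''(1)]] u''(2) B_A[OF e] B_S[OF e] A_closed P_S in auto)
  have "u' * u * (a * l + y) - lam e * (b' * l + u'' * z) =
      (u' * u * (a * l) - lam e * (b' * l)) + (u' * (u * y) - lam e * (u'' * z))"
    by (simp add: algebra_simps)
  also have "\<dots> \<in> prod_span (A \<inter> P e) L"
    unfolding e1 e2 using in1 in2 in3 by (intro prod_span_add)
  finally have "u' * u * (a * l + y) - lam e * (b' * l + u'' * z) \<in> prod_span (A \<inter> P e) L" .
  moreover have "b' * l + u'' * z \<in> prod_span (B e) L"
    using b' Cons u'' u(3) B_mult[OF e]
    by (intro prod_span_Cons prod_span_mult_left[of z "B e"]) auto
  moreover have "u' * u \<in> B e" "regular S (u' * u)"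
    using u u' B_mult[OF e] regular_mult[OF subS] by auto
  ultimately show ?case by (intro bexI[of _ "u' * u"] conjI bexI[of _ "b' * l + u'' * z"])
qed

lemma prod_span_AP:
  assumes "f \<in> prod_span A L"
  shows "\<exists>n. f \<in> prod_span (A \<inter> P n) L"
  using assms
proof (induction rule: prod_span_induct)
  case zero then show ?case using prod_span_zero by blast
next
  case (Cons a l y)
  then obtain n m where nm: "y \<in> prod_span (A \<inter> P n) L" "a \<in> P m" using ASx by (auto simp: Sx_def)
  have "y \<in> prod_span (A \<inter> P (n + m)) L"
    by (rule prod_span_mono[OF nm(1)]) (auto intro: P_mono[of _ n])
  moreover have "a \<in> A \<inter> P (n + m)" using Cons nm P_mono[of a m] by auto
  ultimately show ?case using Cons prod_span_Cons by blast
qed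

lemma AP_span_P: "L \<subseteq> R \<Longrightarrow> y \<in> prod_span (A \<inter> P n) L \<Longrightarrow> y \<in> P n"
  by (rule prod_span_induct[of y "A \<inter> P n" L]) (auto simp: P_zero intro!: P_add P_S R_S)

text \<open>An element of low degree in \<open>AL\<close> may be a sum of products whose left
  factors have high degree and cancel. Each round lowers the bound on the factors by one:
  \<open>prod_span_lead\<close> extracts \<open>lam n * z\<close>, and \<open>z = 0\<close> because
  the whole element has degree below \<open>n\<close>.\<close>

lemma prod_span_reduce:
  assumes LR: "L \<subseteq> R" and f: "f \<in> prod_span A L" "f \<in> P m"
  shows "\<exists>u\<in>B 0. regular S u \<and> u * f \<in> prod_span (A \<inter> P m) L"
proof -
  have "f \<in> prod_span (A \<inter> P n) L \<Longrightarrow> f \<in> P m \<Longrightarrow>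
      \<exists>u\<in>B 0. regular S u \<and> u * f \<in> prod_span (A \<inter> P m) L" for n f
  proof (induction n arbitrary: f)
    case 0
    have "f \<in> prod_span (A \<inter> P m) L"
      by (rule prod_span_mono[OF 0(1)]) (auto intro: P_mono[of _ 0])
    then show ?case using B0_closed
      by (intro bexI[of _ 1]) (auto simp: regular_def S_closed)
  next
    case (Suc n)
    show ?case
    proof (cases "Suc n \<le> m")
      case True
      have "f \<in> prod_span (A \<inter> P m) L"
        by (rule prod_span_mono[OF Suc(2)]) (use True in \<open>auto intro: P_mono[of _ "Suc n" m]\<close>)
      then show ?thesis using B0_closed
        by (intro bexI[of _ 1]) (auto simp: regular_def S_closed)
    next
      case False
      then have fn: "f \<in> P n" using Suc P_mono[of f m n] by auto
      show ?thesis
      proof (cases "n \<in> D")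
        case True
        obtain u z where u: "u \<in> B n" "regular S u" "z \<in> prod_span (B n) L"
          "u * f - lam n * z \<in> prod_span (A \<inter> P n) L"
          using prod_span_lead[OF True LR Suc(2)] by blast
        have "u * f - lam n * z \<in> P n" using AP_span_P[OF LR u(4)] .
        moreover have "u * f \<in> P n" using fn u B_S[OF True] P_smult by blast
        ultimately have "lam n * z \<in> P n" using P_diff[of "u * f" n "u * f - lam n * z"] by simp
        then have "z = 0" using lam_in_P True B_subset[OF True LR u(3)] by blast
        then have "u * f \<in> prod_span (A \<inter> P n) L" using u by simp
        moreover have "u * f \<in> P m" using Suc u B_S[OF True] P_smult by blast
        ultimately obtain w where w: "w \<in> B 0" "regular S w" "w * (u * f) \<in> prod_span (A \<inter> P m) L"
          using Suc.IH by blast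
        then show ?thesis using u B_B0[OF True] B0_closed regular_mult[OF subS]
          by (intro bexI[of _ "w * u"]) (auto simp: mult.assoc)
      next
        case False
        \<comment> \<open>No element of \<open>A\<close> has degree \<open>n\<close>, so the factors
          already satisfy the next bound.\<close>
        have "A \<inter> P (Suc n) \<subseteq> A \<inter> P n"
        proof
          fix a assume a: "a \<in> A \<inter> P (Suc n)"
          then obtain c where c: "lt n c a" using P_Suc by blast
          then have "c = 0" using degD a False by blast
          then show "a \<in> A \<inter> P n" using a c lt_0_iff by blast
        qed
        then have "f \<in> prod_span (A \<inter> P n) L" using Suc(2) prod_span_mono by blast
        then show ?thesis using Suc by blast
      qed
    qed
  qed
  then show ?thesis using f prod_span_AP by blast
qed

text \<open>The representation is reduced to factors of degree at most \<open>m\<close>, since only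
  then does \<open>prod_span_lead\<close> apply in degree \<open>m\<close>. Regularity of the
  multiplier keeps the leading coefficient, and with it \<open>z\<close>, non-zero.\<close>

lemma prod_span_normal_form:
  assumes LR: "L \<subseteq> R" and f: "f \<in> prod_span A L" and lt: "lt m c f" "c \<noteq> 0" and m: "m \<in> D"
  shows "\<exists>u\<in>B 0. \<exists>z\<in>prod_span (B m) L. regular S u \<and> z \<noteq> 0 \<and> u * f - lam m * z \<in> P m"
proof -
  obtain u where u: "u \<in> B 0" "regular S u" "u * f \<in> prod_span (A \<inter> P (Suc m)) L"
    using prod_span_reduce[OF LR f lt_Suc_P[OF lt(1)]] by blast
  then obtain w z where w: "w \<in> B m" "regular S w" "z \<in> prod_span (B m) L"
    "w * (u * f) - lam m * z \<in> prod_span (A \<inter> P m) L" using prod_span_lead[OF m LR] by blast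
  have wP: "w * u * f - lam m * z \<in> P m" using AP_span_P[OF LR w(4)] by (simp add: mult.assoc)
  have wu: "w * u \<in> B 0" "regular S (w * u)"
    using u w B_B0[OF m] B0_closed regular_mult[OF subS] by auto
  have "z \<noteq> 0"
  proof
    assume "z = 0"
    then have "w * u * f \<in> P m" using wP by simp
    moreover have "lt m (w * u * c) (w * u * f)" using lt wu B_S[OF zero_D] by (intro lt_smult) auto
    ultimately have "w * u * c = 0" using lt_in_P by blast
    then show False using regularD(2)[OF wu(2)] lt lt_S by blast
  qed
  then show ?thesis using wP wu w by blast
qed

section \<open>Exact commutation with singular elements\<close>

lemma Z_S: "z \<in> Z \<Longrightarrow> z \<in> S"
  using left_ideal_subset[OF Z_left] .

lemma Z_alpha_pow: "z \<in> Z \<Longrightarrow> (\<alpha> ^^ n) z \<in> Z"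
  by (induction n) (auto simp: Z_alpha)

lemma pow_Z: "z \<in> Z \<Longrightarrow> x ^ n * z = (\<alpha> ^^ n) z * x ^ n"
proof (induction n)
  case (Suc n)
  then have "x ^ Suc n * z = x * (\<alpha> ^^ n) z * x ^ n" by (simp add: mult.assoc)
  also have "\<dots> = (\<alpha> ^^ Suc n) z * x ^ Suc n"
    using comm[of "(\<alpha> ^^ n) z"] Z_alpha_pow[OF Suc(2)] Z_S Z_delta by (simp add: mult.assoc)
  finally show ?case .
qed auto

text \<open>By \<open>pow_Z\<close> the difference is an element of \<open>S\<close> times
  \<open>x ^ m\<close>, by \<open>lam_comm\<close> it has degree below \<open>m\<close>; so it is
  0.\<close>

lemma lam_Z:
  assumes "m \<in> D" "z \<in> B m" "z \<in> Z"
  shows "lam m * z = alm m z * lam m"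
proof -
  obtain v where v: "regular S v" "lam m = v * x ^ m" using lam_form assms by blast
  have "lam m * z - alm m z * lam m = (v * (\<alpha> ^^ m) z - alm m z * v) * x ^ m"
    using v pow_Z[OF assms(3)] by (simp add: algebra_simps)
  moreover have "v * (\<alpha> ^^ m) z - alm m z * v \<in> S"
    using regularD(3)[OF v(1)] alpha_pow(1)[OF Z_S[OF assms(3)]] B_S[OF assms(1) alm(1)[OF assms(1,2)]]
    by (simp add: S_closed)
  ultimately show ?thesis using lam_comm[OF assms(1,2)] monom_in_P by (metis eq_iff_diff_eq_0 mult_zero_left)
qed

text \<open>The trace of \<open>Z\<close> on \<open>B m\<close> is the singular ideal of
  \<open>B m\<close>, which every automorphism of \<open>B m\<close> preserves.\<close>

lemma alm_Z: "m \<in> D \<Longrightarrow> z \<in> B m \<Longrightarrow> alm m z \<in> Z \<longleftrightarrow> z \<in> Z"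
  using automorph_sing_ideal[OF autB subB] singB alm(1) by blast

section \<open>Essential left ideals of a special subextension\<close>

lemma B0_singular: "b \<in> B 0 \<Longrightarrow> (\<And>p. p \<in> B 0 \<Longrightarrow> p \<noteq> 0 \<Longrightarrow> \<exists>q\<in>B 0. q * p \<noteq> 0 \<and> q * p * b = 0) \<Longrightarrow> b \<in> Z"
  using sing_ideal_iff[OF subB[OF zero_D]] singB[OF zero_D] by blast

text \<open>\<open>c\<close> need not lie in \<open>B 0\<close>, so \<open>sing\<close> only says
  that it behaves like a singular element under \<open>B 0\<close>. Clearing denominators replaces
  \<open>c * x ^ i\<close> by \<open>b * lam i\<close> with \<open>b\<close> in \<open>B i\<close>,
  and \<open>b\<close> is truly singular. Singular elements pass \<open>lam i\<close> without
  remainder, so a multiple of \<open>b * lam i\<close> is exactly \<open>lam i\<close> times an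
  element of the span of \<open>L\<close> over \<open>B i\<close>.\<close>

lemma essential_monomial:
  assumes LR: "L \<subseteq> R"
    and ess: "\<And>m p. m \<in> D \<Longrightarrow> p \<in> B m \<Longrightarrow> p \<noteq> 0 \<Longrightarrow> multiple_in (B m) p (prod_span (B m) L)"
    and i: "i \<in> D" and c: "c \<in> S" "c \<noteq> 0" "c * x ^ i \<in> A"
    and sing: "\<And>p. p \<in> B 0 \<Longrightarrow> p \<noteq> 0 \<Longrightarrow> \<exists>q\<in>B 0. q * p \<noteq> 0 \<and> q * p * c = 0"
  shows "multiple_in (B 0) (c * x ^ i) (prod_span A L)"
proof -
  obtain u b where u: "u \<in> B i" "regular S u" "b \<in> B i" "u * c * x ^ i = b * lam i"
    using denom[OF i c(1,3)] by blast
  obtain v where v: "regular S v" "lam i = v * x ^ i" using lam_form i by blast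
  have S: "u \<in> S" "b \<in> S" "v \<in> S" using u v B_S[OF i] regularD(3) by auto
  have ucb: "u * c = b * v"
  proof -
    have "lt i (u * c) (u * c * x ^ i)" "lt i (b * v) (b * v * x ^ i)" using S c S_closed by (auto intro!: lt_monom)
    then show ?thesis using u(4) v lt_unique by (simp add: mult.assoc)
  qed
  have bne: "b \<noteq> 0" using ucb regularD(2)[OF u(2) c(1)] c by auto
  \<comment> \<open>Singularity passes from \<open>c\<close> to \<open>b\<close>: test
    \<open>c\<close> against \<open>p * u\<close> and cancel the regular \<open>v\<close> in
    \<open>u * c = b * v\<close>.\<close>
  have "b \<in> Z"
  proof (rule B0_singular)
    show "b \<in> B 0" using B_B0 i u by blast
    fix p assume p: "p \<in> B 0" "p \<noteq> 0"
    have pS: "p \<in> S" using p B_S[OF zero_D] by blast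
    have "p * u \<in> B 0" using p u B_B0[OF i] B0_closed by auto
    moreover have "p * u \<noteq> 0" using regularD(1)[OF u(2) pS] p by blast
    ultimately obtain q where q: "q \<in> B 0" "q * (p * u) \<noteq> 0" "q * (p * u) * c = 0" using sing by blast
    have "(q * p * b) * v = q * (p * u) * c" using ucb by (simp add: mult.assoc)
    then have "q * p * b = 0" using q regularD(1)[OF v(1)] pS S B_S[OF zero_D q(1)] S_closed by simp
    moreover have "q * p \<noteq> 0" using q(2) by (metis mult.assoc mult_zero_left)
    ultimately show "\<exists>q\<in>B 0. q * p \<noteq> 0 \<and> q * p * b = 0" using q by blast
  qed
  obtain z0 where z0: "z0 \<in> B i" "alm i z0 = b" using alm(5)[OF i u(3)] by blast
  have z0Z: "z0 \<in> Z" using alm_Z[OF i z0(1)] z0 \<open>b \<in> Z\<close> by simp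
  have "z0 \<noteq> 0" using bne z0 automorph_zero[OF autB subB] i by blast
  then obtain r0 where r0: "r0 \<in> B i" "r0 * z0 \<noteq> 0" "r0 * z0 \<in> prod_span (B i) L"
    using ess[OF i z0(1)] by blast
  define r where "r = alm i r0"
  have r: "r \<in> B i" "r * b = alm i (r0 * z0)" using alm(1,4)[OF i] r0 z0 by (auto simp: r_def)
  have zB: "r0 * z0 \<in> B i" using B_mult i r0 z0 by blast
  have zZ: "r0 * z0 \<in> Z" using left_ideal_mult[OF Z_left _ z0Z] B_S[OF i r0(1)] by blast
  have eq: "r * u * (c * x ^ i) = lam i * (r0 * z0)"
  proof -
    have "r * u * (c * x ^ i) = r * (u * c * x ^ i)" by (simp add: mult.assoc)
    also have "\<dots> = (r * b) * lam i" using u(4) by (simp add: mult.assoc)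
    also have "\<dots> = lam i * (r0 * z0)" using lam_Z[OF i zB zZ] r by simp
    finally show ?thesis .
  qed
  have "lam i * (r0 * z0) \<in> prod_span A L"
    using r0(3) by (rule prod_span_mult_left) (use lam_A[OF i] B_A[OF i] A_closed in auto)
  moreover have "lam i * (r0 * z0) \<noteq> 0" using lam_in_P[OF i zB] r0(2) P_zero by auto
  moreover have "r * u \<in> B 0" using r u B_B0[OF i] B0_closed by auto
  ultimately show ?thesis using eq by metis
qed

text \<open>The monomials of \<open>f\<close> are moved into \<open>AL\<close> one at a time. Each
  coefficient inherits the singular behaviour of \<open>f\<close>, because by freeness
  \<open>q * f = 0\<close> kills all coefficients; and a multiplier that keeps one coefficient
  non-zero keeps \<open>q * f\<close> non-zero.\<close>

lemma essential_singular_element: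
  assumes LR: "L \<subseteq> R"
    and ess: "\<And>m p. m \<in> D \<Longrightarrow> p \<in> B m \<Longrightarrow> p \<noteq> 0 \<Longrightarrow> multiple_in (B m) p (prod_span (B m) L)"
    and f: "f \<in> A" "f \<noteq> 0"
    and sing: "\<And>p. p \<in> B 0 \<Longrightarrow> p \<noteq> 0 \<Longrightarrow> \<exists>q\<in>B 0. q * p \<noteq> 0 \<and> q * p * f = 0"
  shows "multiple_in (B 0) f (prod_span A L)"
proof -
  obtain N c where c: "\<forall>m. c m \<in> S \<and> c m * x ^ m \<in> A" "f = (\<Sum>m\<le>N. c m * x ^ m)"
    using homog f by blast
  have qf: "q * f = (\<Sum>m\<le>N. (q * c m) * x ^ m)" for q
    by (simp add: c sum_distrib_left mult.assoc)
  have coeff: "q * c m = 0" if "q \<in> S" "q * f = 0" "m \<le> N" for q m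
    using free[of "\<lambda>m. q * c m" N m] qf[of q] that c S_closed by auto
  have "n \<le> Suc N \<Longrightarrow> \<exists>q\<in>B 0. q * f \<noteq> 0 \<and> (\<forall>m<n. q * c m * x ^ m \<in> prod_span A L)" for n
  proof (induction n)
    case 0 then show ?case using f B0_closed by (intro bexI[of _ 1]) auto
  next
    case (Suc n)
    then obtain q where q: "q \<in> B 0" "q * f \<noteq> 0" "\<forall>m<n. q * c m * x ^ m \<in> prod_span A L" by auto
    have qS: "q \<in> S" and qA: "q \<in> A" using q B_S[OF zero_D] B_A[OF zero_D] by auto
    have mult: "q' * q * c m * x ^ m \<in> prod_span A L" if "q' \<in> B 0" "m < n" for q' m
    proof -
      have "q' * (q * c m * x ^ m) \<in> prod_span A L"
        by (rule prod_span_mult_left[of _ A]) (use that q B_A[OF zero_D] A_closed in auto)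
      then show ?thesis by (simp add: mult.assoc)
    qed
    show ?case
    proof (cases "q * c n = 0")
      case True
      then show ?thesis using q by (intro bexI[of _ q]) (auto simp: less_Suc_eq prod_span_zero)
    next
      case False
      have cS: "q * c n \<in> S" using qS c by (simp add: S_closed)
      have cA: "q * c n * x ^ n \<in> A" using qA c A_closed by (simp add: mult.assoc)
      have nD: "n \<in> D" using degD[OF cA lt_monom[OF cS] False] .
      have "\<exists>q'\<in>B 0. q' * (q * c n * x ^ n) \<noteq> 0 \<and> q' * (q * c n * x ^ n) \<in> prod_span A L"
      proof (rule essential_monomial[OF LR ess nD cS False cA])
        fix p assume p: "p \<in> B 0" "p \<noteq> 0"
        show "\<exists>q'\<in>B 0. q' * p \<noteq> 0 \<and> q' * p * (q * c n) = 0"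
        proof (cases "p * q = 0")
          case True
          then show ?thesis using p B0_closed
            by (intro bexI[of _ 1]) (auto simp: mult.assoc[symmetric])
        next
          case False
          moreover have pq: "p * q \<in> B 0" using p q by (simp add: B0_closed)
          ultimately obtain q' where q': "q' \<in> B 0" "q' * (p * q) \<noteq> 0" "q' * (p * q) * f = 0"
            using sing[of "p * q"] by blast
          then have "q' * (p * q) * c n = 0"
            using coeff[of "q' * (p * q)" n] Suc(2) B_S[OF zero_D, of "q' * (p * q)"] pq
            by (simp add: B0_closed)
          moreover have "q' * p \<noteq> 0" using q'(2) by (metis mult.assoc mult_zero_left)
          ultimately show ?thesis using q' by (auto simp: mult.assoc)
        qed
      qed auto
      then obtain q' where q': "q' \<in> B 0" "q' * (q * c n * x ^ n) \<noteq> 0"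
        "q' * (q * c n * x ^ n) \<in> prod_span A L" by blast
      have "q' * q * c n \<noteq> 0" using q'(2) by (metis mult.assoc mult_zero_left)
      then have "q' * q * f \<noteq> 0" using coeff[of "q' * q" n] Suc(2) B_S[OF zero_D] q' q B0_closed by auto
      moreover have "q' * q * c n * x ^ n \<in> prod_span A L" using q' by (simp add: mult.assoc)
      ultimately show ?thesis using q q' mult B0_closed
        by (intro bexI[of _ "q' * q"]) (auto simp: less_Suc_eq)
    qed
  qed
  from this[of "Suc N"] obtain q where q: "q \<in> B 0" "q * f \<noteq> 0"
    "\<forall>m<Suc N. q * c m * x ^ m \<in> prod_span A L" by auto
  moreover have "q * f \<in> prod_span A L" unfolding qf using q by (intro prod_span_sum) auto
  ultimately show ?thesis by blast
qed

text \<open>The multiplier is taken in \<open>B 0\<close>, that is in degree 0, so that it acts on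
  each coefficient separately. If some non-zero multiple of \<open>f\<close> has lower degree,
  induction applies; otherwise whatever annihilates the leading coefficient of \<open>f\<close>
  annihilates \<open>f\<close>.\<close>

theorem essential_step:
  assumes LR: "L \<subseteq> R"
    and ess: "\<And>m p. m \<in> D \<Longrightarrow> p \<in> B m \<Longrightarrow> p \<noteq> 0 \<Longrightarrow> multiple_in (B m) p (prod_span (B m) L)"
    and f: "f \<in> A" "f \<noteq> 0"
  shows "multiple_in (B 0) f (prod_span A L)"
proof -
  have "f \<in> P n \<Longrightarrow> f \<in> A \<Longrightarrow> f \<noteq> 0 \<Longrightarrow> multiple_in (B 0) f (prod_span A L)" for n f
  proof (induction n arbitrary: f rule: less_induct)
    case (less n)
    obtain m c where mc: "m < n" "lt m c f" "c \<noteq> 0" using lt_exists less by blast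
    have m: "m \<in> D" using degD less mc by blast
    show ?case
    proof (cases "multiple_in (B 0) f (P m)")
      case True
      then obtain p where p: "p \<in> B 0" "p * f \<noteq> 0" "p * f \<in> P m" by blast
      moreover have "p * f \<in> A" using p less B_A[OF zero_D] A_closed by auto
      ultimately obtain q where "q \<in> B 0" "q * (p * f) \<noteq> 0" "q * (p * f) \<in> prod_span A L"
        using less.IH mc by blast
      then show ?thesis using p B0_closed by (intro bexI[of _ "q * p"]) (auto simp: mult.assoc)
    next
      case False
      have good: "p * f = 0" if "p \<in> B 0" "p * c = 0" for p
        using lt_smult[OF _ mc(2), of p] that B_S[OF zero_D] False lt_0_iff by auto
      \<comment> \<open>With \<open>R\<close> in place of \<open>L\<close> the normal form applies
        to every element of \<open>A\<close> and brings its leading coefficient under the control of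
        \<open>B m\<close>.\<close>
      have "f \<in> prod_span A R" using prod_span_mem[of f A 1 R] less subring_one[OF subR] by simp
      then obtain u z0 where u: "u \<in> B 0" "z0 \<in> prod_span (B m) R" "regular S u" "z0 \<noteq> 0"
        "u * f - lam m * z0 \<in> P m" using prod_span_normal_form[OF subset_refl _ mc(2,3) m] by blast
      have z0: "z0 \<in> B m" using B_subset[OF m _ u(2)] by blast
      obtain r0 where r0: "r0 \<in> B m" "r0 * z0 \<noteq> 0" "r0 * z0 \<in> prod_span (B m) L"
        using ess[OF m z0 u(4)] by blast
      define r z h where "r = alm m r0" and "z = r0 * z0" and "h = r * u * f - lam m * z"
      have r: "r \<in> B 0" using alm(1)[OF m r0(1)] B_B0[OF m] by (simp add: r_def)
      have ruB: "r * u \<in> B 0" using r u B0_closed by auto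
      have zB: "z \<in> B m" using B_mult m r0 z0 by (simp add: z_def)
      have hP: "h \<in> P m" using lam_shift[OF m z0 r0(1) u(5)]
        by (simp add: h_def r_def z_def mult.assoc)
      have lz: "lam m * z \<in> prod_span A L" unfolding z_def
        using r0(3) by (rule prod_span_mult_left) (use lam_A[OF m] B_A[OF m] A_closed in auto)
      have hA: "h \<in> A" using r u less zB lam_A[OF m] B_A[OF m] B_A[OF zero_D] A_closed
        by (auto simp: h_def)
      obtain v where v: "regular S v" "lam m = v * x ^ m" using lam_form m by blast
      define a where "a = alm m z * v"
      have "lt m a (lam m * z)" using lam_lt[OF m v(2,1) zB] by (simp add: a_def)
      moreover have "lt m (r * u * c) (r * u * f)" using lt_smult mc ruB B_S[OF zero_D] by blast
      ultimately have "lt m (r * u * c - a) h" using lt_diff by (auto simp: h_def)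
      then have ruc: "r * u * c = a" using lt_in_P hP by fastforce
      have almz: "alm m z \<in> B m" using alm(1) m zB by blast
      have almz0: "alm m z \<noteq> 0" using automorph_eq_zero[OF autB[OF m] subB[OF m] zB] r0 by (simp add: z_def)
      \<comment> \<open>Either some \<open>q\<close> brings the remainder \<open>h\<close> into
        \<open>AL\<close> without killing \<open>alm m z\<close>, and then
        \<open>q * (r * u) * f\<close> is the multiple wanted; or every such \<open>q\<close> kills
        it, and then \<open>r * u * f\<close> behaves like a singular element.\<close>
      show ?thesis
      proof (cases "\<exists>q\<in>B 0. q * h \<in> prod_span A L \<and> q * alm m z \<noteq> 0")
        case True
        then obtain q where q: "q \<in> B 0" "q * h \<in> prod_span A L" "q * alm m z \<noteq> 0" by blast
        have "q * (lam m * z) \<in> prod_span A L" using lz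
          by (rule prod_span_mult_left) (use q B_A[OF zero_D] A_closed in auto)
        then have "q * h + q * (lam m * z) \<in> prod_span A L" using q prod_span_add by blast
        then have "q * (r * u) * f \<in> prod_span A L" by (simp add: h_def algebra_simps)
        moreover have "q * (r * u) * f \<noteq> 0"
        proof
          assume *: "q * (r * u) * f = 0"
          have "q * (r * u) \<in> B 0" using q ruB B0_closed by auto
          then have "lt m (q * (r * u) * c) (q * (r * u) * f)" using lt_smult mc B_S[OF zero_D] by blast
          then have "q * (r * u) * c = 0" using * lt_zero by simp
          then have "q * alm m z * v = 0" using ruc by (simp add: a_def mult.assoc)
          moreover have "q * alm m z \<in> S" using q almz B_S[OF m] B_S[OF zero_D] S_closed by auto
          ultimately show False using q regularD(1)[OF v(1)] by blast
        qed
        ultimately show ?thesis using q ruB B0_closed by (intro bexI[of _ "q * (r * u)"]) auto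
      next
        case False
        \<comment> \<open>Induction puts a multiple of \<open>p * h\<close> into \<open>AL\<close>;
          by the case assumption its multiplier kills the leading coefficient of
          \<open>r * u * f\<close>, hence by \<open>good\<close> the whole element.\<close>
        have sing: "\<exists>q\<in>B 0. q * p \<noteq> 0 \<and> q * p * (r * u * f) = 0" if p: "p \<in> B 0" "p \<noteq> 0" for p
        proof -
          obtain q where q: "q \<in> B 0" "q * p \<noteq> 0" "q * p * h \<in> prod_span A L"
          proof (cases "p * h = 0")
            case True
            then show ?thesis using that[of 1] p B0_closed prod_span_zero[of A L] by auto
          next
            case False
            moreover have "p * h \<in> P m" "p * h \<in> A"
              using p hP hA P_smult B_S[OF zero_D] B_A[OF zero_D] A_closed by auto
            ultimately obtain q where q: "q \<in> B 0" "q * (p * h) \<noteq> 0" "q * (p * h) \<in> prod_span A L"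
              using less.IH[OF mc(1)] by blast
            moreover have "q * p \<noteq> 0" using q(2) by (metis mult.assoc mult_zero_left)
            ultimately show ?thesis using that[of q] by (auto simp: mult.assoc)
          qed
          have qp: "q * p \<in> B 0" using q p B0_closed by auto
          then have "q * p * alm m z = 0" using False q by blast
          then have "q * p * (r * u) * c = 0" using ruc by (metis a_def mult.assoc mult_zero_left)
          then have "q * p * (r * u) * f = 0" using good[of "q * p * (r * u)"] qp ruB B0_closed by auto
          then show ?thesis using q by (auto simp: mult.assoc)
        qed
        have "a \<noteq> 0" using regularD(1)[OF v(1) B_S[OF m almz]] almz0 by (auto simp: a_def)
        then have ne: "r * u * f \<noteq> 0"
          using ruc lt_smult[OF B_S[OF zero_D ruB] mc(2)] lt_zero by force
        have "r * u * f \<in> A" using ruB B_A[OF zero_D] less A_closed by auto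
        from essential_singular_element[OF LR ess this ne sing]
        obtain q where "q \<in> B 0" "q * (r * u * f) \<noteq> 0" "q * (r * u * f) \<in> prod_span A L" by blast
        then show ?thesis using ruB B0_closed by (intro bexI[of _ "q * (r * u)"]) (auto simp: mult.assoc)
      qed
    qed
  qed
  then show ?thesis using f ASx by (auto simp: Sx_def)
qed

section \<open>Uniform left ideals of a special subextension\<close>

lemma lt_cong: "lt m a f \<Longrightarrow> g - f \<in> P m \<Longrightarrow> lt m a g"
  using P_add[of "g - f" m "f - a * x ^ m"] by (simp add: lt_def)

text \<open>\<open>g\<close> is raised to degree \<open>m\<close> by \<open>lam (m - k)\<close>.
  Both normal forms have their \<open>z\<close> in the span of \<open>L\<close> over
  \<open>B m\<close>, where uniformity gives a common multiple; \<open>lam_shift\<close> carries the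
  two multipliers over to \<open>f\<close> and \<open>g\<close>.\<close>

lemma uniform_common_lead:
  assumes LR: "L \<subseteq> R"
    and unif: "\<And>m f g. m \<in> D \<Longrightarrow> f \<in> prod_span (B m) L \<Longrightarrow> f \<noteq> 0 \<Longrightarrow> g \<in> prod_span (B m) L \<Longrightarrow> g \<noteq> 0
      \<Longrightarrow> common_multiple (B m) f g"
    and f: "f \<in> prod_span A L" "lt m c f" "c \<noteq> 0"
    and g: "g \<in> prod_span A L" "lt k d g" "d \<noteq> 0" and km: "k \<le> m"
  shows "\<exists>p\<in>B 0. \<exists>q\<in>B 0. \<exists>z\<in>prod_span (B m) L. z \<noteq> 0 \<and>
    p * f - lam m * z \<in> P m \<and> q * (lam (m - k) * g) - lam m * z \<in> P m"
proof -
  have LA: "L \<subseteq> A" using LR RA by blast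
  have m: "m \<in> D" using degD[OF prod_span_subset[OF subA LA f(1)] f(2,3)] .
  have k: "k \<in> D" using degD[OF prod_span_subset[OF subA LA g(1)] g(2,3)] .
  have mk: "m - k \<in> D" using D_diff m k km by blast
  obtain v where v: "regular S v" "lam (m - k) = v * x ^ (m - k)" using lam_form mk by blast
  have vS: "v \<in> S" using v regularD(3) by blast
  have dS: "d \<in> S" using g lt_S by blast
  have "lt (m - k + k) (v * (\<alpha> ^^ (m - k)) d) (lam (m - k) * g)"
    unfolding v(2) by (intro lt_mult lt_monom vS g(2))
  then have ltg: "lt m (v * (\<alpha> ^^ (m - k)) d) (lam (m - k) * g)" using km by simp
  have ne: "v * (\<alpha> ^^ (m - k)) d \<noteq> 0"
    using regularD(2)[OF v(1) alpha_pow(1)[OF dS]] alpha_pow_eq_zero[OF dS] g(3) by blast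
  have lg: "lam (m - k) * g \<in> prod_span A L" using g(1)
    by (rule prod_span_mult_left) (use lam_A[OF mk] A_closed in auto)
  obtain u1 z1 where u1: "u1 \<in> B 0" "z1 \<in> prod_span (B m) L" "z1 \<noteq> 0" "u1 * f - lam m * z1 \<in> P m"
    using prod_span_normal_form[OF LR f m] by blast
  obtain u2 z2 where u2: "u2 \<in> B 0" "z2 \<in> prod_span (B m) L" "z2 \<noteq> 0"
    "u2 * (lam (m - k) * g) - lam m * z2 \<in> P m"
    using prod_span_normal_form[OF LR lg ltg ne m] by blast
  obtain s t where st: "s \<in> B m" "t \<in> B m" "s * z1 = t * z2" "s * z1 \<noteq> 0"
    using unif[OF m u1(2,3) u2(2,3)] by blast
  have "alm m s * (u1 * f) - lam m * (s * z1) \<in> P m"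
    by (rule lam_shift[OF m B_subset[OF m LR u1(2)] st(1) u1(4)])
  moreover have "alm m t * (u2 * (lam (m - k) * g)) - lam m * (t * z2) \<in> P m"
    by (rule lam_shift[OF m B_subset[OF m LR u2(2)] st(2) u2(4)])
  moreover have "s * z1 \<in> prod_span (B m) L" using u1(2)
    by (rule prod_span_mult_left) (use st B_mult[OF m] in auto)
  moreover have "alm m s * u1 \<in> B 0" "alm m t * u2 \<in> B 0"
    using u1 u2 B_B0[OF m alm(1)[OF m]] st by (auto simp: B0_closed)
  ultimately show ?thesis using st
    by (intro bexI[of _ "alm m s * u1"] bexI[of _ "alm m t * u2"] bexI[of _ "s * z1"]) (auto simp: mult.assoc)
qed

lemma AL_closed:
  assumes "L \<subseteq> R"
  shows "a \<in> A \<Longrightarrow> y \<in> prod_span A L \<Longrightarrow> a * y \<in> prod_span A L"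
    "y \<in> prod_span A L \<Longrightarrow> w \<in> prod_span A L \<Longrightarrow> y - w \<in> prod_span A L"
    "y \<in> prod_span A L \<Longrightarrow> y \<in> A" "y \<in> prod_span A L \<Longrightarrow> y \<in> Sx"
proof -
  have "L \<subseteq> A" using assms RA by blast
  note li = left_ideal_prod_span[OF subA this]
  show "a \<in> A \<Longrightarrow> y \<in> prod_span A L \<Longrightarrow> a * y \<in> prod_span A L" using left_ideal_mult[OF li] .
  show "y \<in> prod_span A L \<Longrightarrow> w \<in> prod_span A L \<Longrightarrow> y - w \<in> prod_span A L" using left_ideal_diff[OF li] .
  show "y \<in> prod_span A L \<Longrightarrow> y \<in> A" using left_ideal_subset[OF li] .
  then show "y \<in> prod_span A L \<Longrightarrow> y \<in> Sx" using ASx by blast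
qed

text \<open>Induction on the sum of the two degrees. Having a common multiple is symmetric, so the
  case \<open>k \<le> m\<close> suffices; exchanging \<open>f\<close> and \<open>g\<close> exchanges
  the two induction hypotheses.\<close>

lemma uniform_degree_induct:
  assumes LR: "L \<subseteq> R"
    and step: "\<And>m c f k d g. f \<in> prod_span A L \<Longrightarrow> lt m c f \<Longrightarrow> c \<noteq> 0 \<Longrightarrow> g \<in> prod_span A L \<Longrightarrow> lt k d g \<Longrightarrow>
      d \<noteq> 0 \<Longrightarrow> k \<le> m \<Longrightarrow>
      (\<And>h. h \<in> prod_span A L \<Longrightarrow> h \<noteq> 0 \<Longrightarrow> h \<in> P m \<Longrightarrow> common_multiple A h g) \<Longrightarrow>
      (\<And>h. h \<in> prod_span A L \<Longrightarrow> h \<noteq> 0 \<Longrightarrow> h \<in> P k \<Longrightarrow> common_multiple A f h) \<Longrightarrow>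
      common_multiple A f g"
    and f: "f \<in> prod_span A L" "f \<noteq> 0" and g: "g \<in> prod_span A L" "g \<noteq> 0"
  shows "common_multiple A f g"
proof -
  have main: "f \<in> prod_span A L \<Longrightarrow> lt m c f \<Longrightarrow> c \<noteq> 0 \<Longrightarrow> g \<in> prod_span A L \<Longrightarrow> lt k d g \<Longrightarrow> d \<noteq> 0 \<Longrightarrow>
     m + k = n \<Longrightarrow> common_multiple A f g" for n m k c d f g
  proof (induction n arbitrary: m k c d f g rule: less_induct)
    case (less n)
    have IH1: "common_multiple A h g" if h: "h \<in> prod_span A L" "h \<noteq> 0" "h \<in> P m" for h
    proof -
      obtain m' c' where "m' < m" "lt m' c' h" "c' \<noteq> 0" using lt_exists h by blast
      then show ?thesis using less.IH[of "m' + k" h m' c' g k d] less.prems h by auto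
    qed
    have IH2: "common_multiple A f h" if h: "h \<in> prod_span A L" "h \<noteq> 0" "h \<in> P k" for h
    proof -
      obtain k' d' where "k' < k" "lt k' d' h" "d' \<noteq> 0" using lt_exists h by blast
      then show ?thesis using less.IH[of "m + k'" f m c h k' d'] less.prems h by auto
    qed
    show ?case
    proof (cases "k \<le> m")
      case True
      then show ?thesis using step[OF less.prems(1-6) True IH1 IH2] by blast
    next
      case False
      then have "m \<le> k" by simp
      have IH1': "common_multiple A h f"
        if h: "h \<in> prod_span A L" "h \<noteq> 0" "h \<in> P k" for h using IH2[OF h] by metis
      have IH2': "common_multiple A g h"
        if h: "h \<in> prod_span A L" "h \<noteq> 0" "h \<in> P m" for h using IH1[OF h] by metis
      obtain s t where st: "s \<in> A" "t \<in> A" "s * g = t * f" "s * g \<noteq> 0"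
        using step[OF less.prems(4,5,6,1,2,3) \<open>m \<le> k\<close> IH1' IH2'] by blast
      then have "t * f = s * g \<and> t * f \<noteq> 0" by simp
      then show ?thesis using st by blast
    qed
  qed
  obtain m c where "lt m c f" "c \<noteq> 0" using lt_exists_Sx[OF AL_closed(4)[OF LR f(1)] f(2)] by blast
  moreover obtain k d where "lt k d g" "d \<noteq> 0" using lt_exists_Sx[OF AL_closed(4)[OF LR g(1)] g(2)] by blast
  ultimately show ?thesis using main f g by blast
qed

text \<open>After multiplication by \<open>j\<close>, any \<open>t\<close> with
  \<open>t * j * f' = 0\<close> satisfies \<open>t * j = 0\<close>. A common multiple
  \<open>t * h\<close> of the difference \<open>h\<close> with \<open>g\<close> therefore yields one
  of \<open>f\<close> with \<open>g\<close>: were the new one zero, \<open>t * h\<close> would be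
  zero as well.\<close>

theorem uniform_step_nonsingular:
  assumes LR: "L \<subseteq> R"
    and unif: "\<And>m f g. m \<in> D \<Longrightarrow> f \<in> prod_span (B m) L \<Longrightarrow> f \<noteq> 0 \<Longrightarrow> g \<in> prod_span (B m) L \<Longrightarrow> g \<noteq> 0
      \<Longrightarrow> common_multiple (B m) f g"
    and nonsing: "\<And>a. a \<in> S \<Longrightarrow> a \<notin> Z \<Longrightarrow> \<exists>j\<in>R. j \<noteq> 0 \<and> (\<forall>s\<in>S. s * j * a = 0 \<longrightarrow> s * j = 0)"
    and LZ: "\<And>y. y \<in> prod_span S L \<Longrightarrow> y \<in> Z \<Longrightarrow> y = 0"
    and f: "f \<in> prod_span A L" "f \<noteq> 0" and g: "g \<in> prod_span A L" "g \<noteq> 0"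
  shows "common_multiple A f g"
proof (rule uniform_degree_induct[OF LR _ f g])
  fix m c f k d g
  assume f: "f \<in> prod_span A L" "lt m c f" "c \<noteq> 0" and g: "g \<in> prod_span A L" "lt k d g" "d \<noteq> 0"
    and km: "k \<le> m"
    and IH: "\<And>h. h \<in> prod_span A L \<Longrightarrow> h \<noteq> 0 \<Longrightarrow> h \<in> P m \<Longrightarrow> common_multiple A h g"
  have m: "m \<in> D" "k \<in> D" using degD AL_closed(3)[OF LR] f g by blast+
  then have mk: "m - k \<in> D" using D_diff km by blast
  obtain p q z where pq: "p \<in> B 0" "q \<in> B 0" "z \<in> prod_span (B m) L" "z \<noteq> 0"
    "p * f - lam m * z \<in> P m" "q * (lam (m - k) * g) - lam m * z \<in> P m"
    using uniform_common_lead[OF LR unif f g km] by blast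
  obtain v where v: "regular S v" "lam m = v * x ^ m" using lam_form m by blast
  have zB: "z \<in> B m" using B_subset[OF m(1) LR pq(3)] .
  define a where "a = alm m z"
  have aB: "a \<in> B m" using alm(1) m zB by (simp add: a_def)
  have aS: "a \<in> S" using B_S m aB by blast
  have "a \<notin> Z"
  proof
    assume "a \<in> Z"
    then have "z \<in> Z" using alm_Z m zB by (simp add: a_def)
    moreover have "z \<in> prod_span S L" using prod_span_mono[OF pq(3)] B_S[OF m(1)] by blast
    ultimately show False using LZ pq by blast
  qed
  then obtain j where j: "j \<in> R" "j \<noteq> 0" "\<forall>s\<in>S. s * j * a = 0 \<longrightarrow> s * j = 0" using nonsing aS by blast
  have jS: "j \<in> S" "j \<in> A" using j R_S RA by auto
  have ltz: "lt m (a * v) (lam m * z)" using lam_lt[OF m(1) v(2,1) zB] by (simp add: a_def)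
  have avS: "a * v \<in> S" using lt_S[OF ltz] .
  define f' g' where "f' = p * f" and "g' = q * (lam (m - k) * g)"
  have lt': "lt m (a * v) f'" "lt m (a * v) g'"
    using lt_cong[OF ltz] pq by (auto simp: f'_def g'_def)
  \<comment> \<open>The leading coefficient is \<open>a * v\<close>; the regular \<open>v\<close> is
    cancelled before the property of \<open>j\<close> is used.\<close>
  have ann: "t * j = 0" if "t \<in> A" "t * j * f' = 0" for t
  proof (rule annihilator_lt[OF jS(1) lt'(1)])
    fix b assume b: "b \<in> S" "b * j * (a * v) = 0"
    then have "b * j * a = 0" using regularD(1)[OF v(1), of "b * j * a"] jS aS
      by (simp add: S_closed mult.assoc)
    then show "b * j = 0" using j b by blast
  qed (use that ASx in auto)
  have inAL: "f' \<in> prod_span A L" "g' \<in> prod_span A L"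
    using pq f g B_A[OF zero_D] lam_A[OF mk] AL_closed(1)[OF LR] by (auto simp: f'_def g'_def)
  have jf': "j * f' \<noteq> 0" using ann[of 1] j A_closed by auto
  define h where "h = j * f' - j * g'"
  have h: "h \<in> prod_span A L" using inAL jS AL_closed(1,2)[OF LR] by (simp add: h_def)
  have hP: "h \<in> P m" using lt_diff_P[OF lt_smult[OF jS(1) lt'(1)] lt_smult[OF jS(1) lt'(2)]] by (simp add: h_def)
  have pA: "p \<in> A" "q \<in> A" using pq B_A[OF zero_D] by auto
  show "common_multiple A f g"
  proof (cases "h = 0")
    case True
    then have "j * p * f = j * q * lam (m - k) * g" "j * p * f \<noteq> 0"
      using jf' by (auto simp: h_def f'_def g'_def mult.assoc)
    then show ?thesis using pA jS lam_A[OF mk] A_closed(6) by metis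
  next
    case False
    then obtain t s where ts: "t \<in> A" "s \<in> A" "t * h = s * g" "t * h \<noteq> 0" using IH h hP by blast
    have eq: "(t * j * p) * f = (t * j * q * lam (m - k) + s) * g"
    proof -
      have "(t * j * p) * f = t * h + t * j * g'" by (simp add: h_def f'_def algebra_simps)
      then show ?thesis using ts by (simp add: g'_def algebra_simps)
    qed
    have "(t * j * p) * f \<noteq> 0"
    proof
      assume "(t * j * p) * f = 0"
      then have "t * j = 0" using ann[OF ts(1)] by (simp add: f'_def mult.assoc)
      then have "t * h = 0" by (simp add: h_def right_diff_distrib mult.assoc[symmetric])
      then show False using ts by blast
    qed
    moreover have "t * j * p \<in> A" "t * j * q * lam (m - k) + s \<in> A"
      using ts jS pA lam_A[OF mk] by (auto simp: A_closed)
    ultimately show ?thesis using eq by blast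
  qed
qed

text \<open>\<open>x\<close> passes elements of \<open>Z\<close> without \<delta>-terms, so the left
  coefficients of \<open>a * l\<close> stay in the left ideal \<open>Z\<close>.\<close>

lemma AL_singular:
  assumes "L \<subseteq> R" "L \<subseteq> Z" "f \<in> prod_span A L"
  shows "f \<in> prod_span Z (range (\<lambda>n. x ^ n))"
  using assms(3)
proof (induction rule: prod_span_induct)
  case zero then show ?case by (rule prod_span_zero)
next
  case (Cons a l y)
  obtain N c where c: "\<forall>m. c m \<in> S" "a = (\<Sum>m\<le>N. c m * x ^ m)"
    using Sx_coeffs Cons ASx by blast
  have lZ: "l \<in> Z" using Cons assms by blast
  have "a * l = (\<Sum>m\<le>N. (c m * (\<alpha> ^^ m) l) * x ^ m)"
    by (simp add: c sum_distrib_right mult.assoc pow_Z[OF lZ])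
  also have "\<dots> \<in> prod_span Z (range (\<lambda>n. x ^ n))"
    using c left_ideal_mult[OF Z_left _ Z_alpha_pow[OF lZ]] by (intro prod_span_sum prod_span_mem) auto
  finally show ?case using Cons prod_span_add by blast
qed

text \<open>Clear denominators: \<open>u * q * x ^ d = b * lam d\<close> with
  \<open>b = alm d b'\<close>. The two expressions for the leading coefficient of
  \<open>lam d * b'\<close> agree, which turns the condition on \<open>q\<close> into
  \<open>b' * c = 0\<close>, so \<open>b' * g = 0\<close> by \<open>good\<close>. The difference of
  \<open>lam d * b'\<close> and \<open>b * lam d\<close> annihilates \<open>Z\<close> and hence
  \<open>g\<close>, so \<open>b * lam d * g = 0\<close>, and \<open>u\<close> is cancelled.\<close>

lemma monomial_annihilates:
  assumes g: "g \<in> prod_span Z (range (\<lambda>n. x ^ n))" "lt n c g"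
    and good: "\<And>p. p \<in> B 0 \<Longrightarrow> p * c = 0 \<Longrightarrow> p * g = 0"
    and q: "q \<in> S" "q * x ^ d \<in> A" "q * (\<alpha> ^^ d) c = 0" and gS: "g \<in> Sx"
  shows "q * x ^ d * g = 0"
proof (cases "q = 0")
  case False
  have d: "d \<in> D" using degD[OF q(2) lt_monom[OF q(1)] False] .
  obtain u b where u: "u \<in> B d" "regular S u" "b \<in> B d" "u * q * x ^ d = b * lam d"
    using denom[OF d q(1,2)] by blast
  obtain v where v: "regular S v" "lam d = v * x ^ d" using lam_form d by blast
  obtain b' where b': "b' \<in> B d" "alm d b' = b" using alm(5)[OF d u(3)] by blast
  have S: "u \<in> S" "b \<in> S" "v \<in> S" "b' \<in> S" "c \<in> S"
    using u v b' B_S[OF d] regularD(3) g lt_S by auto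
  have l1: "lt d (b * v) (lam d * b')" using lam_lt[OF d v(2,1) b'(1)] b' by simp
  have l2: "lt d (v * (\<alpha> ^^ d) b') (lam d * b')"
  proof -
    have "lt (d + 0) (v * (\<alpha> ^^ d) b') (lam d * b')"
      unfolding v(2) using S by (intro lt_mult lt_monom lt_const)
    then show ?thesis by simp
  qed
  have bv: "b * v = v * (\<alpha> ^^ d) b'" using lt_unique l1 l2 by blast
  have "u * q = b * v"
  proof -
    have "lt d (u * q) (u * q * x ^ d)" "lt d (b * v) (b * v * x ^ d)"
      using S q by (auto intro!: lt_monom simp: S_closed)
    then show ?thesis using u(4) v lt_unique by (simp add: mult.assoc)
  qed
  then have "v * (\<alpha> ^^ d) b' * (\<alpha> ^^ d) c = u * (q * (\<alpha> ^^ d) c)" using bv by (simp add: mult.assoc[symmetric])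
  then have "v * (\<alpha> ^^ d) (b' * c) = 0" using q S alpha_pow(4) by (simp add: mult.assoc)
  moreover have b'c: "b' * c \<in> S" using S by (simp add: S_closed)
  ultimately have "(\<alpha> ^^ d) (b' * c) = 0" using regularD(2)[OF v(1) alpha_pow(1)] by blast
  then have "b' * c = 0" using alpha_pow_eq_zero[OF b'c] by blast
  then have b'g: "b' * g = 0" using good B_B0[OF d b'(1)] by blast
  define low where "low = lam d * b' - b * lam d"
  have lowP: "low \<in> P d" using lam_comm[OF d b'(1)] b' by (simp add: low_def)
  \<comment> \<open>The product is an element of \<open>S\<close> times \<open>x ^ d\<close> and at
    the same time of degree below \<open>d\<close>.\<close>
  have lowz: "low * z = 0" if z: "z \<in> Z" for z
  proof -
    have bz: "b' * z \<in> Z" using left_ideal_mult[OF Z_left S(4) z] .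
    have "low * z = v * (x ^ d * (b' * z)) - b * (v * (x ^ d * z))"
      by (simp add: low_def v algebra_simps)
    also have "\<dots> = (v * (\<alpha> ^^ d) (b' * z) - b * (v * (\<alpha> ^^ d) z)) * x ^ d"
      by (simp add: pow_Z[OF z] pow_Z[OF bz] algebra_simps)
    finally have eq: "low * z = (v * (\<alpha> ^^ d) (b' * z) - b * (v * (\<alpha> ^^ d) z)) * x ^ d" .
    have "v * (\<alpha> ^^ d) (b' * z) - b * (v * (\<alpha> ^^ d) z) \<in> S"
      using S alpha_pow(1)[OF Z_S[OF z]] alpha_pow(1)[OF Z_S[OF bz]] by (simp add: S_closed)
    moreover have "low * z \<in> P d" using P_S[OF lowP Z_S[OF z]] .
    ultimately show ?thesis using eq monom_in_P by (metis mult_zero_left)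
  qed
  have "low * g = 0" using g(1)
    by (induction rule: prod_span_induct) (auto simp: distrib_left mult.assoc[symmetric] lowz)
  then have "b * lam d * g = 0" using b'g by (simp add: low_def algebra_simps)
  then have "u * (q * x ^ d * g) = 0" using u(4) by (simp add: mult.assoc[symmetric])
  moreover have "q * x ^ d * g \<in> Sx" using q(2) ASx gS subring_mult[OF subring_Sx] by blast
  ultimately show ?thesis using regular_Sx[OF u(2)] by blast
qed simp

text \<open>Instead of a multiplier \<open>j\<close>, the equality of leading coefficients is
  exploited: \<open>t * f' = 0\<close> is shown to imply \<open>t * g' = 0\<close>, so a non-zero
  \<open>t * h\<close> with \<open>h = f' - g'\<close> forces \<open>t * f'\<close> to be
  non-zero.\<close>

theorem uniform_step_singular:
  assumes LR: "L \<subseteq> R" and LZ: "L \<subseteq> Z"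
    and unif: "\<And>m f g. m \<in> D \<Longrightarrow> f \<in> prod_span (B m) L \<Longrightarrow> f \<noteq> 0 \<Longrightarrow> g \<in> prod_span (B m) L \<Longrightarrow> g \<noteq> 0
      \<Longrightarrow> common_multiple (B m) f g"
    and f: "f \<in> prod_span A L" "f \<noteq> 0" and g: "g \<in> prod_span A L" "g \<noteq> 0"
  shows "common_multiple A f g"
proof (rule uniform_degree_induct[OF LR _ f g])
  fix m c f k d g
  assume f: "f \<in> prod_span A L" "lt m c f" "c \<noteq> 0" and g: "g \<in> prod_span A L" "lt k d g" "d \<noteq> 0"
    and km: "k \<le> m"
    and IH1: "\<And>h. h \<in> prod_span A L \<Longrightarrow> h \<noteq> 0 \<Longrightarrow> h \<in> P m \<Longrightarrow> common_multiple A h g"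
    and IH2: "\<And>h. h \<in> prod_span A L \<Longrightarrow> h \<noteq> 0 \<Longrightarrow> h \<in> P k \<Longrightarrow> common_multiple A f h"
  have B0A: "p \<in> A" "p \<in> S" if "p \<in> B 0" for p using that B_A[OF zero_D] B_S[OF zero_D] by auto
  \<comment> \<open>If a multiplier from \<open>B 0\<close> lowers one of the degrees without
    killing the element, induction finishes. Otherwise annihilating a leading coefficient by
    \<open>B 0\<close> annihilates the whole element.\<close>
  show "common_multiple A f g"
  proof (cases "(\<exists>p\<in>B 0. p * f \<noteq> 0 \<and> p * f \<in> P m) \<or> (\<exists>p\<in>B 0. p * g \<noteq> 0 \<and> p * g \<in> P k)")
    case True
    then show ?thesis
    proof
      assume "multiple_in (B 0) f (P m)"
      then obtain p where p: "p \<in> B 0" "p * f \<noteq> 0" "p * f \<in> P m" by blast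
      then obtain s t where "s \<in> A" "t \<in> A" "s * (p * f) = t * g" "s * (p * f) \<noteq> 0"
        using IH1 AL_closed(1)[OF LR] f B0A by metis
      then show ?thesis using p B0A A_closed(6) by (metis mult.assoc)
    next
      assume "multiple_in (B 0) g (P k)"
      then obtain p where p: "p \<in> B 0" "p * g \<noteq> 0" "p * g \<in> P k" by blast
      then obtain s t where "s \<in> A" "t \<in> A" "s * f = t * (p * g)" "s * f \<noteq> 0"
        using IH2 AL_closed(1)[OF LR] g B0A by metis
      then show ?thesis using p B0A A_closed(6) by (metis mult.assoc)
    qed
  next
    case False
    have goodf: "p * f = 0" if "p \<in> B 0" "p * c = 0" for p
      using lt_smult[OF _ f(2), of p] that B0A False lt_0_iff by auto
    have goodg: "p * g = 0" if "p \<in> B 0" "p * d = 0" for p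
      using lt_smult[OF _ g(2), of p] that B0A False lt_0_iff by auto
    have m: "m \<in> D" "k \<in> D" using degD AL_closed(3)[OF LR] f g by blast+
    then have mk: "m - k \<in> D" using D_diff km by blast
    obtain p q z where pq: "p \<in> B 0" "q \<in> B 0" "z \<in> prod_span (B m) L" "z \<noteq> 0"
      "p * f - lam m * z \<in> P m" "q * (lam (m - k) * g) - lam m * z \<in> P m"
      using uniform_common_lead[OF LR unif f g km] by blast
    obtain v where v: "regular S v" "lam m = v * x ^ m" using lam_form m by blast
    obtain w where w: "regular S w" "lam (m - k) = w * x ^ (m - k)" using lam_form mk by blast
    have zB: "z \<in> B m" using B_subset[OF m(1) LR pq(3)] .
    define a where "a = alm m z * v"
    have ltz: "lt m a (lam m * z)" using lam_lt[OF m(1) v(2,1) zB] by (simp add: a_def)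
    have "alm m z \<noteq> 0" using automorph_eq_zero[OF autB[OF m(1)] subB[OF m(1)] zB] pq by simp
    then have a0: "a \<noteq> 0" using regularD(1)[OF v(1) B_S[OF m(1) alm(1)[OF m(1) zB]]] by (auto simp: a_def)
    define f' g' where "f' = p * f" and "g' = q * (lam (m - k) * g)"
    have lt': "lt m a f'" "lt m a g'"
      using lt_cong[OF ltz] pq by (auto simp: f'_def g'_def)
    have f'0: "f' \<noteq> 0" using lt' a0 lt_zero by blast
    have pc: "p * c = a" using lt_unique lt'(1) lt_smult[OF _ f(2), of p] B0A pq by (auto simp: f'_def)
    have qd: "q * w * (\<alpha> ^^ (m - k)) d = a"
    proof -
      have "lt (m - k + k) (w * (\<alpha> ^^ (m - k)) d) (lam (m - k) * g)"
        unfolding w(2) by (intro lt_mult lt_monom regularD(3)[OF w(1)] g(2))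
      then have "lt m (q * (w * (\<alpha> ^^ (m - k)) d)) g'"
        unfolding g'_def using km pq B0A by (intro lt_smult) auto
      then show ?thesis using lt'(2) lt_unique by (auto simp: mult.assoc)
    qed
    have inAL: "f' \<in> prod_span A L" "g' \<in> prod_span A L"
      using pq f g B0A lam_A[OF mk] AL_closed(1)[OF LR] by (auto simp: f'_def g'_def)
    note Zx = AL_singular[OF LR LZ]
    have good_f': "p' * f' = 0" if "p' \<in> B 0" "p' * a = 0" for p'
      using goodf[of "p' * p"] that pc pq by (simp add: f'_def mult.assoc B0_closed)
    have good_g': "p' * g' = 0" if p': "p' \<in> B 0" "p' * a = 0" for p'
    proof -
      have "(p' * q * w) * x ^ (m - k) * g = 0"
      proof (rule monomial_annihilates[OF Zx[OF g(1)] g(2) goodg])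
        show "p' * q * w \<in> S" using p' pq B0A regularD(3)[OF w(1)] by (simp add: S_closed)
        have "p' * q * lam (m - k) \<in> A" using p' pq B0A lam_A[OF mk] by (simp add: A_closed)
        then show "p' * q * w * x ^ (m - k) \<in> A" by (simp add: w mult.assoc)
        show "p' * q * w * (\<alpha> ^^ (m - k)) d = 0" using p'(2) qd by (simp add: mult.assoc)
        show "g \<in> Sx" using AL_closed(4)[OF LR g(1)] .
      qed
      then show ?thesis by (simp add: g'_def w mult.assoc)
    qed
    have ann: "t * g' = 0" if t: "t \<in> A" "t * f' = 0" for t
    proof -
      obtain N e where e: "\<forall>i. e i \<in> S \<and> e i * x ^ i \<in> A" "t = (\<Sum>i\<le>N. e i * x ^ i)"
        using homog t by blast
      have "(\<Sum>i\<le>N. e i * x ^ i) * f' = 0 \<Longrightarrow> \<forall>i\<le>N. e i * (\<alpha> ^^ i) a = 0" for N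
      proof (induction N)
        case 0
        have "lt (0 + m) (e 0 * (\<alpha> ^^ 0) a) (e 0 * f')" using e lt' by (intro lt_mult lt_const) auto
        then have "e 0 * a = 0" using 0 lt_zero by auto
        then show ?case by simp
      next
        case (Suc N)
        have "lt (Suc N) (e (Suc N)) (\<Sum>i\<le>Suc N. e i * x ^ i)" using e by (intro lt_coeffs) auto
        then have "lt (Suc N + m) (e (Suc N) * (\<alpha> ^^ Suc N) a) ((\<Sum>i\<le>Suc N. e i * x ^ i) * f')"
          using lt' by (intro lt_mult)
        then have top: "e (Suc N) * (\<alpha> ^^ Suc N) a = 0" using Suc(2) lt_zero by metis
        have "e (Suc N) * x ^ Suc N * f' = 0"
          by (rule monomial_annihilates[OF Zx[OF inAL(1)] lt'(1) good_f' _ _ top])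
            (use e AL_closed(4)[OF LR inAL(1)] in \<open>auto simp del: power_Suc\<close>)
        then have "(\<Sum>i\<le>N. e i * x ^ i) * f' = 0" using Suc(2) by (simp add: distrib_right)
        then show ?case using Suc.IH top by (auto simp: le_Suc_eq)
      qed
      then have co: "e i * (\<alpha> ^^ i) a = 0" if "i \<le> N" for i using t e that by blast
      have "e i * x ^ i * g' = 0" if "i \<le> N" for i
        by (rule monomial_annihilates[OF Zx[OF inAL(2)] lt'(2) good_g' _ _ co[OF that]])
          (use e AL_closed(4)[OF LR inAL(2)] in auto)
      then show ?thesis by (simp add: e sum_distrib_right)
    qed
    define h where "h = f' - g'"
    have h: "h \<in> prod_span A L" using inAL AL_closed(2)[OF LR] by (simp add: h_def)
    have hP: "h \<in> P m" using lt_diff_P lt' by (auto simp: h_def)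
    have pA: "p \<in> A" "q \<in> A" using pq B0A by auto
    show ?thesis
    proof (cases "h = 0")
      case True
      then have "p * f = q * lam (m - k) * g" "p * f \<noteq> 0"
        using f'0 by (auto simp: h_def f'_def g'_def mult.assoc)
      then show ?thesis using pA lam_A[OF mk] A_closed(6) by metis
    next
      case False
      then obtain t s where ts: "t \<in> A" "s \<in> A" "t * h = s * g" "t * h \<noteq> 0" using IH1 h hP by blast
      have eq: "(t * p) * f = (t * q * lam (m - k) + s) * g"
      proof -
        have "(t * p) * f = t * h + t * g'" by (simp add: h_def f'_def algebra_simps)
        then show ?thesis using ts by (simp add: g'_def algebra_simps)
      qed
      have "(t * p) * f \<noteq> 0"
      proof
        assume "(t * p) * f = 0"
        then have z: "t * f' = 0" by (simp add: f'_def mult.assoc)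
        then have "t * g' = 0" using ann ts by blast
        then have "t * h = 0" using z by (simp add: h_def right_diff_distrib)
        then show False using ts by blast
      qed
      moreover have "t * p \<in> A" "t * q * lam (m - k) + s \<in> A"
        using ts pA lam_A[OF mk] by (auto simp: A_closed)
      ultimately show ?thesis using eq by blast
    qed
  qed
qed

end

section \<open>The tower of Ore extensions\<close>

lemma sorted_le_split:
  assumes "sorted ss" "set ss \<subseteq> {s. s \<le> (k::'v::linorder)}"
  shows "\<exists>us n. ss = us @ replicate n k \<and> sorted us \<and> set us \<subseteq> {s. s < k}"
  using assms
proof (induction ss rule: rev_induct)
  case Nil then show ?case by (intro exI[of _ "[]"] exI[of _ 0]) auto
next
  case (snoc a ss)
  show ?case
  proof (cases "a = k")
    case True
    from snoc obtain us n where "ss = us @ replicate n k" "sorted us" "set us \<subseteq> {s. s < k}"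
      by (auto simp: sorted_append)
    then show ?thesis using True
      by (intro exI[of _ us] exI[of _ "Suc n"]) (simp add: replicate_append_same)
  next
    case False
    then have "set (ss @ [a]) \<subseteq> {s. s < k}" using snoc by (fastforce simp: sorted_append)
    then show ?thesis using snoc by (intro exI[of _ "ss @ [a]"] exI[of _ 0]) auto
  qed
qed

lemma std_termsI: "sorted ss \<Longrightarrow> set ss \<subseteq> I \<Longrightarrow> prod_list (map x ss) \<in> std_terms x I"
  unfolding std_terms_def by (intro CollectI exI[of _ ss]) simp

lemma std_termsE:
  assumes "t \<in> std_terms x I"
  obtains ss where "t = prod_list (map x ss)" "sorted ss" "set ss \<subseteq> I"
  using assms unfolding std_terms_def by (elim CollectE exE conjE)

lemma std_terms_le:
  "std_terms x {s. s \<le> k} = {t * x k ^ n | t n. t \<in> std_terms x {s. s < k}}"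
proof (intro equalityI subsetI)
  fix t assume "t \<in> std_terms x {s. s \<le> k}"
  then obtain ss where ss: "t = prod_list (map x ss)" "sorted ss" "set ss \<subseteq> {s. s \<le> k}"
    by (auto simp: std_terms_def)
  then obtain us n where us: "ss = us @ replicate n k" "sorted us" "set us \<subseteq> {s. s < k}"
    using sorted_le_split by blast
  then have "t = prod_list (map x us) * x k ^ n" by (simp add: ss)
  then show "t \<in> {t * x k ^ n | t n. t \<in> std_terms x {s. s < k}}"
    using us unfolding std_terms_def by blast
next
  fix t assume "t \<in> {t * x k ^ n | t n. t \<in> std_terms x {s. s < k}}"
  then obtain us n where us: "t = prod_list (map x us) * x k ^ n" "sorted us" "set us \<subseteq> {s. s < k}"
    by (auto simp: std_terms_def)
  then have "t = prod_list (map x (us @ replicate n k))" by simp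
  moreover have "sorted (us @ replicate n k)" "set (us @ replicate n k) \<subseteq> {s. s \<le> k}"
    using us by (auto simp: sorted_append less_imp_le)
  ultimately show "t \<in> std_terms x {s. s \<le> k}" unfolding std_terms_def by blast
qed

text \<open>\<open>C\<close> is kept arbitrary because the identity serves both for \<open>R\<close>
  and for \<open>sing_ideal R\<close>. It rests on splitting a sorted list at its trailing block of
  \<open>k\<close>.\<close>

lemma prod_span_std_terms_le:
  "prod_span C (std_terms x {s. s \<le> k}) =
   prod_span (prod_span C (std_terms x {s. s < k})) (range (\<lambda>n. x k ^ n))"
proof (intro equalityI subsetI)
  fix y assume "y \<in> prod_span C (std_terms x {s. s \<le> k})"
  then show "y \<in> prod_span (prod_span C (std_terms x {s. s < k})) (range (\<lambda>n. x k ^ n))"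
  proof (induction rule: prod_span_induct)
    case (Cons a l y)
    then obtain t n where t: "l = t * x k ^ n" "t \<in> std_terms x {s. s < k}" by (auto simp: std_terms_le)
    then have "(a * t) * x k ^ n + y \<in> prod_span (prod_span C (std_terms x {s. s < k})) (range (\<lambda>n. x k ^ n))"
      using Cons by (intro prod_span_Cons prod_span_mem) auto
    then show ?case using t by (simp add: mult.assoc)
  qed (rule prod_span_zero)
next
  fix y assume "y \<in> prod_span (prod_span C (std_terms x {s. s < k})) (range (\<lambda>n. x k ^ n))"
  then show "y \<in> prod_span C (std_terms x {s. s \<le> k})"
  proof (induction rule: prod_span_induct)
    case (Cons a l y)
    then obtain n where l: "l = x k ^ n" by blast
    have "a * x k ^ n \<in> prod_span C (std_terms x {s. s \<le> k})" using Cons(1)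
    proof (induction rule: prod_span_induct)
      case (Cons c t y)
      then have "c * (t * x k ^ n) + y * x k ^ n \<in> prod_span C (std_terms x {s. s \<le> k})"
        by (intro prod_span_Cons) (auto simp: std_terms_le)
      then show ?case by (simp add: distrib_right mult.assoc)
    qed (simp add: prod_span_zero)
    then show ?case unfolding l using Cons(4) by (rule prod_span_add)
  qed (rule prod_span_zero)
qed

lemma std_terms_mono:
  assumes "I \<subseteq> J"
  shows "std_terms x I \<subseteq> std_terms x J"
proof
  fix t assume "t \<in> std_terms x I"
  then obtain ss where ss: "t = prod_list (map x ss)" "sorted ss" "set ss \<subseteq> I" by (rule std_termsE)
  show "t \<in> std_terms x J" unfolding ss(1) by (rule std_termsI) (use ss assms in auto)
qed

lemma prod_span_std_terms_mono:
  "y \<in> prod_span C (std_terms x I) \<Longrightarrow> I \<subseteq> J \<Longrightarrow> y \<in> prod_span C (std_terms x J)"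
  by (rule prod_span_mono[OF _ subset_refl std_terms_mono])

lemma prod_span_std_terms_finite:
  assumes "y \<in> prod_span C (std_terms x I)"
  shows "\<exists>J. finite J \<and> J \<subseteq> I \<and> y \<in> prod_span C (std_terms x J)"
  using assms
proof (induction rule: prod_span_induct)
  case zero then show ?case using prod_span_zero by blast
next
  case (Cons c t y)
  then obtain J where J: "finite J" "J \<subseteq> I" "y \<in> prod_span C (std_terms x J)" by blast
  obtain ss where ss: "t = prod_list (map x ss)" "sorted ss" "set ss \<subseteq> I"
    using Cons(2) by (rule std_termsE)
  have "y \<in> prod_span C (std_terms x (J \<union> set ss))"
    by (rule prod_span_std_terms_mono[OF J(3)]) auto
  moreover have "t \<in> std_terms x (J \<union> set ss)" unfolding ss by (rule std_termsI) (use ss in auto)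
  ultimately have "c * t + y \<in> prod_span C (std_terms x (J \<union> set ss))"
    using Cons by (intro prod_span_Cons)
  then show ?case using J ss by (intro exI[of _ "J \<union> set ss"]) auto
qed

lemma essential_finite_lann:
  assumes "subring R" "finite F" "\<And>z. z \<in> F \<Longrightarrow> essential_li R (lann R z)"
  shows "essential_li R {r \<in> R. \<forall>z\<in>F. r * z = 0}"
  using assms(2,3)
proof (induction F rule: finite_induct)
  case empty
  then show ?case using left_ideal_self[OF assms(1)] subring_one[OF assms(1)]
    by (auto simp: essential_li_iff[OF assms(1)] intro!: bexI[of _ 1])
next
  case (insert z F)
  have "{r \<in> R. \<forall>z\<in>insert z F. r * z = 0} = lann R z \<inter> {r \<in> R. \<forall>z\<in>F. r * z = 0}"
    by (auto simp: lann_def)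
  then show ?case using insert essential_li_Int[OF assms(1)] by simp
qed

section \<open>Independence of left ideals under an Ore extension\<close>

lemma (in ore) prod_span_P_split:
  assumes "L \<subseteq> S" "y \<in> prod_span (P (Suc e)) L"
  shows "\<exists>s\<in>prod_span S L. y - x ^ e * s \<in> prod_span (P e) L"
  using assms(2)
proof (induction rule: prod_span_induct)
  case zero then show ?case by (intro bexI[of _ 0]) (auto simp: prod_span_zero)
next
  case (Cons a l y)
  then obtain s where s: "s \<in> prod_span S L" "y - x ^ e * s \<in> prod_span (P e) L" by blast
  obtain c where c: "lt e c a" using Cons P_Suc by blast
  then obtain s' where s': "s' \<in> S" "c * x ^ e - x ^ e * s' \<in> P e" using swap_pow lt_S by blast
  have "(a - c * x ^ e) + (c * x ^ e - x ^ e * s') \<in> P e" using c s' by (intro P_add) (auto simp: lt_def)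
  then have "(a - x ^ e * s') * l + (y - x ^ e * s) \<in> prod_span (P e) L"
    using Cons s by (intro prod_span_Cons) auto
  then have "a * l + y - x ^ e * (s' * l + s) \<in> prod_span (P e) L" by (simp add: algebra_simps)
  moreover have "s' * l + s \<in> prod_span S L" using s s' Cons by (intro prod_span_Cons)
  ultimately show ?case by blast
qed

lemma (in ore) prod_span_P_in_P: "L \<subseteq> S \<Longrightarrow> y \<in> prod_span (P e) L \<Longrightarrow> y \<in> P e"
  by (rule prod_span_induct[of y "P e" L]) (auto simp: P_zero intro!: P_add P_S)

lemma (in ore) prod_span_Sx_P: 
  assumes "y \<in> prod_span Sx L" shows "\<exists>e. y \<in> prod_span (P e) L"
  using assms
proof (induction rule: prod_span_induct)
  case zero then show ?case using prod_span_zero by blast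
next
  case (Cons a l y)
  then obtain e n where e: "y \<in> prod_span (P e) L" "a \<in> P n" by (auto simp: Sx_def)
  have "y \<in> prod_span (P (e + n)) L" by (rule prod_span_mono[OF e(1)]) (auto intro: P_mono[of _ e])
  then have "a * l + y \<in> prod_span (P (e + n)) L" using Cons e P_mono[of a n "e + n"]
    by (intro prod_span_Cons) auto
  then show ?case by blast
qed

text \<open>Meant for finite \<open>F\<close>, since \<open>sum\<close> over an infinite set is
  \<open>0\<close>.\<close>

definition independent_li :: "'i set \<Rightarrow> ('i \<Rightarrow> 'a::ring_1 set) \<Rightarrow> bool" where
  "independent_li F Ls \<longleftrightarrow> (\<forall>c. (\<forall>i\<in>F. c i \<in> Ls i) \<and> sum c F = 0 \<longrightarrow> (\<forall>i\<in>F. c i = 0))"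

lemma independent_liD:
  "independent_li F Ls \<Longrightarrow> (\<And>i. i \<in> F \<Longrightarrow> c i \<in> Ls i) \<Longrightarrow> sum c F = 0 \<Longrightarrow> i \<in> F \<Longrightarrow> c i = 0"
  by (simp add: independent_li_def)

text \<open>With coefficients on the right, the top parts are \<open>x ^ e * s i\<close> with
  \<open>s i\<close> in the span of \<open>L i\<close> over \<open>S\<close>. The top coefficient of
  the vanishing sum is the image of \<open>sum s F\<close> under a power of \<alpha>, so
  \<open>sum s F = 0\<close>, and independence over \<open>S\<close> removes the top parts.\<close>

lemma (in ore) independent_Sx:
  assumes F: "finite F" and LS: "\<And>i. i \<in> F \<Longrightarrow> L i \<subseteq> S"
    and ind: "independent_li F (\<lambda>i. prod_span S (L i))"
  shows "independent_li F (\<lambda>i. prod_span Sx (L i))"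
proof -
  have main: "(\<forall>i\<in>F. c i \<in> prod_span (P e) (L i)) \<Longrightarrow> sum c F = 0 \<Longrightarrow> \<forall>i\<in>F. c i = 0" for e c
  proof (induction e arbitrary: c)
    case 0
    have "c i = 0" if "i \<in> F" for i
      using prod_span_P_in_P[OF LS[OF that], of "c i" 0] 0 that by (simp add: P_0)
    then show ?case by blast
  next
    case (Suc e)
    have "\<forall>i\<in>F. \<exists>s. s \<in> prod_span S (L i) \<and> c i - x ^ e * s \<in> prod_span (P e) (L i)"
      using prod_span_P_split[OF LS] Suc(2) by blast
    then obtain s where s: "\<forall>i\<in>F. s i \<in> prod_span S (L i) \<and> c i - x ^ e * s i \<in> prod_span (P e) (L i)"
      by metis
    have sS: "s i \<in> S" if "i \<in> F" for i using prod_span_subset[OF subS LS[OF that]] s that by blast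
    then have sumS: "sum s F \<in> S" by (intro subring_sum[OF subS])
    have "(\<Sum>i\<in>F. c i - x ^ e * s i) \<in> P e" using s prod_span_P_in_P[OF LS] by (intro P_sum) blast
    moreover have "(\<Sum>i\<in>F. c i - x ^ e * s i) = - (x ^ e * sum s F)"
      using Suc(3) by (simp add: sum_subtractf sum_distrib_left)
    ultimately have "x ^ e * sum s F \<in> P e" using P_uminus by force
    then have "(\<alpha> ^^ e) (sum s F) = 0" using lt_in_P lt_pow_S[OF sumS] by blast
    then have "sum s F = 0" using alpha_pow_eq_zero[OF sumS] by blast
    then have "\<forall>i\<in>F. s i = 0" using ind s unfolding independent_li_def by blast
    then show ?case using Suc s by simp
  qed
  show ?thesis unfolding independent_li_def
  proof (intro allI impI)
    fix c assume c: "(\<forall>i\<in>F. c i \<in> prod_span Sx (L i)) \<and> sum c F = 0"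
    then have "\<forall>i\<in>F. \<exists>e. c i \<in> prod_span (P e) (L i)" using prod_span_Sx_P by blast
    then obtain e where e: "\<forall>i\<in>F. c i \<in> prod_span (P (e i)) (L i)" by metis
    have "c i \<in> prod_span (P (Max (e ` F))) (L i)" if "i \<in> F" for i
    proof (rule prod_span_mono)
      show "c i \<in> prod_span (P (e i)) (L i)" using e that by blast
      have "e i \<le> Max (e ` F)" using that F by simp
      then show "P (e i) \<subseteq> P (Max (e ` F))" using P_mono by blast
      show "L i \<subseteq> L i" by (rule subset_refl)
    qed
    then show "\<forall>i\<in>F. c i = 0" using c main[of c "Max (e ` F)"] by simp
  qed
qed

text \<open>Ordinals up to \<Omega> are initial segments of the index type:
  \<open>{s. s < k}\<close> is the stage of \<open>k\<close> and \<open>{s. s \<le> k}\<close> its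
  successor. By \<open>S_top\<close> the whole type is the top ring, so unbounded quantifiers over
  elements range over that ring.\<close>

locale skew =
  fixes R :: "'a::ring_1 set" and x :: "'v::wellorder \<Rightarrow> 'a" and \<Omega> :: "'v set"
    and \<alpha> \<delta> :: "'v \<Rightarrow> 'a \<Rightarrow> 'a"
  assumes Omega: "down_closed \<Omega>"
    and S_top: "Sk R x \<Omega> = UNIV"
    and S_sub: "\<And>I. down_closed I \<Longrightarrow> I \<subseteq> \<Omega> \<Longrightarrow> subring (Sk R x I)"
    and S_ore: "\<And>k. k \<in> \<Omega> \<Longrightarrow> ore_ext (Sk R x {s. s < k}) (x k) (Sk R x {s. s \<le> k}) (\<alpha> k) (\<delta> k)"
    and delta_zero: "\<And>k p. k \<in> \<Omega> \<Longrightarrow> p \<in> ZT R x {s. s < k} \<Longrightarrow> \<delta> k p = 0"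
    and subR: "subring R"
begin

abbreviation "SS \<equiv> Sk R x"
abbreviation "ZZ \<equiv> ZT R x"

lemmas R_closed = subring_closed[OF subR]

lemma SS_eq: "SS I = prod_span R (std_terms x I)"
  unfolding Sk_def by (rule lin_comb_eq_prod_span) (auto simp: R_closed)

lemma ZZ_eq: "ZZ I = prod_span (sing_ideal R) (std_terms x I)"
  unfolding ZT_def using left_ideal_zero[OF left_ideal_sing_ideal[OF subR]]
    left_ideal_add[OF left_ideal_sing_ideal[OF subR]] by (rule lin_comb_eq_prod_span)

lemma std_terms_empty: "std_terms x {} = {1}"
  by (auto simp: std_terms_def)

lemma prod_span_one: 
  assumes "0 \<in> C" "\<And>a b. a \<in> C \<Longrightarrow> b \<in> C \<Longrightarrow> a + b \<in> C"
  shows "prod_span C {1} = C"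
proof (intro equalityI subsetI)
  fix y assume "y \<in> prod_span C {1}"
  then show "y \<in> C" by (induction rule: prod_span_induct) (auto simp: assms)
next
  fix y assume "y \<in> C"
  then show "y \<in> prod_span C {1}" using prod_span_mem[of y C 1 "{1}"] by simp
qed

lemma SS_empty: "SS {} = R"
  unfolding SS_eq std_terms_empty by (rule prod_span_one) (auto simp: R_closed)

lemma ZZ_empty: "ZZ {} = sing_ideal R"
  unfolding ZZ_eq std_terms_empty using left_ideal_zero[OF left_ideal_sing_ideal[OF subR]]
    left_ideal_add[OF left_ideal_sing_ideal[OF subR]] by (rule prod_span_one)

lemma SS_mono: "I \<subseteq> J \<Longrightarrow> SS I \<subseteq> SS J"
  using prod_span_std_terms_mono by (auto simp: SS_eq)

lemma ZZ_mono: "I \<subseteq> J \<Longrightarrow> ZZ I \<subseteq> ZZ J"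
  using prod_span_std_terms_mono by (auto simp: ZZ_eq)

lemma ZZ_SS: "ZZ I \<subseteq> SS I"
proof
  fix y assume "y \<in> ZZ I"
  moreover have "sing_ideal R \<subseteq> R" by (auto simp: sing_ideal_def)
  ultimately show "y \<in> SS I" unfolding SS_eq ZZ_eq by (rule prod_span_mono) simp
qed

lemma R_SS: "r \<in> R \<Longrightarrow> r \<in> SS I"
  using SS_mono[of "{}" I] SS_empty by auto

lemma dc: "down_closed {s. s < k}" "down_closed {s. s \<le> k}" "down_closed {}"
  by (auto simp: down_closed_def)

lemma dc_sub: "k \<in> \<Omega> \<Longrightarrow> {s. s < k} \<subseteq> \<Omega>" "k \<in> \<Omega> \<Longrightarrow> {s. s \<le> k} \<subseteq> \<Omega>"
  using Omega unfolding down_closed_def by (blast intro: less_imp_le)+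

text \<open>Finitely many elements involve finitely many variables, and the largest index bounds
  them all.\<close>

lemma SS_finite:
  assumes "I \<noteq> {}" "finite E" "E \<subseteq> SS I"
  shows "\<exists>k\<in>I. E \<subseteq> SS {s. s \<le> k}"
  using assms(2,3)
proof (induction E rule: finite_induct)
  case empty then show ?case using assms(1) by auto
next
  case (insert y E)
  then obtain k where k: "k \<in> I" "E \<subseteq> SS {s. s \<le> k}" by auto
  obtain J where J: "finite J" "J \<subseteq> I" "y \<in> SS J"
    using prod_span_std_terms_finite[of y R x I] insert by (auto simp: SS_eq)
  define m where "m = Max (insert k J)"
  have "m \<in> I" using J k Max_in[of "insert k J"] by (auto simp: m_def)
  moreover have "k \<le> m" using J by (simp add: m_def)
  then have "{s. s \<le> k} \<subseteq> {s. s \<le> m}" by auto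
  moreover have "J \<subseteq> {s. s \<le> m}" using J by (simp add: m_def subset_iff)
  ultimately show ?case using SS_mono[of J "{s. s \<le> m}"] SS_mono[of "{s. s \<le> k}" "{s. s \<le> m}"] J k
    by (intro bexI[of _ m]) auto
qed

lemma ZZ_finite:
  assumes "I \<noteq> {}" "y \<in> ZZ I"
  shows "\<exists>k\<in>I. y \<in> ZZ {s. s \<le> k}"
proof -
  obtain k where k: "k \<in> I" using assms by blast
  obtain J where J: "finite J" "J \<subseteq> I" "y \<in> ZZ J"
    using prod_span_std_terms_finite[of y "sing_ideal R" x I] assms by (auto simp: ZZ_eq)
  define m where "m = Max (insert k J)"
  have "m \<in> I" using J k Max_in[of "insert k J"] by (auto simp: m_def)
  moreover have "J \<subseteq> {s. s \<le> m}" using J by (simp add: m_def subset_iff)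
  ultimately show ?thesis using ZZ_mono[of J "{s. s \<le> m}"] J by auto
qed

text \<open>\<open>lim\<close> covers every non-empty segment, with or without a largest element: a
  property that concerns finitely many elements at a time passes from all
  \<open>{s. s \<le> k}\<close> with \<open>k \<in> I\<close> to \<open>I\<close>.\<close>

lemma dc_induct [consumes 2, case_names base step lim]:
  assumes "down_closed I" "I \<subseteq> \<Omega>" and base: "Q {}"
    and step: "\<And>k. k \<in> \<Omega> \<Longrightarrow> Q {s. s < k} \<Longrightarrow> Q {s. s \<le> k}"
    and lim: "\<And>I. down_closed I \<Longrightarrow> I \<subseteq> \<Omega> \<Longrightarrow> I \<noteq> {} \<Longrightarrow> (\<And>k. k \<in> I \<Longrightarrow> Q {s. s \<le> k}) \<Longrightarrow> Q I"
  shows "Q I"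
proof -
  have k: "k \<in> \<Omega> \<Longrightarrow> Q {s. s \<le> k}" for k
  proof (induction k rule: less_induct)
    case (less k)
    have "Q {s. s < k}"
    proof (cases "{s. s < k} = {}")
      case True then show ?thesis using base by simp
    next
      case False
      show ?thesis
      proof (rule lim[OF dc(1) dc_sub(1)[OF less(2)] False])
        fix j assume "j \<in> {s. s < k}"
        then have "j < k" "j \<in> \<Omega>" using dc_sub(1)[OF less(2)] by auto
        then show "Q {s. s \<le> j}" by (rule less.IH)
      qed
    qed
    then show ?case by (rule step[OF less(2)])
  qed
  show ?thesis
  proof (cases "I = {}")
    case False
    show ?thesis
    proof (rule lim[OF assms(1,2) False])
      fix j assume "j \<in> I"
      then have "j \<in> \<Omega>" using assms(2) by blast
      then show "Q {s. s \<le> j}" by (rule k)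
    qed
  qed (use base in simp)
qed

lemma ore_k: "k \<in> \<Omega> \<Longrightarrow> ore (SS {s. s < k}) (x k) (\<alpha> k) (\<delta> k)"
  using S_ore[of k] S_sub[OF dc(1) dc_sub(1)]
  by unfold_locales (auto simp: ore_ext_def)

lemma SS_le: "k \<in> \<Omega> \<Longrightarrow> SS {s. s \<le> k} = ore.Sx (SS {s. s < k}) (x k)"
  using S_ore[of k] ore.lin_comb_eq_Sx[OF ore_k] by (simp add: ore_ext_def)

text \<open>The implication climbs the tower: at each new variable it is
  \<open>annihilator_lt\<close> for the constant \<open>a\<close>, which has degree 0 there. Indices
  in \<open>I\<close> are covered by the hypothesis, and every other index has all of
  \<open>I\<close> below it.\<close>

lemma nonsingular_extend:
  assumes I: "down_closed I" "I \<subseteq> \<Omega>" and j: "j \<in> SS I" and a: "a \<in> SS I"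
    and ja: "\<And>s. s \<in> SS I \<Longrightarrow> s * j * a = 0 \<Longrightarrow> s * j = 0" and s: "s * j * a = 0"
  shows "s * j = 0"
proof -
  have le: "l \<in> \<Omega> \<Longrightarrow> s \<in> SS {s. s \<le> l} \<Longrightarrow> s * j * a = 0 \<Longrightarrow> s * j = 0" for l s
  proof (induction l arbitrary: s rule: less_induct)
    case (less l)
    show ?case
    proof (cases "l \<in> I")
      case True
      then have "{s. s \<le> l} \<subseteq> I" using I by (auto simp: down_closed_def)
      then show ?thesis using SS_mono ja less by blast
    next
      case False
      then have Il: "I \<subseteq> {s. s < l}" using I(1) by (auto simp: down_closed_def) (metis not_less)
      interpret ore "SS {s. s < l}" "x l" "\<alpha> l" "\<delta> l" using ore_k less by blast
      have jl: "j \<in> SS {s. s < l}" "a \<in> SS {s. s < l}" using SS_mono[OF Il] j a by auto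
      show ?thesis
      proof (rule annihilator_lt[OF jl(1) lt_const[OF jl(2)]])
        fix b assume b: "b \<in> SS {s. s < l}" "b * j * a = 0"
        show "b * j = 0"
        proof (cases "{s. s < l} = {}")
          case True
          then have "b \<in> R" using b SS_empty by simp
          then show ?thesis using ja b R_SS by blast
        next
          case False
          then obtain k where "k < l" "b \<in> SS {s. s \<le> k}"
            using SS_finite[OF False, of "{b}"] b by auto
          then show ?thesis using less.IH b dc_sub(1)[OF less.prems(1)] by blast
        qed
      next
        show "s \<in> Sx" using less SS_le by blast
        show "s * j * a = 0" by fact
      qed
    qed
  qed
  show ?thesis
  proof (cases "\<Omega> = {}")
    case True
    then show ?thesis using S_top I ja s by auto
  next
    case False
    then obtain k where "k \<in> \<Omega>" "s \<in> SS {s. s \<le> k}"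
      using SS_finite[OF False, of "{s}"] S_top by auto
    then show ?thesis using le s by blast
  qed
qed

text \<open>\<open>z\<close> may lie outside \<open>R\<close>, but its annihilator in
  \<open>R\<close> contains the intersection of those of its finitely many coefficients.\<close>

lemma essential_lann_ZZ: "z \<in> ZZ I \<Longrightarrow> essential_li R (lann R z)"
  unfolding ZZ_eq
proof (induction rule: prod_span_induct)
  case zero
  then show ?case using left_ideal_zero[OF left_ideal_sing_ideal[OF subR]] by (simp add: sing_ideal_def)
next
  case (Cons a l y)
  have "essential_li R (lann R a \<inter> lann R y)"
    using Cons by (intro essential_li_Int subR) (auto simp: sing_ideal_def)
  moreover have "lann R a \<inter> lann R y \<subseteq> lann R (a * l + y)"
    by (auto simp: lann_def distrib_left mult.assoc[symmetric])
  ultimately show ?case using essential_li_mono[OF subR _ left_ideal_lann[OF subR]] by blast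
qed

text \<open>One \<open>j\<close> in \<open>R\<close> serves for all \<open>s\<close> of the top
  ring, hence for every subring. At a successor it comes from the highest coefficient outside Z(R)T;
  the coefficients above that one are killed by an essential left ideal of \<open>R\<close>, which
  contains a non-zero multiple \<open>r * j\<close>. This multiple inherits the property of
  \<open>j\<close> and reduces \<open>f\<close> to its part \<open>g\<close> of degree at most
  \<open>n\<close>.\<close>

theorem nonsingular_witness:
  assumes "down_closed I" "I \<subseteq> \<Omega>" "a \<in> SS I" "a \<notin> ZZ I"
  shows "\<exists>j\<in>R. j \<noteq> 0 \<and> (\<forall>s. s * j * a = 0 \<longrightarrow> s * j = 0)"
proof -
  have "\<forall>a\<in>SS I - ZZ I. \<exists>j\<in>R. j \<noteq> 0 \<and> (\<forall>s. s * j * a = 0 \<longrightarrow> s * j = 0)"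
    using assms(1,2)
  proof (induction rule: dc_induct)
    case base
    show ?case
    proof
      fix a assume "a \<in> SS {} - ZZ {}"
      then have a: "a \<in> R" "a \<notin> sing_ideal R" by (auto simp: SS_empty ZZ_empty)
      then obtain j where j: "j \<in> R" "j \<noteq> 0" "\<forall>q\<in>R. q * j * a = 0 \<longrightarrow> q * j = 0"
        using sing_ideal_iff[OF subR, of a] by blast
      have "s * j = 0" if "s * j * a = 0" for s
        using nonsingular_extend[OF dc(3) _ _ _ _ that] a j by (auto simp: SS_empty)
      then show "\<exists>j\<in>R. j \<noteq> 0 \<and> (\<forall>s. s * j * a = 0 \<longrightarrow> s * j = 0)" using j by blast
    qed
  next
    case (lim I)
    show ?case
    proof
      fix a assume a: "a \<in> SS I - ZZ I"
      then obtain k where k: "k \<in> I" "a \<in> SS {s. s \<le> k}" using SS_finite[OF lim(3), of "{a}"] by auto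
      have "{s. s \<le> k} \<subseteq> I" using k lim(1) by (auto simp: down_closed_def)
      then have "a \<notin> ZZ {s. s \<le> k}" using a ZZ_mono by blast
      then show "\<exists>j\<in>R. j \<noteq> 0 \<and> (\<forall>s. s * j * a = 0 \<longrightarrow> s * j = 0)" using lim(4) k by blast
    qed
  next
    case (step k)
    interpret ore "SS {s. s < k}" "x k" "\<alpha> k" "\<delta> k" using ore_k step by blast
    show ?case
    proof
      fix f assume f: "f \<in> SS {s. s \<le> k} - ZZ {s. s \<le> k}"
      then obtain N c where c: "\<forall>m. c m \<in> SS {s. s < k}" "f = (\<Sum>m\<le>N. c m * x k ^ m)"
        using Sx_coeffs SS_le step by blast
      define M where "M = {i. i \<le> N \<and> c i \<notin> ZZ {s. s < k}}"
      have "M \<noteq> {}"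
      proof
        assume "M = {}"
        then have "f \<in> prod_span (ZZ {s. s < k}) (range (\<lambda>n. x k ^ n))"
          unfolding c by (intro prod_span_sum prod_span_mem) (auto simp: M_def)
        then show False using f by (auto simp: ZZ_eq prod_span_std_terms_le)
      qed
      moreover have "finite M" by (auto simp: M_def)
      ultimately have "Max M \<in> M" by (rule Max_in[rotated])
      define n where "n = Max M"
      have n: "n \<le> N" "c n \<notin> ZZ {s. s < k}" using \<open>Max M \<in> M\<close> by (auto simp: n_def M_def)
      have above: "c i \<in> ZZ {s. s < k}" if "n < i" "i \<le> N" for i
      proof (rule ccontr)
        assume "c i \<notin> ZZ {s. s < k}"
        then have "i \<in> M" using that by (simp add: M_def)
        then show False using Max_ge[OF \<open>finite M\<close>] that by (simp add: n_def leD)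
      qed
      obtain j where j: "j \<in> R" "j \<noteq> 0" "\<forall>s. s * j * c n = 0 \<longrightarrow> s * j = 0"
        using step(2) c n by blast
      have "essential_li R {r \<in> R. \<forall>z\<in>c ` {n<..N}. r * z = 0}"
        by (intro essential_finite_lann subR) (auto intro!: essential_lann_ZZ[OF above])
      moreover have "j \<in> R - {0}" using j by blast
      ultimately obtain r where r: "r \<in> R" "r * j \<noteq> 0" "r * j \<in> {r \<in> R. \<forall>z\<in>c ` {n<..N}. r * z = 0}"
        unfolding essential_li_iff[OF subR] by meson
      define g where "g = (\<Sum>m\<le>n. c m * x k ^ m)"
      have "f = g + (\<Sum>m\<in>{n<..N}. c m * x k ^ m)"
      proof -
        have "{..N} = {..n} \<union> {n<..N}" "{..n} \<inter> {n<..N} = {}" using n by auto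
        then show ?thesis unfolding c g_def by (simp add: sum.union_disjoint)
      qed
      moreover have "r * j * (\<Sum>m\<in>{n<..N}. c m * x k ^ m) = 0"
        using r(3) by (simp add: sum_distrib_left mult.assoc[symmetric])
      ultimately have jf: "r * j * f = r * j * g" by (simp add: distrib_left)
      have rjR: "r * j \<in> R" using r j by (simp add: R_closed)
      have main: "s * (r * j) = 0" if s: "s \<in> SS {s. s \<le> k}" "s * (r * j) * f = 0" for s
      proof (rule annihilator_lt[OF R_SS[OF rjR] _ _ _ ])
        show "lt n (c n) g" unfolding g_def using c by (intro lt_coeffs) auto
        show "b * (r * j) = 0" if "b * (r * j) * c n = 0" for b
          using j(3)[rule_format, of "b * r"] that by (simp add: mult.assoc)
        show "s \<in> Sx" using s SS_le step by blast
        show "s * (r * j) * g = 0" using s(2) jf by (simp add: mult.assoc)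
      qed
      have "s * (r * j) = 0" if "s * (r * j) * f = 0" for s
        using nonsingular_extend[OF dc(2) dc_sub(2)[OF step(1)] R_SS[OF rjR] _ main that] f by blast
      then show "\<exists>j\<in>R. j \<noteq> 0 \<and> (\<forall>s. s * j * f = 0 \<longrightarrow> s * j = 0)" using rjR r by blast
    qed
  qed
  then show ?thesis using assms by blast
qed

text \<open>For a subring \<open>A\<close> the multiple lies in \<open>A\<close> anyway, so this
  expresses essentiality of \<open>A \<inter> prod_span A L\<close>, also when \<open>A\<close> does
  not contain \<open>L\<close>.\<close>

definition ess_ok :: "'a set \<Rightarrow> bool" where
  "ess_ok A \<longleftrightarrow> (\<forall>L. essential_li R L \<longrightarrow> (\<forall>f\<in>A - {0}. multiple_in A f (prod_span A L)))"

theorem sing_ideal_eq: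
  assumes I: "down_closed I" "I \<subseteq> \<Omega>" and A: "subring A" "A \<subseteq> SS I" and ess: "ess_ok A"
    and mult: "\<And>j. j \<in> R \<Longrightarrow> j \<noteq> 0 \<Longrightarrow> \<exists>a\<in>A. a * j \<in> A \<and> a * j \<noteq> 0"
  shows "sing_ideal A = A \<inter> ZZ I"
proof (intro equalityI subsetI)
  fix f assume f: "f \<in> sing_ideal A"
  then have fA: "f \<in> A" by (simp add: sing_ideal_def)
  have "f \<in> ZZ I"
  proof (rule ccontr)
    assume "f \<notin> ZZ I"
    then obtain j where j: "j \<in> R" "j \<noteq> 0" "\<forall>s. s * j * f = 0 \<longrightarrow> s * j = 0"
      using nonsingular_witness[OF I] fA A by blast
    \<comment> \<open>\<open>j\<close> may lie outside \<open>A\<close>, so its multiple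
      \<open>a * j\<close> is the test element for singularity.\<close>
    obtain a where a: "a \<in> A" "a * j \<in> A" "a * j \<noteq> 0" using mult j by blast
    then obtain q where q: "q \<in> A" "q * (a * j) \<noteq> 0" "q * (a * j) * f = 0"
      using f sing_ideal_iff[OF A(1), of f] by blast
    then show False using j(3)[rule_format, of "q * a"] by (simp add: mult.assoc)
  qed
  then show "f \<in> A \<inter> ZZ I" using fA by blast
next
  fix f assume f: "f \<in> A \<inter> ZZ I"
  then have K: "essential_li R (lann R f)" using essential_lann_ZZ by blast
  have "\<exists>q\<in>A. q * p \<noteq> 0 \<and> q * p * f = 0" if p: "p \<in> A - {0}" for p
  proof -
    obtain q where q: "q \<in> A" "q * p \<noteq> 0" "q * p \<in> prod_span A (lann R f)"
      using ess K p unfolding ess_ok_def by blast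
    have "q * p * f = 0" using q(3)
      by (induction rule: prod_span_induct) (auto simp: distrib_right mult.assoc lann_def)
    then show ?thesis using q by blast
  qed
  then show "f \<in> sing_ideal A" using f sing_ideal_iff[OF A(1), of f] by blast
qed

lemma sing_ideal_SS:
  assumes I: "down_closed I" "I \<subseteq> \<Omega>" and ess: "ess_ok (SS I)"
  shows "sing_ideal (SS I) = ZZ I"
proof -
  have "sing_ideal (SS I) = SS I \<inter> ZZ I"
  proof (rule sing_ideal_eq[OF I S_sub[OF I] subset_refl ess])
    fix j assume "j \<in> R" "j \<noteq> 0"
    then show "\<exists>a\<in>SS I. a * j \<in> SS I \<and> a * j \<noteq> 0"
      using R_SS subring_one[OF S_sub[OF I]] by (intro bexI[of _ 1]) auto
  qed
  then show ?thesis using ZZ_SS by blast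
qed

text \<open>Both properties are inherited from the singular ideal of the stage; the description by
  left coefficients does not show them.\<close>

lemma ZZ_structure:
  assumes k: "k \<in> \<Omega>" and ess: "ess_ok (SS {s. s < k})"
  shows "left_ideal (SS {s. s < k}) (ZZ {s. s < k})"
    and "z \<in> SS {s. s < k} \<Longrightarrow> (\<alpha> k ^^ n) z \<in> ZZ {s. s < k} \<longleftrightarrow> z \<in> ZZ {s. s < k}"
proof -
  note e = sing_ideal_SS[OF dc(1) dc_sub(1)[OF k] ess, symmetric]
  note sub = S_sub[OF dc(1) dc_sub(1)[OF k]]
  have "automorph (SS {s. s < k}) (\<alpha> k)" using S_ore[OF k] by (simp add: ore_ext_def)
  then have a: "automorph (SS {s. s < k}) (\<alpha> k ^^ n)" by (rule automorph_funpow)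
  show "left_ideal (SS {s. s < k}) (ZZ {s. s < k})" unfolding e by (rule left_ideal_sing_ideal[OF sub])
  show "z \<in> SS {s. s < k} \<Longrightarrow> (\<alpha> k ^^ n) z \<in> ZZ {s. s < k} \<longleftrightarrow> z \<in> ZZ {s. s < k}"
    unfolding e by (rule automorph_sing_ideal[OF a sub])
qed

text \<open>With powers of \<open>x k\<close> as \<open>lam\<close> all denominators are
  \<open>1\<close> and each \<open>B m\<close> is the lower stage, so \<open>essential_step\<close>
  applies to the full extension.\<close>

lemma ore_special_SS:
  assumes k: "k \<in> \<Omega>" and ess: "ess_ok (SS {s. s < k})"
  shows "ore_special (SS {s. s < k}) (x k) (\<alpha> k) (\<delta> k) R (SS {s. s \<le> k}) UNIV (\<lambda>m. x k ^ m)
    (\<lambda>_. SS {s. s < k}) (\<lambda>m. \<alpha> k ^^ m) (ZZ {s. s < k})"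
proof -
  interpret ore "SS {s. s < k}" "x k" "\<alpha> k" "\<delta> k" using ore_k k by blast
  note Z = ZZ_structure[OF k ess]
  have reg: "regular (SS {s. s < k}) 1" by (auto simp: regular_def S_closed)
  have pow: "c * x k ^ m \<in> Sx" if "c \<in> SS {s. s < k}" for c m
    using monom_P[OF that, of m "Suc m"] P_in_Sx by blast
  show ?thesis unfolding SS_le[OF k]
  proof unfold_locales
    show "subring R" by (rule subR)
    show "subring Sx" by (rule subring_Sx)
    show "R \<subseteq> Sx" using R_SS S_Sx by blast
    show "\<exists>N c. (\<forall>m. c m \<in> SS {s. s < k} \<and> c m * x k ^ m \<in> Sx) \<and> a = (\<Sum>m\<le>N. c m * x k ^ m)"
      if "a \<in> Sx" for a using Sx_coeffs[OF that] pow by blast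
    show "SS {s. s < k} = Sx \<inter> SS {s. s < k}" using S_Sx by blast
    show "\<exists>v. regular (SS {s. s < k}) v \<and> x k ^ m = v * x k ^ m" for m
      using reg by (intro exI[of _ 1]) simp
    show "x k ^ m \<in> Sx" for m using pow[of 1 m] S_closed by simp
    show "subring (SS {s. s < k})" by (rule subS)
    show "R \<subseteq> SS {s. s < k}" using R_SS by blast
    show "SS {s. s < k} \<subseteq> Sx \<inter> SS {s. s < k}" using S_Sx by blast
    show "automorph (SS {s. s < k}) (\<alpha> k ^^ m)" for m by (rule aut_pow)
    show "x k ^ m * p - (\<alpha> k ^^ m) p * x k ^ m \<in> P m" if "p \<in> SS {s. s < k}" for m p
      using lt_pow_S[OF that, of m] by (simp add: lt_def)
    show "\<exists>u\<in>SS {s. s < k}. regular (SS {s. s < k}) u \<and> (\<exists>b\<in>SS {s. s < k}. u * q * x k ^ m = b * x k ^ m)"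
      if "q \<in> SS {s. s < k}" for m q
      using reg S_closed that by (intro bexI[of _ 1] conjI bexI[of _ q]) auto
    show "left_ideal (SS {s. s < k}) (ZZ {s. s < k})" by (rule Z)
    show "\<alpha> k z \<in> ZZ {s. s < k}" if "z \<in> ZZ {s. s < k}" for z
      using Z(2)[of z 1] that ZZ_SS by auto
    show "\<delta> k z = 0" if "z \<in> ZZ {s. s < k}" for z using delta_zero k that by blast
    show "sing_ideal (SS {s. s < k}) = SS {s. s < k} \<inter> ZZ {s. s < k}"
      using sing_ideal_SS[OF dc(1) dc_sub(1)[OF k] ess] ZZ_SS by blast
  qed auto
qed

text \<open>Each stage supplies, through \<open>ZZ_structure\<close>, the properties of Z(R)T under
  which the next one is treated.\<close>

theorem ess_ok_SS: "down_closed I \<Longrightarrow> I \<subseteq> \<Omega> \<Longrightarrow> ess_ok (SS I)"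
proof (induction rule: dc_induct)
  case base
  show ?case unfolding ess_ok_def SS_empty
  proof (intro allI impI ballI)
    fix L f assume L: "essential_li R L" and f: "f \<in> R - {0}"
    then obtain q where q: "q \<in> R" "q * f \<noteq> 0" "q * f \<in> L" using essential_li_iff[OF subR] by blast
    then have "q * f \<in> prod_span R L" using prod_span_mem[of 1 R "q * f" L] by (simp add: R_closed)
    then show "multiple_in R f (prod_span R L)" using q by blast
  qed
next
  case (step k)
  interpret ore_special "SS {s. s < k}" "x k" "\<alpha> k" "\<delta> k" R "SS {s. s \<le> k}" UNIV "\<lambda>m. x k ^ m"
    "\<lambda>_. SS {s. s < k}" "\<lambda>m. \<alpha> k ^^ m" "ZZ {s. s < k}"
    using step by (rule ore_special_SS)
  show ?case unfolding ess_ok_def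
  proof (intro allI impI ballI)
    fix L f assume L: "essential_li R L" and f: "f \<in> SS {s. s \<le> k} - {0}"
    have LR: "L \<subseteq> R" using L by (auto simp: essential_li_def left_ideal_def)
    have "\<exists>q\<in>SS {s. s < k}. q * f \<noteq> 0 \<and> q * f \<in> prod_span (SS {s. s \<le> k}) L"
      using L f step(2) by (intro essential_step[OF LR]) (auto simp: ess_ok_def)
    then show "\<exists>q\<in>SS {s. s \<le> k}. q * f \<noteq> 0 \<and> q * f \<in> prod_span (SS {s. s \<le> k}) L"
      using SS_mono[of "{s. s < k}" "{s. s \<le> k}"] by (auto simp: less_imp_le subset_iff)
  qed
next
  case (lim I)
  show ?case unfolding ess_ok_def
  proof (intro allI impI ballI)
    fix L f assume L: "essential_li R L" and f: "f \<in> SS I - {0}"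
    then obtain k where k: "k \<in> I" "f \<in> SS {s. s \<le> k}" using SS_finite[OF lim(3), of "{f}"] by auto
    then obtain q where q: "q \<in> SS {s. s \<le> k}" "q * f \<noteq> 0" "q * f \<in> prod_span (SS {s. s \<le> k}) L"
      using lim(4) L f unfolding ess_ok_def by blast
    have "{s. s \<le> k} \<subseteq> I" using k lim(1) by (auto simp: down_closed_def)
    note mono = SS_mono[OF this]
    show "multiple_in (SS I) f (prod_span (SS I) L)"
      using q mono prod_span_mono[OF q(3) mono subset_refl] by blast
  qed
qed

lemmas ZZ_struct = ZZ_structure[OF _ ess_ok_SS[OF dc(1) dc_sub(1)]]

theorem independent_extend:
  assumes F: "finite F" and L: "\<And>i. i \<in> F \<Longrightarrow> left_ideal R (L i)" and ind: "independent_li F L"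
  shows "independent_li F (\<lambda>i. prod_span UNIV (L i))"
proof -
  have LR: "L i \<subseteq> R" if "i \<in> F" for i using L[OF that] by (simp add: left_ideal_def)
  have "independent_li F (\<lambda>i. prod_span (SS \<Omega>) (L i))"
    using Omega subset_refl
  proof (induction rule: dc_induct)
    case base
    show ?case unfolding independent_li_def SS_empty
      using ind prod_span_left_ideal[OF L] unfolding independent_li_def by blast
  next
    case (step k)
    interpret ore "SS {s. s < k}" "x k" "\<alpha> k" "\<delta> k" using ore_k step by blast
    show ?case unfolding SS_le[OF step(1)] using LR R_SS step
      by (intro independent_Sx[OF F]) blast+
  next
    case (lim I)
    show ?case unfolding independent_li_def
    proof (intro allI impI)
      fix c assume c: "(\<forall>i\<in>F. c i \<in> prod_span (SS I) (L i)) \<and> sum c F = 0"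
      \<comment> \<open>The left factors of all \<open>c i\<close> together form a finite set, so
        the relation already holds in one stage below.\<close>
      then have "\<forall>i\<in>F. \<exists>E. finite E \<and> E \<subseteq> SS I \<and> c i \<in> prod_span E (L i)"
        using prod_span_finite by blast
      then obtain E where E: "\<forall>i\<in>F. finite (E i) \<and> E i \<subseteq> SS I \<and> c i \<in> prod_span (E i) (L i)" by metis
      then have "finite (\<Union>(E ` F))" "\<Union>(E ` F) \<subseteq> SS I" using F by auto
      then obtain k where k: "k \<in> I" "\<Union>(E ` F) \<subseteq> SS {s. s \<le> k}" using SS_finite[OF lim(3)] by blast
      have "c i \<in> prod_span (SS {s. s \<le> k}) (L i)" if "i \<in> F" for i
      proof (rule prod_span_mono)
        show "c i \<in> prod_span (E i) (L i)" using E that by blast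
        show "E i \<subseteq> SS {s. s \<le> k}" using k(2) that by blast
        show "L i \<subseteq> L i" by (rule subset_refl)
      qed
      then have "c i = 0" if "i \<in> F" for i
        by (rule independent_liD[OF lim(4)[OF k(1)] _ conjunct2[OF c] that])
      then show "\<forall>i\<in>F. c i = 0" by blast
    qed
  qed
  then show ?thesis by (simp add: S_top)
qed

text \<open>Zero intersection is independence of a family of two, so the relation between
  \<open>y\<close> and \<open>- y\<close> in the extended ideals is trivial.\<close>

lemma prod_span_disjoint:
  assumes "left_ideal R L" "left_ideal R C" "L \<inter> C = {0}" "y \<in> prod_span UNIV L" "y \<in> prod_span UNIV C"
  shows "y = 0"
proof -
  define Ls where "Ls = (\<lambda>i::nat. if i = 0 then L else C)"
  have "independent_li {0,1} Ls" unfolding independent_li_def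
  proof (intro allI impI)
    fix c assume c: "(\<forall>i\<in>{0,1}. c i \<in> Ls i) \<and> sum c {0,1} = 0"
    then have "c 0 \<in> L" "c 1 \<in> C" "c 0 = - c 1" by (auto simp: Ls_def eq_neg_iff_add_eq_0)
    then have "c 0 \<in> L \<inter> C" using left_ideal_uminus[OF assms(2)] by auto
    then show "\<forall>i\<in>{0,1}. c i = 0" using assms(3) \<open>c 0 = - c 1\<close> by auto
  qed
  then have "independent_li {0,1} (\<lambda>i. prod_span UNIV (Ls i))"
    using assms by (intro independent_extend) (auto simp: Ls_def)
  moreover have "- y \<in> prod_span UNIV C" using assms(5) by (rule prod_span_uminus) simp
  ultimately show ?thesis
    using independent_liD[of "{0,1}" "\<lambda>i. prod_span UNIV (Ls i)" "\<lambda>i. if i = 0 then y else - y" 0] assms(4)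
    by (auto simp: Ls_def)
qed

text \<open>Moves singular coefficients from the left to the right:
  \<open>z * x k ^ n = x k ^ n * w\<close> exactly, where \<open>z\<close> is the image of
  \<open>w\<close> under a power of \<alpha>. In this form Z(R)T can be compared with left ideals
  extended from \<open>R\<close>.\<close>

lemma ZZ_prod_span: "down_closed I \<Longrightarrow> I \<subseteq> \<Omega> \<Longrightarrow> \<forall>y\<in>ZZ I. y \<in> prod_span UNIV (sing_ideal R)"
proof (induction rule: dc_induct)
  case base
  show ?case using prod_span_mem[of 1 UNIV _ "sing_ideal R"] by (auto simp: ZZ_empty)
next
  case (lim I)
  then show ?case using ZZ_finite by blast
next
  case (step k)
  interpret ore_special "SS {s. s < k}" "x k" "\<alpha> k" "\<delta> k" R "SS {s. s \<le> k}" UNIV "\<lambda>m. x k ^ m"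
    "\<lambda>_. SS {s. s < k}" "\<lambda>m. \<alpha> k ^^ m" "ZZ {s. s < k}"
    using step(1) ess_ok_SS[OF dc(1) dc_sub(1)[OF step(1)]] by (rule ore_special_SS)
  show ?case
  proof
    fix y assume "y \<in> ZZ {s. s \<le> k}"
    then have "y \<in> prod_span (ZZ {s. s < k}) (range (\<lambda>n. x k ^ n))"
      by (simp add: ZZ_eq prod_span_std_terms_le)
    then show "y \<in> prod_span UNIV (sing_ideal R)"
    proof (induction rule: prod_span_induct)
      case zero then show ?case by (rule prod_span_zero)
    next
      case (Cons z l y)
      then obtain n where l: "l = x k ^ n" by blast
      have zS: "z \<in> SS {s. s < k}" using Cons ZZ_SS by blast
      then obtain w where w: "w \<in> SS {s. s < k}" "(\<alpha> k ^^ n) w = z" using alpha_pow(5) by blast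
      then have wZ: "w \<in> ZZ {s. s < k}" using ZZ_struct(2)[OF step(1) step(1) w(1), of n] Cons by simp
      then have "w \<in> prod_span UNIV (sing_ideal R)" using step(2) by blast
      then have "x k ^ n * w \<in> prod_span UNIV (sing_ideal R)" by (rule prod_span_mult_left) simp
      then have "z * l \<in> prod_span UNIV (sing_ideal R)" using pow_Z[OF wZ, of n] w l by simp
      then show ?case using Cons(4) by (rule prod_span_add)
    qed
  qed
qed

end

section \<open>Essentially special subextensions\<close>

definition li_sum :: "'a::ring_1 set \<Rightarrow> 'a set \<Rightarrow> 'a set" where
  "li_sum L M = {y. \<exists>a\<in>L. \<exists>b\<in>M. y = a + b}"

lemma left_ideal_li_sum:
  assumes "subring A" "left_ideal A L" "left_ideal A M"
  shows "left_ideal A (li_sum L M)"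
  unfolding left_ideal_def
proof (intro conjI ballI)
  show "li_sum L M \<subseteq> A"
    using left_ideal_subset[OF assms(2)] left_ideal_subset[OF assms(3)] subring_add[OF assms(1)]
    by (auto simp: li_sum_def)
  show "0 \<in> li_sum L M" using left_ideal_zero[OF assms(2)] left_ideal_zero[OF assms(3)]
    unfolding li_sum_def by force
  fix y w assume "y \<in> li_sum L M" "w \<in> li_sum L M"
  then obtain a b c d where ab: "a \<in> L" "b \<in> M" "y = a + b" "c \<in> L" "d \<in> M" "w = c + d"
    by (auto simp: li_sum_def)
  then have "y - w = (a - c) + (b - d)" "a - c \<in> L" "b - d \<in> M"
    using left_ideal_diff[OF assms(2)] left_ideal_diff[OF assms(3)] by auto
  then show "y - w \<in> li_sum L M" unfolding li_sum_def by blast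
next
  fix r y assume r: "r \<in> A" and "y \<in> li_sum L M"
  then obtain a b where ab: "a \<in> L" "b \<in> M" "y = a + b" by (auto simp: li_sum_def)
  then have "r * y = r * a + r * b" "r * a \<in> L" "r * b \<in> M"
    using r left_ideal_mult[OF assms(2)] left_ideal_mult[OF assms(3)] by (auto simp: distrib_left)
  then show "r * y \<in> li_sum L M" unfolding li_sum_def by blast
qed

lemma left_ideal_Union_chain:
  assumes "\<C> \<noteq> {}" "subset.chain X \<C>" "\<And>C. C \<in> \<C> \<Longrightarrow> left_ideal A C"
  shows "left_ideal A (\<Union>\<C>)"
  unfolding left_ideal_def
proof (intro conjI ballI)
  show "\<Union>\<C> \<subseteq> A" using left_ideal_subset[OF assms(3)] by blast
  show "0 \<in> \<Union>\<C>" using assms(1,3) left_ideal_zero by blast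
  fix a b assume "a \<in> \<Union>\<C>" "b \<in> \<Union>\<C>"
  then obtain C D where CD: "C \<in> \<C>" "D \<in> \<C>" "a \<in> C" "b \<in> D" by blast
  then have "C \<subseteq> D \<or> D \<subseteq> C" using assms(2) unfolding subset_chain_def by blast
  then show "a - b \<in> \<Union>\<C>"
  proof
    assume "C \<subseteq> D"
    then have "a - b \<in> D" using CD left_ideal_diff[OF assms(3)] by blast
    then show ?thesis using CD by blast
  next
    assume "D \<subseteq> C"
    then have "a - b \<in> C" using CD left_ideal_diff[OF assms(3)] by blast
    then show ?thesis using CD by blast
  qed
next
  fix r a assume "r \<in> A" "a \<in> \<Union>\<C>"
  then show "r * a \<in> \<Union>\<C>" using left_ideal_mult[OF assms(3)] by blast
qed

text \<open>\<open>C\<close> is maximal with \<open>L \<inter> C = {0}\<close>. If \<open>f\<close>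
  had no non-zero multiple in the sum, \<open>C\<close> enlarged by \<open>principal R f\<close>
  would still meet \<open>L\<close> trivially; maximality then puts \<open>f\<close> into
  \<open>C\<close>, hence into the sum.\<close>

lemma essential_complement:
  assumes R: "subring R" and L: "left_ideal R L"
  shows "\<exists>C. left_ideal R C \<and> L \<inter> C = {0} \<and> essential_li R (li_sum L C)"
proof -
  define X where "X = {C. left_ideal R C \<and> L \<inter> C = {0}}"
  have "left_ideal R {0}" by (auto simp: left_ideal_def subring_zero[OF R])
  then have "{0} \<in> X" using left_ideal_zero[OF L] by (auto simp: X_def)
  then have "X \<noteq> {}" by blast
  moreover have "\<Union>\<C> \<in> X" if "\<C> \<noteq> {}" "subset.chain X \<C>" for \<C>
  proof -
    have mem: "C \<in> X" if "C \<in> \<C>" for C using that \<open>subset.chain X \<C>\<close> by (auto simp: subset_chain_def)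
    then have "left_ideal R (\<Union>\<C>)" using that by (intro left_ideal_Union_chain[of \<C> X]) (auto simp: X_def)
    moreover have "L \<inter> \<Union>\<C> = {0}"
    proof -
      have "L \<inter> \<Union>\<C> \<subseteq> {0}" using mem by (auto simp: X_def)
      then show ?thesis using left_ideal_zero[OF L] left_ideal_zero[OF \<open>left_ideal R (\<Union>\<C>)\<close>] by blast
    qed
    ultimately show ?thesis by (simp add: X_def)
  qed
  ultimately obtain C where C: "C \<in> X" "\<forall>D\<in>X. C \<subseteq> D \<longrightarrow> D = C" using subset_Zorn_nonempty[of X] by blast
  have CL: "left_ideal R C" "L \<inter> C = {0}" using C by (auto simp: X_def)
  have LC: "left_ideal R (li_sum L C)" using left_ideal_li_sum R L CL by blast
  have "multiple_in R f (li_sum L C)" if f: "f \<in> R - {0}" for f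
  proof (rule ccontr)
    assume no: "\<not> ?thesis"
    define D where "D = li_sum C (principal R f)"
    have D: "left_ideal R D" unfolding D_def using left_ideal_li_sum[OF R CL(1) left_ideal_principal[OF R]] f by blast
    have "l = 0" if l: "l \<in> L" "l \<in> D" for l
    proof -
      obtain c r where c: "c \<in> C" "r \<in> R" "l = c + r * f" using l by (auto simp: D_def li_sum_def)
      then have "r * f = l + - c" by simp
      then have "r * f \<in> li_sum L C" using l c left_ideal_uminus[OF CL(1)] unfolding li_sum_def by blast
      then have "r * f = 0" using no c by blast
      then show ?thesis using c l CL(2) by auto
    qed
    then have "L \<inter> D = {0}" using left_ideal_zero[OF L] left_ideal_zero[OF D] by auto
    then have "D \<in> X" using D by (simp add: X_def)
    moreover have "C \<subseteq> D"
    proof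
      fix c assume "c \<in> C"
      then have "c = c + 0 * f \<and> c \<in> C" by simp
      then show "c \<in> D" unfolding D_def li_sum_def using subring_zero[OF R] by blast
    qed
    ultimately have "D = C" using C by blast
    have "f = 0 + 1 * f" by simp
    then have "f \<in> D" unfolding D_def li_sum_def using left_ideal_zero[OF CL(1)] subring_one[OF R] by blast
    then have "f \<in> C" using \<open>D = C\<close> by blast
    moreover have "f = 0 + f" by simp
    ultimately have "f \<in> li_sum L C" unfolding li_sum_def using left_ideal_zero[OF L] by blast
    then show False using no f subring_one[OF R] by (metis Diff_iff insertI1 mult_1)
  qed
  then have "essential_li R (li_sum L C)" using essential_li_iff[OF R] LC by blast
  then show ?thesis using CL by blast
qed

lemma prod_span_li_sum:
  assumes "y \<in> prod_span A (li_sum L C)"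
  shows "\<exists>u\<in>prod_span A L. \<exists>w\<in>prod_span A C. y = u + w"
  using assms
proof (induction rule: prod_span_induct)
  case zero
  have "(0::'a) = 0 + 0" by simp
  then show ?case using prod_span_zero by blast
next
  case (Cons a l y)
  then obtain u w where uw: "u \<in> prod_span A L" "w \<in> prod_span A C" "y = u + w" by blast
  obtain b c where bc: "b \<in> L" "c \<in> C" "l = b + c" using Cons by (auto simp: li_sum_def)
  have "a * l + y = (a * b + u) + (a * c + w)" using uw bc by (simp add: algebra_simps)
  moreover have "a * b + u \<in> prod_span A L" "a * c + w \<in> prod_span A C"
    using Cons uw bc prod_span_Cons by auto
  ultimately show ?case by blast
qed

section \<open>Good subrings and the permanence of goodness\<close>

context skew
begin

definition unif_ok :: "'a set \<Rightarrow> bool" where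
  "unif_ok A \<longleftrightarrow> (\<forall>L. uniform_li R L \<longrightarrow> (\<forall>f g. f \<in> A \<longrightarrow> f \<in> prod_span A L \<longrightarrow> f \<noteq> 0 \<longrightarrow>
     g \<in> A \<longrightarrow> g \<in> prod_span A L \<longrightarrow> g \<noteq> 0 \<longrightarrow> common_multiple A f g))"

text \<open>An essentially special subextension need not contain \<open>R\<close>; \<open>nice_R\<close> is the substitute for \<open>R \<subseteq> A\<close>
  that survives nicely essential subrings and unions of chains.\<close>

definition nice_R :: "'a set \<Rightarrow> bool" where
  "nice_R A \<longleftrightarrow> (\<forall>E. finite E \<and> E \<subseteq> prod_span A R - {0} \<longrightarrow> (\<exists>a\<in>A. \<forall>y\<in>E. a * y \<noteq> 0 \<and> a * y \<in> A))"

definition good :: "'a set \<Rightarrow> bool" where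
  "good A \<longleftrightarrow> subring A \<and> ess_ok A \<and> unif_ok A \<and> nice_R A"

lemma ess_okD:
  "ess_ok A \<Longrightarrow> essential_li R L \<Longrightarrow> f \<in> A \<Longrightarrow> f \<noteq> 0 \<Longrightarrow> multiple_in A f (prod_span A L)"
  by (simp add: ess_ok_def)

lemma unif_okD:
  "unif_ok A \<Longrightarrow> uniform_li R L \<Longrightarrow> f \<in> A \<Longrightarrow> f \<in> prod_span A L \<Longrightarrow> f \<noteq> 0 \<Longrightarrow> g \<in> A \<Longrightarrow>
    g \<in> prod_span A L \<Longrightarrow> g \<noteq> 0 \<Longrightarrow> common_multiple A f g"
  by (simp add: unif_ok_def)

lemma nice_RD:
  "nice_R A \<Longrightarrow> finite E \<Longrightarrow> E \<subseteq> prod_span A R - {0} \<Longrightarrow> \<exists>a\<in>A. \<forall>y\<in>E. a * y \<noteq> 0 \<and> a * y \<in> A"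
  by (simp add: nice_R_def)

lemma uniform_subset: "uniform_li R L \<Longrightarrow> L \<subseteq> R" and essential_subset: "essential_li R L \<Longrightarrow> L \<subseteq> R"
  by (auto simp: uniform_li_def essential_li_def left_ideal_def)

lemma nice_R_contains:
  assumes "subring A" "R \<subseteq> A"
  shows "nice_R A"
  unfolding nice_R_def
proof (intro allI impI)
  fix E assume E: "finite E \<and> E \<subseteq> prod_span A R - {0}"
  have "\<forall>y\<in>E. 1 * y \<noteq> 0 \<and> 1 * y \<in> A"
    using E prod_span_subset[OF assms] by auto
  then show "\<exists>a\<in>A. \<forall>y\<in>E. a * y \<noteq> 0 \<and> a * y \<in> A" using subring_one[OF assms(1)] by blast
qed

lemma good_R: "good R"
proof -
  have "unif_ok R" unfolding unif_ok_def
  proof (intro allI impI)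
    fix L f g assume L: "uniform_li R L" and f: "f \<in> prod_span R L" "f \<noteq> 0" and g: "g \<in> prod_span R L" "g \<noteq> 0"
    have "left_ideal R L" using L by (simp add: uniform_li_def)
    then have "f \<in> L - {0}" "g \<in> L - {0}" using prod_span_left_ideal f g by auto
    then show "common_multiple R f g" using L uniform_li_iff[OF subR, of L] by meson
  qed
  then show ?thesis using ess_ok_SS[OF dc(3)] nice_R_contains[OF subR] subR
    by (simp add: good_def SS_empty)
qed

text \<open>A single \<open>a\<close> in \<open>A\<close> moves into \<open>A\<close> all of the
  finitely many elements of \<open>At\<close> involved: the multipliers, the product and, for
  essentiality, the left factors of a representation.\<close>

lemma good_nicely_ess:
  assumes At: "good At" "R \<subseteq> At" and nice: "nicely_ess A At"
  shows "good A"
proof -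
  have subAt: "subring At" using At by (simp add: good_def)
  have subA: "subring A" and AAt: "A \<subseteq> At" using nice by (auto simp: nicely_ess_def)
  have clear: "\<exists>a\<in>A. \<forall>y\<in>E. y \<noteq> 0 \<longrightarrow> a * y \<noteq> 0 \<and> a * y \<in> A" if "finite E" "E \<subseteq> At" for E
  proof -
    have "finite (E - {0}) \<and> E - {0} \<subseteq> At - {0}" using that by auto
    then obtain a where "a \<in> A" "\<forall>y\<in>E - {0}. a * y \<noteq> 0 \<and> a * y \<in> A"
      using nice unfolding nicely_ess_def by meson
    then show ?thesis by blast
  qed
  have PS: "y \<in> At" if "y \<in> prod_span A R" for y
    using prod_span_subset[OF subAt At(2) prod_span_mono[OF that AAt subset_refl]] .
  have "nice_R A" unfolding nice_R_def
  proof (intro allI impI)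
    fix E assume E: "finite E \<and> E \<subseteq> prod_span A R - {0}"
    then obtain a where "a \<in> A" "\<forall>y\<in>E. y \<noteq> 0 \<longrightarrow> a * y \<noteq> 0 \<and> a * y \<in> A" using clear[of E] PS by blast
    then show "\<exists>a\<in>A. \<forall>y\<in>E. a * y \<noteq> 0 \<and> a * y \<in> A" using E by blast
  qed
  moreover have "ess_ok A" unfolding ess_ok_def
  proof (intro allI impI ballI)
    fix L f assume L: "essential_li R L" and f: "f \<in> A - {0}"
    have eo: "ess_ok At" using At by (simp add: good_def)
    obtain q where q: "q \<in> At" "q * f \<noteq> 0" "q * f \<in> prod_span At L"
      using ess_okD[OF eo L, of f] f AAt by blast
    obtain F where F: "finite F" "F \<subseteq> At" "q * f \<in> prod_span F L" using prod_span_finite[OF q(3)] by blast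
    have qfA: "q * f \<in> At" using q f AAt subring_mult[OF subAt] by blast
    obtain a where a: "a \<in> A" "\<forall>y\<in>insert q (insert (q * f) F). y \<noteq> 0 \<longrightarrow> a * y \<noteq> 0 \<and> a * y \<in> A"
      using clear[of "insert q (insert (q * f) F)"] F q qfA by auto
    have "a * (q * f) \<in> prod_span A L"
    proof (rule prod_span_mult_left[OF F(3)])
      show "a * b \<in> A" if "b \<in> F" for b
        using a that subring_zero[OF subA] by (cases "b = 0") auto
    qed
    moreover have "q \<noteq> 0" using q by auto
    then have "a * q \<in> A" using a by blast
    moreover have "a * (q * f) \<noteq> 0" using a q by blast
    ultimately show "multiple_in A f (prod_span A L)"
      by (intro bexI[of _ "a * q"]) (auto simp: mult.assoc)
  qed
  moreover have "unif_ok A" unfolding unif_ok_def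
  proof (intro allI impI)
    fix L f g assume L: "uniform_li R L" and f: "f \<in> A" "f \<in> prod_span A L" "f \<noteq> 0"
      and g: "g \<in> A" "g \<in> prod_span A L" "g \<noteq> 0"
    have uo: "unif_ok At" using At by (simp add: good_def)
    have "f \<in> prod_span At L" "g \<in> prod_span At L"
      using prod_span_mono[OF f(2) AAt subset_refl] prod_span_mono[OF g(2) AAt subset_refl] by auto
    then obtain s t where st: "s \<in> At" "t \<in> At" "s * f = t * g" "s * f \<noteq> 0"
      using unif_okD[OF uo L, of f g] f g AAt by blast
    have "s * f \<in> At" using st f AAt subring_mult[OF subAt] by blast
    then obtain a where a: "a \<in> A" "\<forall>y\<in>{s, t, s * f}. y \<noteq> 0 \<longrightarrow> a * y \<noteq> 0 \<and> a * y \<in> A"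
      using clear[of "{s, t, s * f}"] st by auto
    have "s \<noteq> 0" "t \<noteq> 0" using st by auto
    then have "a * s \<in> A" "a * t \<in> A" "a * (s * f) \<noteq> 0" using a st by auto
    moreover from this have "(a * s) * f = (a * t) * g" "(a * s) * f \<noteq> 0"
      using st(3) by (auto simp: mult.assoc)
    ultimately show "common_multiple A f g" by blast
  qed
  ultimately show ?thesis using subA by (simp add: good_def)
qed

lemma chain_finite_subset:
  assumes "\<Lambda> \<noteq> {}" "\<forall>j\<in>\<Lambda>. \<forall>j'\<in>\<Lambda>. j \<le> j' \<longrightarrow> Af j \<subseteq> Af j'" "finite F" "F \<subseteq> (\<Union>j\<in>\<Lambda>. Af j)"
  shows "\<exists>j\<in>(\<Lambda>::'v set). F \<subseteq> Af j"
  using assms(3,4)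
proof (induction F rule: finite_induct)
  case empty then show ?case using assms(1) by blast
next
  case (insert y F)
  then obtain i j where ij: "i \<in> \<Lambda>" "F \<subseteq> Af i" "j \<in> \<Lambda>" "y \<in> Af j" by auto
  show ?case
  proof (cases "i \<le> j")
    case True
    then have "insert y F \<subseteq> Af j" using assms(2) ij by blast
    then show ?thesis using ij by blast
  next
    case False
    then have "insert y F \<subseteq> Af i" using assms(2) ij by (meson insert_subset le_cases subset_iff)
    then show ?thesis using ij by blast
  qed
qed

text \<open>Each property concerns finitely many elements and finitely many left factors, so it
  takes place within one member of the chain.\<close>

lemma good_Union:
  assumes ne: "\<Lambda> \<noteq> {}" and chain: "\<forall>j\<in>\<Lambda>. \<forall>j'\<in>\<Lambda>. j \<le> j' \<longrightarrow> Af j \<subseteq> Af j'"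
    and good: "\<And>j. j \<in> (\<Lambda>::'v set) \<Longrightarrow> good (Af j)"
  shows "good (\<Union>j\<in>\<Lambda>. Af j)"
proof -
  let ?A = "\<Union>j\<in>\<Lambda>. Af j"
  have sub: "subring (Af j)" "ess_ok (Af j)" "unif_ok (Af j)" "nice_R (Af j)" if "j \<in> \<Lambda>" for j
    using good[OF that] by (auto simp: good_def)
  note fin = chain_finite_subset[OF ne chain]
  have AfA: "Af j \<subseteq> ?A" if "j \<in> \<Lambda>" for j using that by blast
  have subA: "subring ?A" unfolding subring_def
  proof (intro conjI ballI)
    show "1 \<in> ?A" using ne subring_one[OF sub(1)] by blast
    fix a b assume "a \<in> ?A" "b \<in> ?A"
    then obtain j where j: "j \<in> \<Lambda>" "{a, b} \<subseteq> Af j" using fin[of "{a, b}"] by auto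
    then have "a - b \<in> Af j" "a * b \<in> Af j"
      using subring_diff[OF sub(1)[OF j(1)]] subring_mult[OF sub(1)[OF j(1)]] by auto
    then show "a - b \<in> ?A" "a * b \<in> ?A" using j by blast+
  qed
  moreover have "ess_ok ?A" unfolding ess_ok_def
  proof (intro allI impI ballI)
    fix L f assume L: "essential_li R L" and f: "f \<in> ?A - {0}"
    then obtain j where j: "j \<in> \<Lambda>" "f \<in> Af j" by blast
    obtain q where q: "q \<in> Af j" "q * f \<noteq> 0" "q * f \<in> prod_span (Af j) L"
      using ess_okD[OF sub(2)[OF j(1)] L j(2)] f by blast
    show "multiple_in ?A f (prod_span ?A L)"
      using q prod_span_mono[OF q(3) AfA[OF j(1)] subset_refl] j by blast
  qed
  moreover have "unif_ok ?A" unfolding unif_ok_def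
  proof (intro allI impI)
    fix L f g assume L: "uniform_li R L" and f: "f \<in> ?A" "f \<in> prod_span ?A L" "f \<noteq> 0"
      and g: "g \<in> ?A" "g \<in> prod_span ?A L" "g \<noteq> 0"
    obtain F G where F: "finite F" "F \<subseteq> ?A" "f \<in> prod_span F L" and G: "finite G" "G \<subseteq> ?A" "g \<in> prod_span G L"
      using prod_span_finite[OF f(2)] prod_span_finite[OF g(2)] by blast
    then obtain j where j: "j \<in> \<Lambda>" "insert f (insert g (F \<union> G)) \<subseteq> Af j"
      using fin[of "insert f (insert g (F \<union> G))"] f(1) g(1) by auto
    have FG: "F \<subseteq> Af j" "G \<subseteq> Af j" "f \<in> Af j" "g \<in> Af j" using j(2) by auto
    have pf: "f \<in> prod_span (Af j) L" by (rule prod_span_mono[OF F(3) FG(1) subset_refl])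
    have pg: "g \<in> prod_span (Af j) L" by (rule prod_span_mono[OF G(3) FG(2) subset_refl])
    obtain s t where st: "s \<in> Af j" "t \<in> Af j" "s * f = t * g \<and> s * f \<noteq> 0"
      using unif_okD[OF sub(3)[OF j(1)] L FG(3) pf f(3) FG(4) pg g(3)] by blast
    then have "s \<in> ?A" "t \<in> ?A" using j(1) by blast+
    with st(3) show "common_multiple ?A f g" by (intro bexI)
  qed
  moreover have "nice_R ?A" unfolding nice_R_def
  proof (intro allI impI)
    fix E assume E: "finite E \<and> E \<subseteq> prod_span ?A R - {0}"
    have "\<forall>y\<in>E. \<exists>F. finite F \<and> F \<subseteq> ?A \<and> y \<in> prod_span F R" using prod_span_finite E by blast
    then obtain F where F: "\<forall>y\<in>E. finite (F y) \<and> F y \<subseteq> ?A \<and> y \<in> prod_span (F y) R" by metis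
    have "finite (\<Union>(F ` E))" using E F by simp
    moreover have "\<Union>(F ` E) \<subseteq> ?A" using F by (intro UN_least) blast
    ultimately obtain j where j: "j \<in> \<Lambda>" "\<Union>(F ` E) \<subseteq> Af j" using fin[of "\<Union>(F ` E)"] by blast
    have "E \<subseteq> prod_span (Af j) R - {0}"
    proof
      fix y assume y: "y \<in> E"
      have "y \<in> prod_span (F y) R" using F y by blast
      then have "y \<in> prod_span (Af j) R" by (rule prod_span_mono) (use j y in blast)+
      then show "y \<in> prod_span (Af j) R - {0}" using E y by blast
    qed
    then obtain a where a: "a \<in> Af j" "\<forall>y\<in>E. a * y \<noteq> 0 \<and> a * y \<in> Af j"
      using nice_RD[OF sub(4)[OF j(1)]] E by blast
    then have "a \<in> ?A" using j(1) by blast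
    moreover have "\<forall>y\<in>E. a * y \<noteq> 0 \<and> a * y \<in> ?A"
    proof
      fix y assume "y \<in> E"
      then have "a * y \<noteq> 0" "a * y \<in> Af j" using a(2) by auto
      then show "a * y \<noteq> 0 \<and> a * y \<in> ?A" using j(1) by blast
    qed
    ultimately show "\<exists>a\<in>?A. \<forall>y\<in>E. a * y \<noteq> 0 \<and> a * y \<in> ?A" by (intro bexI)
  qed
  ultimately show ?thesis by (simp add: good_def)
qed

text \<open>Degree 0 is handled apart, as \<open>special\<close> states its conditions for
  \<open>m \<noteq> 0\<close> and prescribes \<open>lam 0\<close>, \<open>B 0\<close> and
  \<open>alm 0\<close>. Essentiality for the rings \<open>B m\<close> enters through the description
  of their singular ideals.\<close>

lemma ore_special_special:
  assumes k: "k \<in> \<Omega>"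
    and sp: "special (SS {s. s < k}) (x k) R (SS {s. s \<le> k}) At lam B alm"
    and B: "\<And>m. m \<in> Degs (SS {s. s < k}) (x k) At \<Longrightarrow> ess_ok (B m)"
  shows "ore_special (SS {s. s < k}) (x k) (\<alpha> k) (\<delta> k) R At (Degs (SS {s. s < k}) (x k) At) lam B alm
    (ZZ {s. s < k})"
proof -
  interpret ore "SS {s. s < k}" "x k" "\<alpha> k" "\<delta> k" using ore_k k by blast
  let ?S = "SS {s. s < k}" and ?D = "Degs (SS {s. s < k}) (x k) At"
  note Z = ZZ_struct[OF k k]
  have At: "subring At" "R \<subseteq> At" "At \<subseteq> Sx" using sp unfolding special_def SS_le[OF k] by blast+
  have zero: "lam 0 = 1" "B 0 = At \<inter> ?S" "\<forall>p\<in>B 0. alm 0 p = p" using sp unfolding special_def by blast+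
  have pos: "(\<exists>v. regular ?S v \<and> lam m = v * x k ^ m) \<and> lam m \<in> At \<and>
        subring (B m) \<and> R \<subseteq> B m \<and> B m \<subseteq> At \<inter> ?S \<and> automorph (B m) (alm m) \<and>
        (\<forall>p\<in>B m. degx ?S (x k) (lam m * p - alm m p * lam m) < m) \<and>
        (\<forall>q\<in>?S. q * x k ^ m \<in> At \<longrightarrow> (\<exists>u\<in>B m. regular ?S u \<and> (\<exists>b\<in>B m. u * q * x k ^ m = b * lam m)))"
    if "m \<in> ?D" "m \<noteq> 0" for m using sp that unfolding special_def by blast
  have reg: "regular ?S 1" by (auto simp: regular_def S_closed)
  have sub0: "subring (At \<inter> ?S)" using At(1) subS unfolding subring_def by blast
  have subB: "subring (B m)" and RB: "R \<subseteq> B m" and BAS: "B m \<subseteq> At \<inter> ?S"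
    and autB: "automorph (B m) (alm m)" and lamA: "lam m \<in> At"
    and form: "\<exists>v. regular ?S v \<and> lam m = v * x k ^ m" if m: "m \<in> ?D" for m
  proof -
    have "subring (B m) \<and> R \<subseteq> B m \<and> B m \<subseteq> At \<inter> ?S \<and> automorph (B m) (alm m) \<and> lam m \<in> At
      \<and> (\<exists>v. regular ?S v \<and> lam m = v * x k ^ m)"
    proof (cases "m = 0")
      case True
      have "automorph (B 0) (alm 0)"
        using zero(3) subring_one[OF sub0] subring_add[OF sub0] subring_mult[OF sub0]
        unfolding automorph_def bij_betw_def zero(2) inj_on_def by auto
      then show ?thesis using True zero sub0 At R_SS reg subring_one[OF At(1)]
        by (auto intro!: exI[of _ 1])
    next
      case False
      then show ?thesis using pos[OF m] by blast
    qed
    then show "subring (B m)" "R \<subseteq> B m" "B m \<subseteq> At \<inter> ?S" "automorph (B m) (alm m)" "lam m \<in> At"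
      "\<exists>v. regular ?S v \<and> lam m = v * x k ^ m" by blast+
  qed
  have Deq: "?D = {dA ?S (x k) At * n | n. True}" using sp unfolding special_def by blast
  show ?thesis
  proof unfold_locales
    show "subring R" by (rule subR)
    show "subring At" "R \<subseteq> At" "At \<subseteq> Sx" by (fact At)+
    show "\<exists>N c. (\<forall>m. c m \<in> ?S \<and> c m * x k ^ m \<in> At) \<and> a = (\<Sum>m\<le>N. c m * x k ^ m)" if "a \<in> At" for a
      using sp that unfolding special_def by blast
    show "m \<in> ?D" if "a \<in> At" "lt m c a" "c \<noteq> 0" for a m c
    proof -
      have "a \<noteq> 0" using that lt_zero by blast
      moreover have "m = degx ?S (x k) a" using degx_eq that by simp
      ultimately show ?thesis unfolding Degs_def using that by blast
    qed
    show "m - n \<in> ?D" if mn: "m \<in> ?D" "n \<in> ?D" for m n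
    proof -
      obtain i j where "m = dA ?S (x k) At * i" "n = dA ?S (x k) At * j" using mn unfolding Deq by blast
      then have "m - n = dA ?S (x k) At * (i - j)" by (simp add: diff_mult_distrib2)
      then show ?thesis unfolding Deq by blast
    qed
    show "B 0 = At \<inter> ?S" by (fact zero)
    show "\<exists>v. regular ?S v \<and> lam m = v * x k ^ m" if "m \<in> ?D" for m by (rule form[OF that])
    show "lam m \<in> At" if "m \<in> ?D" for m by (rule lamA[OF that])
    show "subring (B m)" if "m \<in> ?D" for m by (rule subB[OF that])
    show "R \<subseteq> B m" if "m \<in> ?D" for m by (rule RB[OF that])
    show "B m \<subseteq> At \<inter> ?S" if "m \<in> ?D" for m by (rule BAS[OF that])
    show "automorph (B m) (alm m)" if "m \<in> ?D" for m by (rule autB[OF that])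
    show "lam m * p - alm m p * lam m \<in> P m" if m: "m \<in> ?D" and p: "p \<in> B m" for m p
    proof (cases "m = 0")
      case True
      then show ?thesis using zero p by (simp add: P_zero)
    next
      case False
      have "alm m p \<in> B m" using automorphD(1)[OF autB[OF m] p] .
      then have "alm m p \<in> At" "p \<in> At" using BAS[OF m] p by auto
      then have "lam m * p - alm m p * lam m \<in> At" using lamA[OF m]
        by (simp add: subring_closed[OF At(1)])
      then show ?thesis using degx_less_P[of "lam m * p - alm m p * lam m" m] pos[OF m False] p At(3) by blast
    qed
    show "\<exists>u\<in>B m. regular ?S u \<and> (\<exists>b\<in>B m. u * q * x k ^ m = b * lam m)"
      if m: "m \<in> ?D" and q: "q \<in> ?S" "q * x k ^ m \<in> At" for m q
    proof (cases "m = 0")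
      case True
      then show ?thesis using q zero reg subring_one[OF sub0]
        by (intro bexI[of _ 1] conjI bexI[of _ q]) auto
    next
      case False
      then show ?thesis using pos[OF m] q by blast
    qed
    show "left_ideal ?S (ZZ {s. s < k})" by (rule Z)
    show "\<alpha> k z \<in> ZZ {s. s < k}" if "z \<in> ZZ {s. s < k}" for z
      using Z(2)[of z 1] that ZZ_SS by auto
    show "\<delta> k z = 0" if "z \<in> ZZ {s. s < k}" for z using delta_zero k that by blast
    show "sing_ideal (B m) = B m \<inter> ZZ {s. s < k}" if m: "m \<in> ?D" for m
    proof (rule sing_ideal_eq[OF dc(1) dc_sub(1)[OF k] subB[OF m] _ B[OF m]])
      show "B m \<subseteq> ?S" using BAS[OF m] by blast
      show "\<exists>a\<in>B m. a * j \<in> B m \<and> a * j \<noteq> 0" if "j \<in> R" "j \<noteq> 0" for j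
        using that RB[OF m] subring_one[OF subB[OF m]] by (intro bexI[of _ 1]) auto
    qed
  qed
qed

lemma good_special:
  assumes k: "k \<in> \<Omega>"
    and sp: "special (SS {s. s < k}) (x k) R (SS {s. s \<le> k}) At lam B alm"
    and B: "\<And>m. m \<in> Degs (SS {s. s < k}) (x k) At \<Longrightarrow> good (B m)"
  shows "good At"
proof -
  let ?D = "Degs (SS {s. s < k}) (x k) At"
  have essB: "ess_ok (B m)" and unifB: "unif_ok (B m)" if "m \<in> ?D" for m
    using B[OF that] by (auto simp: good_def)
  interpret ore_special "SS {s. s < k}" "x k" "\<alpha> k" "\<delta> k" R At ?D lam B alm "ZZ {s. s < k}"
    using k sp essB by (rule ore_special_special)
  have ess: "ess_ok At" unfolding ess_ok_def
  proof (intro allI impI ballI)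
    fix L f assume L: "essential_li R L" and f: "f \<in> At - {0}"
    have "multiple_in (B 0) f (prod_span At L)"
    proof (rule essential_step[OF essential_subset[OF L]])
      fix m p assume "m \<in> ?D" "p \<in> B m" "p \<noteq> 0"
      then show "multiple_in (B m) p (prod_span (B m) L)"
        using ess_okD[OF essB L] by blast
    qed (use f in auto)
    then show "multiple_in At f (prod_span At L)" using B_A[OF zero_D] by blast
  qed
  have unif_step: "common_multiple (B m) f g"
    if L: "uniform_li R L" and m: "m \<in> ?D" and f: "f \<in> prod_span (B m) L" "f \<noteq> 0"
      and g: "g \<in> prod_span (B m) L" "g \<noteq> 0" for L m f g
    using unif_okD[OF unifB[OF m] L B_subset[OF m uniform_subset[OF L] f(1)] f
        B_subset[OF m uniform_subset[OF L] g(1)] g] .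
  have "unif_ok At" unfolding unif_ok_def
  proof (intro allI impI)
    fix L f g assume L: "uniform_li R L" and f: "f \<in> prod_span At L" "f \<noteq> 0"
      and g: "g \<in> prod_span At L" "g \<noteq> 0"
    have LR: "L \<subseteq> R" using uniform_subset[OF L] .
    have Lli: "left_ideal R L" using L by (simp add: uniform_li_def)
    have Zli: "left_ideal R (sing_ideal R)" using left_ideal_sing_ideal[OF subR] .
    \<comment> \<open>Either no non-zero element of \<open>L\<close> is singular, or the singular
      part is a non-zero and hence uniform left ideal inside \<open>L\<close>.\<close>
    define L0 where "L0 = L \<inter> sing_ideal R"
    have L0li: "left_ideal R L0" unfolding L0_def using left_ideal_Int Lli Zli by blast
    show "common_multiple At f g"
    proof (cases "L0 = {0}")
      case True
      show ?thesis
      proof (rule uniform_step_nonsingular[OF LR unif_step[OF L] _ _ f g])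
        show "\<exists>j\<in>R. j \<noteq> 0 \<and> (\<forall>s\<in>SS {s. s < k}. s * j * a = 0 \<longrightarrow> s * j = 0)"
          if "a \<in> SS {s. s < k}" "a \<notin> ZZ {s. s < k}" for a
          using nonsingular_witness[OF dc(1) dc_sub(1)[OF k] that] by blast
        \<comment> \<open>Z(R)T lies in the extension of Z(R) to the top ring, which meets the
          extension of \<open>L\<close> trivially.\<close>
        show "y = 0" if y: "y \<in> prod_span (SS {s. s < k}) L" "y \<in> ZZ {s. s < k}" for y
        proof (rule prod_span_disjoint[OF Lli Zli])
          show "L \<inter> sing_ideal R = {0}" using True by (simp add: L0_def)
          show "y \<in> prod_span UNIV L" by (rule prod_span_mono[OF y(1)]) auto
          show "y \<in> prod_span UNIV (sing_ideal R)" using ZZ_prod_span[OF dc(1) dc_sub(1)[OF k]] y by blast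
        qed
      qed
    next
      case False
      have L0u: "uniform_li R L0" using L L0li False unfolding uniform_li_def L0_def by (meson Int_lower1 order_trans)
      have L0R: "L0 \<subseteq> R" using LR by (auto simp: L0_def)
      have L0Z: "L0 \<subseteq> ZZ {s. s < k}" using ZZ_mono[of "{}" "{s. s < k}"] ZZ_empty by (auto simp: L0_def)
      obtain C where C: "left_ideal R C" "L0 \<inter> C = {0}" "essential_li R (li_sum L0 C)"
        using essential_complement[OF subR L0li] by blast
      have LC: "L \<inter> C = {0}"
      proof (rule ccontr)
        assume ne: "L \<inter> C \<noteq> {0}"
        have "left_ideal R (L \<inter> C)" using left_ideal_Int Lli C by blast
        then have "(L \<inter> C) \<inter> L0 \<noteq> {0}" using L L0li ne False unfolding uniform_li_def L0_def
          by (meson Int_lower1)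
        moreover have "(L \<inter> C) \<inter> L0 = L0 \<inter> C" by (auto simp: L0_def)
        ultimately show False using C by simp
      qed
      \<comment> \<open>Write \<open>q * h = u + w\<close> along the essential sum of
        \<open>L0\<close> and \<open>C\<close>. Then \<open>w\<close> also lies in the span of
        \<open>L\<close>, and \<open>L \<inter> C = {0}\<close> persists after extension, so
        \<open>w = 0\<close>.\<close>
      have reduce: "multiple_in At h (prod_span At L0)" if h: "h \<in> prod_span At L" "h \<noteq> 0" for h
      proof -
        have hA: "h \<in> At" using AL_closed(3)[OF LR h(1)] .
        obtain q where q: "q \<in> At" "q * h \<noteq> 0" "q * h \<in> prod_span At (li_sum L0 C)"
          using ess_okD[OF ess C(3) hA h(2)] by blast
        obtain u w where uw: "u \<in> prod_span At L0" "w \<in> prod_span At C" "q * h = u + w"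
          using prod_span_li_sum[OF q(3)] by blast
        have "u \<in> prod_span At L" by (rule prod_span_mono[OF uw(1)]) (auto simp: L0_def)
        then have "q * h - u \<in> prod_span At L" using AL_closed(1,2)[OF LR] q h by blast
        then have "w \<in> prod_span At L" using uw(3) by simp
        then have "w \<in> prod_span UNIV L" by (rule prod_span_mono) auto
        moreover have "w \<in> prod_span UNIV C" by (rule prod_span_mono[OF uw(2)]) auto
        ultimately have "w = 0" using prod_span_disjoint[OF Lli C(1) LC] by blast
        then show ?thesis using q uw by (intro bexI[of _ q]) auto
      qed
      obtain p where p: "p \<in> At" "p * f \<noteq> 0" "p * f \<in> prod_span At L0" using reduce f by blast
      obtain q where q: "q \<in> At" "q * g \<noteq> 0" "q * g \<in> prod_span At L0" using reduce g by blast
      obtain s t where st: "s \<in> At" "t \<in> At" "s * (p * f) = t * (q * g)" "s * (p * f) \<noteq> 0"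
        using uniform_step_singular[OF L0R L0Z unif_step[OF L0u] p(3,2) q(3,2)] by blast
      have "(s * p) * f = (t * q) * g" "(s * p) * f \<noteq> 0" using st by (auto simp: mult.assoc)
      moreover have "s * p \<in> At" "t * q \<in> At" using st p q by (auto simp: A_closed)
      ultimately show ?thesis by blast
    qed
  qed
  then show ?thesis using ess nice_R_contains[OF subA RA] subA by (simp add: good_def)
qed

theorem ess_sp_good:
  assumes "ess_sp R x I A" "I \<subseteq> \<Omega>"
  shows "good A \<and> A \<subseteq> SS I"
  using assms
proof (induction rule: ess_sp.induct)
  case (zero A)
  then show ?case using good_nicely_ess[OF good_R] by (auto simp: SS_empty nicely_ess_def)
next
  case (lim I \<Lambda> Af A)
  have sub: "{s. s < j} \<subseteq> I" if "j \<in> \<Lambda>" for j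
    using that lim.hyps(2,4) unfolding down_closed_def by (blast intro: less_imp_le)
  have *: "good (Af j) \<and> Af j \<subseteq> SS {s. s < j}" if "j \<in> \<Lambda>" for j
    using lim.IH sub[OF that] that lim.prems by blast
  have "good A" unfolding lim.hyps(7) using good_Union[OF lim.hyps(5,6)] * by blast
  moreover have "A \<subseteq> SS I" unfolding lim.hyps(7) using * SS_mono[OF sub] by blast
  ultimately show ?case by blast
next
  case (succ k At lam B alm A)
  have k: "k \<in> \<Omega>" using succ.prems by auto
  have At: "good At"
    using good_special[OF k succ.hyps(1)] succ.IH dc_sub(1)[OF k] by blast
  have "R \<subseteq> At" "At \<subseteq> SS {s. s \<le> k}" using succ.hyps(1) unfolding special_def by blast+
  then show ?case using good_nicely_ess[OF At _ succ.hyps(2)] succ.hyps(2) by (auto simp: nicely_ess_def)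
qed

end

section \<open>Uniform dimension\<close>

lemma prod_span_assoc:
  assumes "y \<in> prod_span A (prod_span B C)"
  shows "y \<in> prod_span (prod_span A B) C"
  using assms
proof (induction rule: prod_span_induct)
  case zero then show ?case by (rule prod_span_zero)
next
  case (Cons a l y)
  have "a * l \<in> prod_span (prod_span A B) C" using Cons(2)
  proof (induction rule: prod_span_induct)
    case zero then show ?case by (simp add: prod_span_zero)
  next
    case (Cons b c y)
    have "(a * b) * c + a * y \<in> prod_span (prod_span A B) C"
      by (rule prod_span_Cons[OF prod_span_mem[OF \<open>a \<in> A\<close> Cons(1)] Cons(2,4)])
    then show ?case by (simp add: distrib_left mult.assoc)
  qed
  then show ?case using Cons(4) by (rule prod_span_add)
qed

lemma independent_li_subset:
  assumes "independent_li F V" "\<And>i. i \<in> F \<Longrightarrow> W i \<subseteq> V i"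
  shows "independent_li F W"
  unfolding independent_li_def
proof (intro allI impI ballI)
  fix c i assume c: "(\<forall>i\<in>F. c i \<in> W i) \<and> sum c F = 0" and i: "i \<in> F"
  show "c i = 0" by (rule independent_liD[OF assms(1) _ conjunct2[OF c] i]) (use c assms(2) in blast)
qed

lemma independent_li_index:
  assumes "independent_li F V" "bij_betw h G F"
  shows "independent_li G (\<lambda>i. V (h i))"
  unfolding independent_li_def
proof (intro allI impI ballI)
  fix c i assume c: "(\<forall>i\<in>G. c i \<in> V (h i)) \<and> sum c G = 0" and i: "i \<in> G"
  define d where "d = (\<lambda>j. c (inv_into G h j))"
  have inv: "inv_into G h (h i) = i" if "i \<in> G" for i
    using assms(2) that by (simp add: bij_betw_def)
  have "sum d F = sum (\<lambda>i. d (h i)) G" using sum.reindex_bij_betw[OF assms(2), of d] by simp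
  also have "\<dots> = sum c G" using inv by (intro sum.cong) (auto simp: d_def)
  finally have "sum d F = 0" using c by simp
  moreover have "d j \<in> V j" if j: "j \<in> F" for j
  proof -
    obtain i where "i \<in> G" "j = h i" using assms(2) j by (auto simp: bij_betw_def)
    then show ?thesis using c inv by (simp add: d_def)
  qed
  moreover have "h i \<in> F" using assms(2) i by (auto simp: bij_betw_def)
  ultimately have "d (h i) = 0" using independent_liD[OF assms(1), of d "h i"] by blast
  then show "c i = 0" using inv[OF i] by (simp add: d_def)
qed

section \<open>Finite direct sums of uniform left ideals and exchange\<close>

definition family_sum :: "'i set \<Rightarrow> ('i \<Rightarrow> 'a::ring_1 set) \<Rightarrow> 'a set" where
  "family_sum K V = {y. \<exists>c. (\<forall>k\<in>K. c k \<in> V k) \<and> y = sum c K}"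

lemma left_ideal_family_sum:
  assumes "subring A" "\<And>k. k \<in> K \<Longrightarrow> left_ideal A (V k)"
  shows "left_ideal A (family_sum K V)"
  unfolding left_ideal_def
proof (intro conjI ballI)
  show "family_sum K V \<subseteq> A"
    using left_ideal_subset[OF assms(2)] by (auto simp: family_sum_def intro!: subring_sum[OF assms(1)])
  show "0 \<in> family_sum K V" unfolding family_sum_def using left_ideal_zero[OF assms(2)]
    by (intro CollectI exI[of _ "\<lambda>_. 0"]) simp
  fix y w assume "y \<in> family_sum K V" "w \<in> family_sum K V"
  then obtain c d where cd: "\<forall>k\<in>K. c k \<in> V k" "y = sum c K" "\<forall>k\<in>K. d k \<in> V k" "w = sum d K"
    by (auto simp: family_sum_def)
  then have "y - w = sum (\<lambda>k. c k - d k) K" by (simp add: sum_subtractf)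
  moreover have "\<forall>k\<in>K. c k - d k \<in> V k" using cd left_ideal_diff[OF assms(2)] by blast
  ultimately show "y - w \<in> family_sum K V" unfolding family_sum_def by (intro CollectI exI[of _ "\<lambda>k. c k - d k"]) simp
next
  fix r y assume r: "r \<in> A" and "y \<in> family_sum K V"
  then obtain c where c: "\<forall>k\<in>K. c k \<in> V k" "y = sum c K" by (auto simp: family_sum_def)
  then have "r * y = sum (\<lambda>k. r * c k) K" by (simp add: sum_distrib_left)
  moreover have "\<forall>k\<in>K. r * c k \<in> V k" using c r left_ideal_mult[OF assms(2)] by blast
  ultimately show "r * y \<in> family_sum K V" unfolding family_sum_def by (intro CollectI exI[of _ "\<lambda>k. r * c k"]) simp
qed

lemma family_sum_member:
  assumes "finite K" "k \<in> K" "\<And>k. k \<in> K \<Longrightarrow> 0 \<in> V k" "y \<in> V k"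
  shows "y \<in> family_sum K V"
proof -
  have "sum (\<lambda>i. if i = k then y else 0) K = y" using assms by simp
  then show ?thesis unfolding family_sum_def using assms
    by (intro CollectI exI[of _ "\<lambda>i. if i = k then y else 0"]) auto
qed

lemma independent_li_insert:
  assumes K: "finite K" "k \<notin> K" and V: "\<And>i. i \<in> insert k K \<Longrightarrow> left_ideal A (V i)"
  shows "independent_li (insert k K) V \<longleftrightarrow> independent_li K V \<and> V k \<inter> family_sum K V = {0}"
proof
  assume ind: "independent_li (insert k K) V"
  have "independent_li K V" unfolding independent_li_def
  proof (intro allI impI ballI)
    fix c i assume c: "(\<forall>i\<in>K. c i \<in> V i) \<and> sum c K = 0" and i: "i \<in> K"
    have "(c(k := 0)) i = 0"
    proof (rule independent_liD[OF ind, of "c(k := 0)"])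
      show "(c(k := 0)) j \<in> V j" if "j \<in> insert k K" for j using that c left_ideal_zero[OF V] by auto
      have "sum (c(k := 0)) K = sum c K" using K by (intro sum.cong) auto
      then show "sum (c(k := 0)) (insert k K) = 0" using K c by simp
      show "i \<in> insert k K" using i by blast
    qed
    then show "c i = 0" using i K by (auto split: if_splits)
  qed
  moreover have "y = 0" if y: "y \<in> V k" "y \<in> family_sum K V" for y
  proof -
    obtain c where c: "\<forall>i\<in>K. c i \<in> V i" "y = sum c K" using y by (auto simp: family_sum_def)
    have "(c(k := - y)) k = 0"
    proof (rule independent_liD[OF ind, of "c(k := - y)"])
      show "(c(k := - y)) j \<in> V j" if "j \<in> insert k K" for j
        using that c y left_ideal_uminus[OF V] by auto
      have "sum (c(k := - y)) K = sum c K" using K by (intro sum.cong) auto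
      then show "sum (c(k := - y)) (insert k K) = 0" using K c by simp
    qed simp
    then show ?thesis by simp
  qed
  moreover have "0 \<in> V k" using left_ideal_zero[OF V] by blast
  moreover have "0 \<in> family_sum K V"
  proof -
    have "\<forall>i\<in>K. 0 \<in> V i" using left_ideal_zero[OF V] by blast
    then show ?thesis unfolding family_sum_def by (intro CollectI exI[of _ "\<lambda>_. 0"]) simp
  qed
  ultimately show "independent_li K V \<and> V k \<inter> family_sum K V = {0}" by blast
next
  assume *: "independent_li K V \<and> V k \<inter> family_sum K V = {0}"
  show "independent_li (insert k K) V" unfolding independent_li_def
  proof (intro allI impI)
    fix c assume c: "(\<forall>i\<in>insert k K. c i \<in> V i) \<and> sum c (insert k K) = 0"
    then have s: "c k + sum c K = 0" using K by simp
    then have "- c k = sum c K" by (simp add: minus_unique)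
    then have "- c k \<in> family_sum K V" unfolding family_sum_def using c by blast
    moreover have "- c k \<in> V k" using c left_ideal_uminus[OF V] by blast
    ultimately have "- c k = 0" using * by blast
    then have ck: "c k = 0" by simp
    then have "sum c K = 0" using s by simp
    then have "c i = 0" if "i \<in> K" for i using * c that independent_liD[of K V c i] by auto
    then show "\<forall>i\<in>insert k K. c i = 0" using ck by blast
  qed
qed

text \<open>Uniformity of \<open>W k\<close> provides a further multiplier \<open>p\<close> that
  takes the component \<open>s * h k\<close> into \<open>N\<close>. Independence keeps the whole
  multiple non-zero, since its component in \<open>W k\<close> still is. Once all components are
  treated, the multiple lies in \<open>N\<close>.\<close>

lemma essential_of_meets_uniform:
  assumes A: "subring A" and K: "finite K"
    and W: "\<And>k. k \<in> K \<Longrightarrow> uniform_li A (W k)" and ind: "independent_li K W"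
    and ess: "\<And>f. f \<in> A \<Longrightarrow> f \<noteq> 0 \<Longrightarrow> multiple_in A f (family_sum K W)"
    and N: "left_ideal A N" "\<And>k. k \<in> K \<Longrightarrow> W k \<inter> N \<noteq> {0}" and f: "f \<in> A" "f \<noteq> 0"
  shows "multiple_in A f N"
proof -
  have Wli: "left_ideal A (W k)" if "k \<in> K" for k using W[OF that] by (simp add: uniform_li_def)
  obtain q where q: "q \<in> A" "q * f \<noteq> 0" "q * f \<in> family_sum K W" using ess f by blast
  obtain h where h: "\<forall>k\<in>K. h k \<in> W k" "q * f = sum h K" using q(3) by (auto simp: family_sum_def)
  have "finite G \<Longrightarrow> G \<subseteq> K \<Longrightarrow> \<exists>s\<in>A. s * (q * f) \<noteq> 0 \<and> (\<forall>k\<in>G. s * h k \<in> N)" for G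
  proof (induction G rule: finite_induct)
    case empty
    then show ?case using q subring_one[OF A] by (intro bexI[of _ 1]) auto
  next
    case (insert k G)
    then obtain s where s: "s \<in> A" "s * (q * f) \<noteq> 0" "\<forall>k\<in>G. s * h k \<in> N" by auto
    have k: "k \<in> K" using insert by blast
    show ?case
    proof (cases "s * h k = 0")
      case True
      then show ?thesis using s left_ideal_zero[OF N(1)] by (intro bexI[of _ s]) auto
    next
      case False
      have "0 \<in> W k \<inter> N" using left_ideal_zero[OF N(1)] left_ideal_zero[OF Wli[OF k]] by blast
      then obtain n where n: "n \<in> W k" "n \<in> N" "n \<noteq> 0" using N(2)[OF k] by blast
      have "s * h k \<in> W k" using left_ideal_mult[OF Wli[OF k] s(1)] h(1) k by blast
      then have "s * h k \<in> W k - {0}" "n \<in> W k - {0}" using False n by auto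
      then obtain p r where pr: "p \<in> A" "r \<in> A" "p * (s * h k) = r * n" "p * (s * h k) \<noteq> 0"
        using W[OF k] unfolding uniform_li_iff[OF A] by meson
      have psA: "p * s \<in> A" using pr s by (simp add: subring_closed[OF A])
      have "p * s * h k \<in> N" using left_ideal_mult[OF N(1) pr(2) n(2)] pr(3) by (simp add: mult.assoc)
      moreover have "p * s * h i \<in> N" if "i \<in> G" for i
        using left_ideal_mult[OF N(1) pr(1), of "s * h i"] s that by (simp add: mult.assoc)
      moreover have "p * s * (q * f) \<noteq> 0"
      proof
        assume z: "p * s * (q * f) = 0"
        have "p * s * h k = 0"
        proof (rule independent_liD[OF ind, of "\<lambda>i. p * s * h i", OF _ _ k])
          show "p * s * h i \<in> W i" if "i \<in> K" for i using left_ideal_mult[OF Wli[OF that] psA] h(1) that by blast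
          show "(\<Sum>i\<in>K. p * s * h i) = 0" using z h(2) by (simp add: sum_distrib_left)
        qed
        then show False using pr(4) by (simp add: mult.assoc)
      qed
      ultimately show ?thesis using psA by (intro bexI[of _ "p * s"]) auto
    qed
  qed
  from this[OF K subset_refl] obtain s where s: "s \<in> A" "s * (q * f) \<noteq> 0" "\<forall>k\<in>K. s * h k \<in> N" by blast
  have "s * (q * f) = (\<Sum>k\<in>K. s * h k)" using h by (simp add: sum_distrib_left)
  then have "s * (q * f) \<in> N" using s left_ideal_sum[OF N(1), of K "\<lambda>k. s * h k"] by simp
  then show ?thesis using s q subring_mult[OF A] by (intro bexI[of _ "s * q"]) (auto simp: mult.assoc)
qed

text \<open>Steinitz exchange: the summands indexed by \<open>I\<close> are traded one at a time for uniform summands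
  indexed by \<open>K\<close>.\<close>

lemma independent_card_le:
  fixes W :: "'k \<Rightarrow> 'a::ring_1 set" and M :: "'i \<Rightarrow> 'a set"
  assumes A: "subring A" and K: "finite K"
    and W: "\<And>k. k \<in> K \<Longrightarrow> uniform_li A (W k)" and ind: "independent_li K W"
    and ess: "\<And>f. f \<in> A \<Longrightarrow> f \<noteq> 0 \<Longrightarrow> multiple_in A f (family_sum K W)"
    and I: "finite I" "\<And>i. i \<in> I \<Longrightarrow> left_ideal A (M i) \<and> M i \<noteq> {0}" "independent_li I M"
  shows "card I \<le> card K"
proof -
  \<comment> \<open>The sum type keeps the two families apart, even when an ideal occurs in
    both.\<close>
  define V where "V = case_sum M W"
  have Wli: "left_ideal A (W k)" if "k \<in> K" for k using W[OF that] by (simp add: uniform_li_def)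
  have Vli: "left_ideal A (V j)" if "j \<in> Inl ` I \<union> Inr ` K" for j
    using that I(2) Wli by (auto simp: V_def)
  have "finite J \<Longrightarrow> J \<subseteq> I \<Longrightarrow>
    \<exists>Y\<subseteq>K. card Y = card J \<and> independent_li (Inl ` (I - J) \<union> Inr ` Y) V" for J
  proof (induction J rule: finite_induct)
    case empty
    have "independent_li (Inl ` I) V" unfolding independent_li_def
    proof (intro allI impI ballI)
      fix c :: "'i + 'k \<Rightarrow> 'a" and j :: "'i + 'k"
      assume c: "(\<forall>i\<in>Inl ` I. c i \<in> V i) \<and> sum c (Inl ` I) = 0" and "j \<in> Inl ` I"
      then obtain i where i: "j = Inl i" "i \<in> I" by blast
      have "sum (\<lambda>i. c (Inl i)) I = 0" using c by (simp add: sum.reindex)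
      then have "c (Inl i) = 0" using c independent_liD[OF I(3), of "\<lambda>i. c (Inl i)" i] i(2) by (auto simp: V_def)
      then show "c j = 0" using i by simp
    qed
    then show ?case by (intro exI[of _ "{}"]) auto
  next
    case (insert i J)
    then obtain Y where Y: "Y \<subseteq> K" "card Y = card J" "independent_li (Inl ` (I - J) \<union> Inr ` Y) V" by auto
    define T where "T = Inl ` (I - insert i J) \<union> Inr ` Y"
    have finT: "finite T" unfolding T_def using I(1) K Y(1) finite_subset by auto
    have eq: "Inl ` (I - J) \<union> Inr ` Y = insert (Inl i) T" using insert by (auto simp: T_def)
    have iT: "Inl i \<notin> T" by (auto simp: T_def)
    have Tsub: "T \<subseteq> Inl ` I \<union> Inr ` K" using Y(1) by (auto simp: T_def)
    have iI: "i \<in> I" using insert by blast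
    have VT: "left_ideal A (V j)" if "j \<in> insert (Inl i) T" for j using that Tsub iI Vli by blast
    have split: "independent_li T V" "V (Inl i) \<inter> family_sum T V = {0}"
      using Y(3) independent_li_insert[OF finT iT VT] unfolding eq by auto
    define N where "N = family_sum T V"
    have Nli: "left_ideal A N" unfolding N_def by (rule left_ideal_family_sum[OF A]) (use VT in blast)
    \<comment> \<open>Otherwise \<open>N\<close> would be essential and meet \<open>M i\<close>,
      against the independence of \<open>M i\<close> from the remaining summands.\<close>
    have "\<exists>k\<in>K. W k \<inter> N = {0}"
    proof (rule ccontr)
      assume no: "\<not> ?thesis"
      have "0 \<in> M i" using left_ideal_zero I(2)[OF iI] by blast
      then obtain f where f: "f \<in> M i" "f \<noteq> 0" using I(2)[OF iI] by blast
      have fA: "f \<in> A" using f I(2)[OF iI] left_ideal_subset by blast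
      have "multiple_in A f N"
        by (rule essential_of_meets_uniform[OF A K W ind ess Nli _ fA f(2)]) (use no in blast)+
      then obtain q where q: "q \<in> A" "q * f \<noteq> 0" "q * f \<in> N" by blast
      have "q * f \<in> V (Inl i)" using left_ideal_mult[of A "M i" q f] I(2)[OF iI] q f by (simp add: V_def)
      then show False using split(2) q by (auto simp: N_def)
    qed
    then obtain k where k: "k \<in> K" "W k \<inter> N = {0}" by blast
    have kT: "Inr k \<notin> T"
    proof
      assume kT: "Inr k \<in> T"
      have "W k \<subseteq> N"
      proof
        fix y assume "y \<in> W k"
        then show "y \<in> N" unfolding N_def using left_ideal_zero[OF VT]
          by (intro family_sum_member[OF finT kT]) (auto simp: V_def)
      qed
      then show False using k W[OF k(1)] by (auto simp: uniform_li_def)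
    qed
    have Vk: "left_ideal A (V j)" if "j \<in> insert (Inr k) T" for j using that Tsub k Vli by blast
    have "independent_li (insert (Inr k) T) V"
      using independent_li_insert[OF finT kT Vk] split(1) k(2) by (simp add: V_def N_def)
    moreover have "insert (Inr k) T = Inl ` (I - insert i J) \<union> Inr ` (insert k Y)" by (auto simp: T_def)
    moreover have "k \<notin> Y" using kT by (auto simp: T_def)
    then have "card (insert k Y) = card (insert i J)"
      using Y K insert by (simp add: finite_subset)
    ultimately show ?case using k Y by (intro exI[of _ "insert k Y"]) auto
  qed
  from this[OF I(1) subset_refl] obtain Y where "Y \<subseteq> K" "card Y = card I" by blast
  then show ?thesis using card_mono[OF K] by metis
qed

text \<open>Choose \<open>s\<close> with \<open>s * m\<close> non-zero and as few non-zero
  components as possible. Then a multiple of \<open>s * m\<close> vanishes as soon as its component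
  in one chosen \<open>W k\<close> does, so \<open>principal A (s * m)\<close> embeds into a uniform
  left ideal.\<close>

lemma uniform_in_family_sum:
  assumes A: "subring A" and K: "finite K"
    and W: "\<And>k. k \<in> K \<Longrightarrow> uniform_li A (W k)" and ind: "independent_li K W"
    and m: "m \<in> family_sum K W" "m \<noteq> 0"
  shows "\<exists>s\<in>A. uniform_li A (principal A (s * m))"
proof -
  have Wli: "left_ideal A (W k)" if "k \<in> K" for k using W[OF that] by (simp add: uniform_li_def)
  obtain h where h: "\<forall>k\<in>K. h k \<in> W k" "m = sum h K" using m by (auto simp: family_sum_def)
  define supp where "supp s = {k \<in> K. s * h k \<noteq> 0}" for s
  have finS: "finite (supp s)" for s using K by (simp add: supp_def)
  have sm: "s * m = (\<Sum>k\<in>K. s * h k)" for s using h by (simp add: sum_distrib_left)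
  have zero_iff: "s * m = 0 \<longleftrightarrow> supp s = {}" if "s \<in> A" for s
  proof
    assume z: "s * m = 0"
    have "s * h k = 0" if "k \<in> K" for k
    proof (rule independent_liD[OF ind, of "\<lambda>i. s * h i", OF _ _ that])
      show "s * h i \<in> W i" if "i \<in> K" for i using left_ideal_mult[OF Wli[OF that] \<open>s \<in> A\<close>] h that by blast
      show "(\<Sum>i\<in>K. s * h i) = 0" using z sm by simp
    qed
    then show "supp s = {}" by (auto simp: supp_def)
  next
    assume "supp s = {}"
    then show "s * m = 0" unfolding sm by (intro sum.neutral) (auto simp: supp_def)
  qed
  have "\<exists>s. s \<in> A \<and> s * m \<noteq> 0" using subring_one[OF A] m by (intro exI[of _ 1]) auto
  then obtain s where s: "s \<in> A" "s * m \<noteq> 0"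
    and min: "\<And>t. t \<in> A \<Longrightarrow> t * m \<noteq> 0 \<Longrightarrow> card (supp s) \<le> card (supp t)"
    using ex_has_least_nat[of "\<lambda>s. s \<in> A \<and> s * m \<noteq> 0" _ "\<lambda>s. card (supp s)"] by blast
  obtain k where k: "k \<in> K" "s * h k \<noteq> 0" using zero_iff s by (auto simp: supp_def)
  have mA: "m \<in> A" using left_ideal_subset[OF left_ideal_family_sum[OF A Wli] m(1)] by blast
  have smA: "s * m \<in> A" using s mA by (simp add: subring_closed[OF A])
  have drop: "d * s * m = 0" if d: "d \<in> A" "d * s * h k = 0" for d
  proof (rule ccontr)
    assume ne: "d * s * m \<noteq> 0"
    have "d * s \<in> A" using d s by (simp add: subring_closed[OF A])
    then have le: "card (supp s) \<le> card (supp (d * s))" using min ne by blast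
    have "supp (d * s) \<subset> supp s"
    proof (rule psubsetI)
      show "supp (d * s) \<subseteq> supp s" by (auto simp: supp_def mult.assoc)
      have "k \<in> supp s" "k \<notin> supp (d * s)" using k d by (auto simp: supp_def)
      then show "supp (d * s) \<noteq> supp s" by blast
    qed
    then show False using psubset_card_mono[OF finS] le by (meson leD)
  qed
  have "uniform_li A (principal A (s * m))" unfolding uniform_li_iff[OF A]
  proof (intro conjI ballI)
    show "left_ideal A (principal A (s * m))" by (rule left_ideal_principal[OF A smA])
    show "principal A (s * m) \<noteq> {0}" using self_in_principal[OF A, of "s * m"] s by blast
    fix f g assume "f \<in> principal A (s * m) - {0}" "g \<in> principal A (s * m) - {0}"
    then obtain a b where ab: "a \<in> A" "f = a * (s * m)" "b \<in> A" "g = b * (s * m)" "f \<noteq> 0" "g \<noteq> 0" by blast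
    have "a * s * h k \<noteq> 0" "b * s * h k \<noteq> 0" using drop ab by (auto simp: mult.assoc)
    moreover have "a * s * h k \<in> W k" "b * s * h k \<in> W k"
      using left_ideal_mult[OF Wli[OF k(1)], of _ "h k"] h(1) k ab s by (auto simp: subring_closed[OF A])
    ultimately have "a * s * h k \<in> W k - {0}" "b * s * h k \<in> W k - {0}" by auto
    then obtain p q where pq: "p \<in> A" "q \<in> A" "p * (a * s * h k) = q * (b * s * h k)" "p * (a * s * h k) \<noteq> 0"
      using W[OF k(1)] unfolding uniform_li_iff[OF A] by meson
    have "(p * a - q * b) * s * m = 0"
      using pq ab by (intro drop) (auto simp: subring_closed[OF A] left_diff_distrib mult.assoc)
    then have "p * f = q * g" using ab by (simp add: left_diff_distrib mult.assoc)
    moreover have "p * f \<noteq> 0"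
    proof -
      have "p * a * s \<in> A" using pq ab s by (simp add: subring_closed[OF A])
      moreover have "k \<in> supp (p * a * s)" using k pq by (auto simp: supp_def mult.assoc)
      ultimately have "p * a * s * m \<noteq> 0" using zero_iff by blast
      then show ?thesis using ab by (simp add: mult.assoc)
    qed
    ultimately show "common_multiple A f g" using pq by blast
  qed
  then show ?thesis using s by blast
qed

lemma uniform_li_subset:
  "uniform_li A U \<Longrightarrow> left_ideal A V \<Longrightarrow> V \<noteq> {0} \<Longrightarrow> V \<subseteq> U \<Longrightarrow> uniform_li A V"
  unfolding uniform_li_def by (meson order_trans)

text \<open>The family is indexed by generators rather than ideals, so that its sum is
  \<open>prod_span R X\<close>. If the sum were not essential at \<open>f\<close>, a uniform left
  ideal inside \<open>principal R f\<close> would contain a generator \<open>u\<close> by which the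
  maximal \<open>X\<close> could be enlarged.\<close>

lemma maximal_independent_uniform:
  assumes R: "subring R" and enough: "enough_uniform R"
  shows "\<exists>X\<subseteq>R. (\<forall>y\<in>X. uniform_li R (principal R y)) \<and>
    (\<forall>F. finite F \<longrightarrow> F \<subseteq> X \<longrightarrow> independent_li F (\<lambda>y. principal R y)) \<and> essential_li R (prod_span R X)"
proof -
  define pr where "pr y = principal R y" for y
  define ok where "ok X \<longleftrightarrow> X \<subseteq> R \<and> (\<forall>y\<in>X. uniform_li R (pr y)) \<and>
    (\<forall>F. finite F \<longrightarrow> F \<subseteq> X \<longrightarrow> independent_li F pr)" for X
  have prli: "left_ideal R (pr y)" if "y \<in> R" for y unfolding pr_def by (rule left_ideal_principal[OF R that])
  have "ok {}" by (auto simp: ok_def independent_li_def)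
  then have "{X. ok X} \<noteq> {}" by blast
  moreover have "\<Union>\<C> \<in> {X. ok X}" if C: "\<C> \<noteq> {}" "subset.chain {X. ok X} \<C>" for \<C>
  proof -
    have mem: "ok X" if "X \<in> \<C>" for X using C(2) that by (auto simp: subset_chain_def)
    have "independent_li F pr" if F: "finite F" "F \<subseteq> \<Union>\<C>" for F
    proof -
      obtain X where "X \<in> \<C>" "F \<subseteq> X" using finite_subset_Union_chain[OF F C] by blast
      then show ?thesis using mem F by (auto simp: ok_def)
    qed
    moreover have "\<Union>\<C> \<subseteq> R" "\<forall>y\<in>\<Union>\<C>. uniform_li R (pr y)" using mem by (auto simp: ok_def)
    ultimately show ?thesis by (simp add: ok_def)
  qed
  ultimately obtain X where X: "ok X" "\<forall>Y. ok Y \<longrightarrow> X \<subseteq> Y \<longrightarrow> Y = X"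
    using subset_Zorn_nonempty[of "{X. ok X}"] by blast
  have XR: "X \<subseteq> R" using X by (simp add: ok_def)
  have Xind: "independent_li F pr" if "finite F" "F \<subseteq> X" for F using X(1) that unfolding ok_def by blast
  define L where "L = prod_span R X"
  have L: "left_ideal R L" unfolding L_def by (rule left_ideal_prod_span[OF R XR])
  have "multiple_in R f L" if f: "f \<in> R - {0}" for f
  proof (rule ccontr)
    assume no: "\<not> ?thesis"
    have fR: "f \<in> R" using f by blast
    have "pr f \<noteq> {0}" using self_in_principal[OF R, of f] f by (auto simp: pr_def)
    then obtain U where U: "U \<subseteq> pr f" "uniform_li R U" using enough prli[OF fR] unfolding enough_uniform_def by blast
    have Uli: "left_ideal R U" using U by (simp add: uniform_li_def)
    obtain u where u: "u \<in> U" "u \<noteq> 0" using U left_ideal_zero[OF Uli] unfolding uniform_li_def by blast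
    have uR: "u \<in> R" using u left_ideal_subset[OF Uli] by blast
    have pu: "pr u \<subseteq> U" using left_ideal_mult[OF Uli] u by (auto simp: pr_def)
    have "pr u \<noteq> {0}" using self_in_principal[OF R, of u] u by (auto simp: pr_def)
    then have uu: "uniform_li R (pr u)" using uniform_li_subset[OF U(2) prli[OF uR] _ pu] by blast
    have disj: "y = 0" if y: "y \<in> pr u" "y \<in> L" for y
    proof -
      obtain r where "r \<in> R" "y = r * f" using y pu U(1) by (auto simp: pr_def)
      then show ?thesis using no y by blast
    qed
    have "ok (insert u X)" unfolding ok_def
    proof (intro conjI allI impI)
      show "insert u X \<subseteq> R" using XR uR by blast
      show "\<forall>y\<in>insert u X. uniform_li R (pr y)" using uu X by (auto simp: ok_def)
      fix F assume F: "finite F" "F \<subseteq> insert u X"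
      show "independent_li F pr"
      proof (cases "u \<in> F")
        case False
        then have "F \<subseteq> X" using F by blast
        then show ?thesis using Xind F(1) by blast
      next
        case True
        define G where "G = F - {u}"
        have G: "finite G" "u \<notin> G" "F = insert u G" "G \<subseteq> X" using F True by (auto simp: G_def)
        have li: "left_ideal R (pr i)" if "i \<in> insert u G" for i using that G XR uR prli by blast
        have indG: "independent_li G pr" using Xind G by blast
        have "family_sum G pr \<subseteq> L"
        proof
          fix y assume "y \<in> family_sum G pr"
          then obtain c where c: "\<forall>k\<in>G. c k \<in> pr k" "y = sum c G" by (auto simp: family_sum_def)
          have "c k \<in> L" if k: "k \<in> G" for k
          proof -
            obtain r where r: "r \<in> R" "c k = r * k" using c k by (auto simp: pr_def)
            have "k \<in> X" using k G(4) by blast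
            then show ?thesis unfolding L_def r(2) using r(1) by (intro prod_span_mem)
          qed
          then show "y \<in> L" unfolding c(2) by (intro left_ideal_sum[OF L])
        qed
        then have "pr u \<inter> family_sum G pr \<subseteq> {0}" using disj by blast
        moreover have "0 \<in> pr u" using left_ideal_zero prli uR by blast
        moreover have "0 \<in> family_sum G pr" using left_ideal_zero[OF left_ideal_family_sum[OF R]] li by blast
        ultimately have "pr u \<inter> family_sum G pr = {0}" by blast
        then show ?thesis using independent_li_insert[OF G(1,2) li] indG G(3) by simp
      qed
    qed
    then have "u \<in> X" using X(2) by blast
    then have "1 * u \<in> L" unfolding L_def using subring_one[OF R] by (intro prod_span_mem)
    then show False using disj[of u] self_in_principal[OF R, of u] u by (simp add: pr_def)
  qed
  then have "essential_li R L" using L essential_li_iff[OF R] by blast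
  then show ?thesis using X(1) unfolding ok_def L_def pr_def by blast
qed

definition indep_size :: "'a::ring_1 set \<Rightarrow> nat \<Rightarrow> bool" where
  "indep_size A n \<longleftrightarrow> (\<exists>Ls :: nat \<Rightarrow> 'a set. (\<forall>i<n. left_ideal A (Ls i) \<and> Ls i \<noteq> {0}) \<and> independent_li {..<n} Ls)"

lemma udim_eq: "udim A = Sup {enat n | n. indep_size A n}"
  unfolding udim_def indep_size_def independent_li_def Ball_def lessThan_iff ..

section \<open>Transfer from \<open>R\<close> to a good subring\<close>

context skew
begin

context
  fixes A assumes good: "good A"
begin

lemma subA: "subring A" and essA: "ess_ok A" and unifA: "unif_ok A" and niceA: "nice_R A"
  using good by (auto simp: good_def)

lemma mult_into_A:
  assumes "j \<in> R" "j \<noteq> 0"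
  shows "\<exists>a\<in>A. a * j \<in> A \<and> a * j \<noteq> 0"
proof -
  have "1 * j \<in> prod_span A R" using assms subring_one[OF subA] by (intro prod_span_mem)
  then show ?thesis using nice_RD[OF niceA, of "{j}"] assms by auto
qed

lemma AL_nonzero:
  assumes "left_ideal R L" "L \<noteq> {0}"
  shows "A \<inter> prod_span A L \<noteq> {0}"
proof -
  obtain l where l: "l \<in> L" "l \<noteq> 0" using assms left_ideal_zero[OF assms(1)] by blast
  then obtain a where "a \<in> A" "a * l \<in> A" "a * l \<noteq> 0"
    using mult_into_A left_ideal_subset[OF assms(1)] by blast
  then show ?thesis using prod_span_mem[of a A l L] l by blast
qed

lemma uniform_AL:
  assumes "uniform_li R L"
  shows "uniform_li A (A \<inter> prod_span A L)"
proof -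
  have "left_ideal R L" "L \<noteq> {0}" using assms by (auto simp: uniform_li_def)
  then show ?thesis unfolding uniform_li_iff[OF subA]
    using left_ideal_Int_prod_span[OF subA] AL_nonzero unif_okD[OF unifA assms] by auto
qed

lemma essential_AL:
  assumes "essential_li R L"
  shows "essential_li A (A \<inter> prod_span A L)"
  unfolding essential_li_iff[OF subA]
proof (intro conjI ballI)
  show "left_ideal A (A \<inter> prod_span A L)" by (rule left_ideal_Int_prod_span[OF subA])
  fix f assume "f \<in> A - {0}"
  then obtain q where "q \<in> A" "q * f \<noteq> 0" "q * f \<in> prod_span A L" "f \<in> A"
    using ess_okD[OF essA assms] by blast
  then show "multiple_in A f (A \<inter> prod_span A L)"
    using subring_mult[OF subA] by (intro bexI[of _ q]) auto
qed

lemma independent_AL: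
  assumes "finite F" "\<And>i. i \<in> F \<Longrightarrow> left_ideal R (L i)" "independent_li F L"
  shows "independent_li F (\<lambda>i. A \<inter> prod_span A (L i))"
proof (rule independent_li_subset[OF independent_extend[OF assms]])
  show "A \<inter> prod_span A (L i) \<subseteq> prod_span UNIV (L i)" for i
    using prod_span_mono[of _ A "L i" UNIV "L i"] by blast
qed

text \<open>Reassociating gives the generators in \<open>X\<close> coefficients in the span of
  \<open>R\<close> over \<open>A\<close>, but the single terms may lie outside \<open>A\<close>.
  \<open>nice_R\<close> supplies one multiplier that puts them all into \<open>A\<close>.\<close>

lemma essential_decomposition:
  assumes XR: "X \<subseteq> R" and ess: "essential_li R (prod_span R X)" and f: "f \<in> A" "f \<noteq> 0"
  shows "\<exists>q\<in>A. \<exists>F. finite F \<and> F \<subseteq> X \<and> q * f \<noteq> 0 \<and>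
    q * f \<in> family_sum F (\<lambda>y. A \<inter> prod_span A (principal R y))"
proof -
  obtain q where q: "q \<in> A" "q * f \<noteq> 0" "q * f \<in> prod_span A (prod_span R X)"
    using ess_okD[OF essA ess f] by blast
  have "q * f \<in> prod_span (prod_span A R) X" using prod_span_assoc[OF q(3)] .
  then have "q * f \<in> lin_comb (prod_span A R) X"
    using lin_comb_eq_prod_span[OF prod_span_zero prod_span_add, of A R X] by simp
  then obtain F c where F: "finite F" "F \<subseteq> X" "\<forall>t\<in>F. c t \<in> prod_span A R" "q * f = (\<Sum>t\<in>F. c t * t)"
    unfolding lin_comb_def by blast
  have RR: "y * t \<in> prod_span A R" if "y \<in> prod_span A R" "t \<in> X" for y t using that(1)
  proof (induction rule: prod_span_induct)
    case zero then show ?case by (simp add: prod_span_zero)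
  next
    case (Cons a l y)
    have "l * t \<in> R" using Cons that(2) XR by (auto simp: R_closed)
    then have "a * (l * t) + y * t \<in> prod_span A R" using Cons by (intro prod_span_Cons)
    then show ?case by (simp add: distrib_right mult.assoc)
  qed
  have Rt: "y * t \<in> prod_span A (principal R t)" if "y \<in> prod_span A R" for y t using that
  proof (induction rule: prod_span_induct)
    case zero then show ?case by (simp add: prod_span_zero)
  next
    case (Cons a l y)
    then have "a * (l * t) + y * t \<in> prod_span A (principal R t)" by (intro prod_span_Cons) auto
    then show ?case by (simp add: distrib_right mult.assoc)
  qed
  \<comment> \<open>\<open>q * f\<close> is included so that the multiplier keeps it non-zero; zero
    terms are removed, as \<open>nice_R\<close> speaks of non-zero elements.\<close>
  define E where "E = insert (q * f) ((\<lambda>t. c t * t) ` F) - {0}"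
  have "q * f \<in> A" using q f subring_mult[OF subA] by blast
  then have "q * f * 1 \<in> prod_span A R" by (intro prod_span_mem) (auto simp: R_closed)
  then have "E \<subseteq> prod_span A R - {0}" using RR F by (auto simp: E_def)
  moreover have "finite E" using F by (simp add: E_def)
  ultimately obtain a where a: "a \<in> A" "\<forall>y\<in>E. a * y \<noteq> 0 \<and> a * y \<in> A" using nice_RD[OF niceA] by blast
  have "a * (c t * t) \<in> A \<inter> prod_span A (principal R t)" if t: "t \<in> F" for t
  proof
    show "a * (c t * t) \<in> A"
    proof (cases "c t * t = 0")
      case True then show ?thesis using subring_zero[OF subA] by (simp only: True mult_zero_right)
    next
      case False
      then have "c t * t \<in> E" using t by (auto simp: E_def)
      then show ?thesis using a by blast
    qed
    have "c t * t \<in> prod_span A (principal R t)" using Rt F t by blast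
    then show "a * (c t * t) \<in> prod_span A (principal R t)"
      by (rule prod_span_mult_left) (use a subring_mult[OF subA] in auto)
  qed
  moreover have "a * q * f = (\<Sum>t\<in>F. a * (c t * t))" using F(4) by (simp add: mult.assoc sum_distrib_left)
  ultimately have "a * q * f \<in> family_sum F (\<lambda>y. A \<inter> prod_span A (principal R y))"
    unfolding family_sum_def by (intro CollectI exI[of _ "\<lambda>t. a * (c t * t)"]) auto
  moreover have "q * f \<in> E" using q by (simp add: E_def)
  then have "a * q * f \<noteq> 0" using a by (auto simp: mult.assoc)
  moreover have "a * q \<in> A" using a q subring_mult[OF subA] by blast
  ultimately show ?thesis using F by blast
qed

theorem enough_uniform_and_udim:
  assumes enough: "enough_uniform R"
  shows "enough_uniform A" "udim A = udim R"
proof -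
  obtain X where X: "X \<subseteq> R" "\<forall>y\<in>X. uniform_li R (principal R y)"
    "\<And>F. finite F \<Longrightarrow> F \<subseteq> X \<Longrightarrow> independent_li F (\<lambda>y. principal R y)" "essential_li R (prod_span R X)"
    using maximal_independent_uniform[OF subR enough] by blast
  define pr where "pr y = principal R y" for y
  define W where "W y = A \<inter> prod_span A (pr y)" for y
  have prli: "left_ideal R (pr y)" if "y \<in> X" for y
    using X(2) that by (simp add: pr_def uniform_li_def)
  have Wu: "uniform_li A (W y)" if "y \<in> X" for y
    unfolding W_def pr_def using uniform_AL X(2) that by blast
  have Wind: "independent_li F W" if "finite F" "F \<subseteq> X" for F
  proof -
    have "independent_li F pr" using X(3)[OF that] unfolding pr_def .
    moreover have "left_ideal R (pr i)" if "i \<in> F" for i using prli that \<open>F \<subseteq> X\<close> by blast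
    ultimately show ?thesis unfolding W_def using independent_AL[OF that(1), of pr] by blast
  qed
  have dec: "\<exists>q\<in>A. \<exists>F. finite F \<and> F \<subseteq> X \<and> q * f \<noteq> 0 \<and> q * f \<in> family_sum F W" if "f \<in> A" "f \<noteq> 0" for f
    using essential_decomposition[OF X(1,4) that] unfolding W_def pr_def .
  show "enough_uniform A" unfolding enough_uniform_def
  proof (intro allI impI)
    fix M assume M: "left_ideal A M \<and> M \<noteq> {0}"
    then obtain f where f: "f \<in> M" "f \<noteq> 0" using left_ideal_zero by blast
    then have "f \<in> A" using M left_ideal_subset by blast
    then obtain q F where q: "q \<in> A" "finite F" "F \<subseteq> X" "q * f \<noteq> 0" "q * f \<in> family_sum F W"
      using dec f(2) by blast
    have Wu': "uniform_li A (W y)" if "y \<in> F" for y using Wu q that by blast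
    obtain s where s: "s \<in> A" "uniform_li A (principal A (s * (q * f)))"
      using uniform_in_family_sum[OF subA q(2) Wu' Wind[OF q(2,3)] q(5,4)] by blast
    have "s * (q * f) \<in> M" using M f s q left_ideal_mult by blast
    then have "principal A (s * (q * f)) \<subseteq> M" using M left_ideal_mult by blast
    then show "\<exists>U\<subseteq>M. uniform_li A U" using s by blast
  qed
  have "indep_size A n \<longleftrightarrow> indep_size R n" for n
  proof
    assume "indep_size R n"
    then obtain Ls where Ls: "\<forall>i<n. left_ideal R (Ls i) \<and> Ls i \<noteq> {0}" "independent_li {..<n} Ls"
      by (auto simp: indep_size_def)
    have "independent_li {..<n} (\<lambda>i. A \<inter> prod_span A (Ls i))" using Ls by (intro independent_AL) auto
    moreover have "\<forall>i<n. left_ideal A (A \<inter> prod_span A (Ls i)) \<and> A \<inter> prod_span A (Ls i) \<noteq> {0}"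
      using Ls AL_nonzero left_ideal_Int_prod_span[OF subA] by blast
    ultimately show "indep_size A n" unfolding indep_size_def
      by (intro exI[of _ "\<lambda>i. A \<inter> prod_span A (Ls i)"]) blast
  next
    assume "indep_size A n"
    then obtain Ms where Ms: "\<forall>i<n. left_ideal A (Ms i) \<and> Ms i \<noteq> {0}" "independent_li {..<n} Ms"
      by (auto simp: indep_size_def)
    \<comment> \<open>An infinite \<open>X\<close> offers independent families of every size. A
      finite \<open>X\<close> gives an essential sum of finitely many uniform left ideals of
      \<open>A\<close>, and exchange bounds \<open>n\<close> by its size.\<close>
    have "\<exists>F\<subseteq>X. finite F \<and> card F = n"
    proof (cases "finite X")
      case False
      then show ?thesis using infinite_arbitrarily_large by blast
    next
      case True
      have "card {..<n} \<le> card X"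
      proof (rule independent_card_le[OF subA True Wu Wind[OF True subset_refl]])
        fix f assume f: "f \<in> A" "f \<noteq> 0"
        then obtain q F where q: "q \<in> A" "finite F" "F \<subseteq> X" "q * f \<noteq> 0" "q * f \<in> family_sum F W"
          using dec by blast
        have Wli: "left_ideal A (W y)" if "y \<in> X" for y using Wu[OF that] by (simp add: uniform_li_def)
        obtain c where c: "\<forall>k\<in>F. c k \<in> W k" "q * f = sum c F" using q(5) by (auto simp: family_sum_def)
        have "c k \<in> family_sum X W" if "k \<in> F" for k
        proof (rule family_sum_member[OF True, of k])
          show "k \<in> X" using that q by blast
          show "0 \<in> W y" if "y \<in> X" for y using left_ideal_zero[OF Wli[OF that]] .
          show "c k \<in> W k" using c that by blast
        qed
        then have "q * f \<in> family_sum X W" unfolding c(2)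
          using left_ideal_family_sum[OF subA Wli] by (intro left_ideal_sum) auto
        then show "multiple_in A f (family_sum X W)" using q by blast
      next
        show "finite {..<n}" by simp
        show "left_ideal A (Ms i) \<and> Ms i \<noteq> {0}" if "i \<in> {..<n}" for i using Ms that by auto
        show "independent_li {..<n} Ms" by (fact Ms)
      qed
      then show ?thesis using obtain_subset_with_card_n[of n X] finite_subset[OF _ True] by (metis card_lessThan)
    qed
    then obtain F where F: "F \<subseteq> X" "finite F" "card F = n" by blast
    then obtain h where h: "bij_betw h {..<n} F" using ex_bij_betw_nat_finite[of F] by (auto simp: atLeast0LessThan)
    have "independent_li {..<n} (\<lambda>i. pr (h i))"
      using independent_li_index[OF X(3)[OF F(2,1)] h] by (simp add: pr_def)
    moreover have "\<forall>i<n. left_ideal R (pr (h i)) \<and> pr (h i) \<noteq> {0}"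
    proof (intro allI impI)
      fix i assume "i < n"
      then have "h i \<in> X" using h F by (auto simp: bij_betw_def)
      then have "uniform_li R (pr (h i))" using X(2) by (simp add: pr_def)
      then show "left_ideal R (pr (h i)) \<and> pr (h i) \<noteq> {0}" by (simp add: uniform_li_def)
    qed
    ultimately show "indep_size R n" unfolding indep_size_def by (intro exI[of _ "\<lambda>i. pr (h i)"]) blast
  qed
  then show "udim A = udim R" by (simp add: udim_eq)
qed

end

end

text \<open>Breaks a circle: that \<open>R\<close> is a subring follows from \<open>S_sub\<close> at
  the empty segment once that stage is known to be \<open>R\<close>, which in turn needs
  \<open>0 \<in> R\<close>, as the empty combination is \<open>0\<close>. In the successor case the
  degree set is non-empty, so the induction hypothesis applies to some \<open>B m\<close>.\<close>

lemma ess_sp_zero: "ess_sp R x I A \<Longrightarrow> 0 \<in> R"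
proof (induction rule: ess_sp.induct)
  case (zero A)
  then show ?case using subring_zero by (auto simp: nicely_ess_def)
next
  case (lim I \<Lambda> Af A)
  obtain j where "j \<in> \<Lambda>" using lim.hyps(5) by blast
  then show ?case using lim.IH by blast
next
  case (succ k At lam B alm A)
  have "Degs (Sk R x {s. s < k}) (x k) At = {dA (Sk R x {s. s < k}) (x k) At * n | n. True}"
    using succ.hyps(1) unfolding special_def by blast
  then obtain m where "m \<in> Degs (Sk R x {s. s < k}) (x k) At" by blast
  then show ?case using succ.IH by blast
qed

theorem mainTheorem16:
  fixes R :: "'a::ring_1 set" and x :: "'v::wellorder \<Rightarrow> 'a" and \<Omega> :: "'v set"
    and \<alpha> \<delta> :: "'v \<Rightarrow> 'a \<Rightarrow> 'a" and A :: "'a set"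
  assumes Omega: "down_closed \<Omega>"
    and S_top: "Sk R x \<Omega> = UNIV"
    and S_sub: "\<forall>I. down_closed I \<and> I \<subseteq> \<Omega> \<longrightarrow> subring (Sk R x I)"
    and S_free: "\<forall>I. down_closed I \<and> I \<subseteq> \<Omega> \<longrightarrow> lin_indep R (std_terms x I)"
    and S_ore: "\<forall>k\<in>\<Omega>. ore_ext (Sk R x {s. s < k}) (x k) (Sk R x {s. s \<le> k}) (\<alpha> k) (\<delta> k)"
    and delta_zero: "\<forall>k\<in>\<Omega>. \<forall>p\<in>ZT R x {s. s < k}. \<delta> k p = 0"
    and ess: "ess_sp R x \<Omega> A"
  shows "(\<forall>L. uniform_li R L \<longrightarrow> uniform_li A (A \<inter> prod_span A L))
       \<and> (\<forall>L. essential_li R L \<longrightarrow> essential_li A (A \<inter> prod_span A L))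
       \<and> sing_ideal A = A \<inter> ZT R x \<Omega>
       \<and> (enough_uniform R \<longrightarrow> enough_uniform A \<and> udim A = udim R)"
proof -
  have R: "Sk R x {} = R"
  proof (intro equalityI subsetI)
    fix y assume "y \<in> Sk R x {}"
    then obtain F c where F: "F \<subseteq> {1::'a}" "\<forall>t\<in>F. c t \<in> R" "y = (\<Sum>t\<in>F. c t * t)"
      by (auto simp: Sk_def lin_comb_def std_terms_def)
    then show "y \<in> R" using ess_sp_zero[OF ess] by (auto simp: subset_singleton_iff)
  next
    fix y assume "y \<in> R"
    then show "y \<in> Sk R x {}" unfolding Sk_def lin_comb_def
      by (intro CollectI exI[of _ "{1}"] exI[of _ "\<lambda>_. y"]) (simp add: std_terms_def)
  qed
  have "down_closed ({} :: 'v set)" by (simp add: down_closed_def)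
  then have "subring R" using S_sub[rule_format, of "{}"] R by simp
  then interpret skew R x \<Omega> \<alpha> \<delta>
    using Omega S_top S_sub S_ore delta_zero by unfold_locales auto
  have good: "good A" using ess_sp_good[OF ess] by blast
  have "sing_ideal A = A \<inter> ZT R x \<Omega>"
    using good mult_into_A[OF good] S_top
    by (intro sing_ideal_eq[OF Omega subset_refl]) (auto simp: good_def)
  then show ?thesis
    using uniform_AL[OF good] essential_AL[OF good] enough_uniform_and_udim[OF good] by blast
qed

end
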